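(* Let $\mathcal{L}=(i_1,\ldots,i_k)$ be a signature with $i_k\ge 1$ and let $S\subseteq\mathbb{N}$. Let $\mathbf{X}=(X_t,t\ge0)$ be a combinatorial Lévy process on $\mathcal{L}_S$ with rate measure $\mu$. Then $\mathbf{X}=_{\mathcal D}\mathbf{X}^*_\mu$, where $\mathbf{X}^*_\mu$ is a $\mu$-canonical Lévy process. Moreover, every combinatorial Lévy process $\mathbf{X}$ on $\mathcal{L}_S$ has the same finite-dimensional distributions as some $\mu$-canonical Lévy process corresponding to a measure $\mu$ on $\mathcal{L}_S$ satisfying $$\mu(\{\mathbf{0}_S^{\mathcal{L}}\})=0\quad\text{and}\quad \mu(\{M^*\in\mathcal{L}_S: M^*|_{S\cap[n]}\neq \mathbf{0}^{\mathcal{L}}_{S\cap[n]}\})<\infty\ \text{ for all } n\in\mathbb{N}.$$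
   Context: A signature is a finite list $\mathcal{L}=(i_1,\ldots,i_k)$ of integers $0\le i_1\le\cdots\le i_k$. For $S\subseteq\mathbb{N}=\{1,2,\ldots\}$, an $\mathcal{L}$-structure over $S$ is $M=(S;M_1,\ldots,M_k)$ with $M_j\subseteq S^{i_j}$ for each $j$ (with $S^0:=\{\odot\}$ a one-point set); $\mathcal{L}_S$ is the set of these. $\mathbf{0}_S^{\mathcal{L}}=(S;\emptyset,\ldots,\emptyset)$. The increment $M\triangle M'\in\mathcal{L}_S$ of $M,M'\in\mathcal{L}_S$ is the componentwise symmetric difference. For $S'\subseteq S$, $M|_{S'}=(S';M_1\cap S'^{i_1},\ldots,M_k\cap S'^{i_k})$; $[n]=\{1,\ldots,n\}$. If $S$ is finite, $\mathcal{L}_S$ has the discrete topology; if $S$ is infinite, it has the product discrete topology (convergence means eventual agreement of the restrictions to $S\cap[n]$ for each $n$; for $S=\mathbb{N}$ it is induced by $d(M,M')=1/(1+\sup\{n: M|_{[n]}=M'|_{[n]}\})$). $\mathcal{L}_S$ carries its Borel $\sigma$-field. A combinatorial Lévy process on $\mathcal{L}_S$ is a process $(X_t)_{t\ge0}$ with values in $\mathcal{L}_S$ such that $X_0=\mathbf{0}_S^{\mathcal{L}}$; $X_{t+s}\triangle X_s=_{\mathcal D}X_t$ for all $s,t\ge 0$; $X_{t_1}\triangle X_{t_0},\ldots,X_{t_r}\triangle X_{t_{r-1}}$ are independent for all $0\le t_0\le\cdots\le t_r<\infty$; and $t\mapsto X_t$ is càdlàg. The rate measure of $\mathbf{X}$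 is the unique measure $\mu$ on $\mathcal{L}_S$ with $\mu(\{\mathbf{0}_S^{\mathcal{L}}\})=0$ and $\mu(\{M^*: M^*|_{S\cap[n]}\neq \mathbf{0}^{\mathcal{L}}_{S\cap[n]}\})<\infty$ for all $n\in\mathbb{N}$, such that $\frac1t\mathbb{P}\{X_t\in d\Delta\}\to\mu(d\Delta)$ vaguely on $\mathcal{L}_S\setminus\{\mathbf{0}_S^{\mathcal{L}}\}$ as $t\downarrow0$. For a measure $\mu$ on $\mathcal{L}_S$ satisfying these two conditions, the $\mu$-canonical Lévy process $\mathbf{X}^*_\mu=(X^*_t,t\ge0)$ is built from a Poisson point process $\mathbf{\Delta}^*=\{(t,\Delta^*_t)\}\subseteq[0,\infty)\times\mathcal{L}_S$ with intensity $dt\otimes\mu$: for each $n$, $\mathbf{X}^{*n}_\mu$ on $\mathcal{L}_{S\cap[n]}$ has $X_0^{*n}=\mathbf{0}^{\mathcal{L}}_{S\cap[n]}$, jumps $X_t^{*n}=X_{t-}^{*n}\triangle\Delta_t^*|_{S\cap[n]}$ at each atom $(t,\Delta^*_t)$ with $\Delta_t^*|_{S\cap[n]}\ne\mathbf{0}^{\mathcal{L}}_{S\cap[n]}$, and is constant between such times; $\mathbf{X}^*_\mu$ is the unique process whose restriction to $S\cap[n]$ is $\mathbf{X}_\mu^{*n}$ for every $n$. For processes, $=_{\mathcal D}$ means equality of all finite-dimensional distributions. *)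

theory Defs
  imports "HOL-Probability.Probability"
begin

section \<open>Structures over a signature\<close>

text \<open>
  A signature is a sorted list \<open>L\<close> of arities. A structure is a pair of its base set and its list
  of relations; an \<open>i\<close>-tuple is a list of length \<open>i\<close>, so \<open>tuples S 0 = {[]}\<close> is the one-point set.
\<close>

type_synonym lstruct = "nat set \<times> nat list set list"

definition tuples :: "nat set \<Rightarrow> nat \<Rightarrow> nat list set" where
  "tuples S i = {xs. set xs \<subseteq> S \<and> length xs = i}"

definition structs :: "nat list \<Rightarrow> nat set \<Rightarrow> lstruct set" where
  "structs L S = {M. fst M = S \<and> length (snd M) = length L \<and>
     (\<forall>j<length L. snd M ! j \<subseteq> tuples S (L ! j))}"

definition zero_struct :: "nat list \<Rightarrow> nat set \<Rightarrow> lstruct" where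
  "zero_struct L S = (S, replicate (length L) {})"

text \<open>The increment is only used for two structures over the same base set.\<close>

definition incr :: "lstruct \<Rightarrow> lstruct \<Rightarrow> lstruct" where
  "incr M N = (fst M, map2 sym_diff (snd M) (snd N))"

text \<open>
  Since \<open>snd M ! j\<close> consists of tuples of length \<open>L ! j\<close>, intersecting it with \<open>lists S'\<close> is the same
  as intersecting it with \<open>tuples S' (L ! j)\<close>.
\<close>

definition restrict_struct :: "lstruct \<Rightarrow> nat set \<Rightarrow> lstruct" where
  "restrict_struct M S' = (S', map (\<lambda>R. R \<inter> lists S') (snd M))"

lemma restrict_struct_eq_tuples:
  assumes "M \<in> structs L S"
  shows "restrict_struct M S' = (S', map2 (\<lambda>i R. R \<inter> tuples S' i) L (snd M))"
proof -
  have len: "length (snd M) = length L"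
    and sub: "\<And>j. j < length L \<Longrightarrow> snd M ! j \<subseteq> tuples S (L ! j)"
    using assms by (auto simp: structs_def)
  have "map (\<lambda>R. R \<inter> lists S') (snd M) = map2 (\<lambda>i R. R \<inter> tuples S' i) L (snd M)"
  proof (rule nth_equalityI)
    fix j assume "j < length (map (\<lambda>R. R \<inter> lists S') (snd M))"
    then show "map (\<lambda>R. R \<inter> lists S') (snd M) ! j = map2 (\<lambda>i R. R \<inter> tuples S' i) L (snd M) ! j"
      using len sub[of j] by (auto simp: tuples_def)
  qed (simp add: len)
  then show ?thesis by (simp add: restrict_struct_def)
qed

section \<open>Topology and Borel sets\<close>

text \<open>
  The topology is generated by the sets of structures with a prescribed restriction to
  \<open>S \<inter> {1..n}\<close>. For finite \<open>S\<close> it is discrete, and in general convergence is eventual agreement of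
  all these restrictions; both are proved below.
\<close>

definition struct_top :: "nat list \<Rightarrow> nat set \<Rightarrow> lstruct topology" where
  "struct_top L S = topology_generated_by
     {{M \<in> structs L S. restrict_struct M (S \<inter> {1..n}) = A} | n A. True}"

definition struct_borel :: "nat list \<Rightarrow> nat set \<Rightarrow> lstruct measure" where
  "struct_borel L S = sigma (structs L S) {U. openin (struct_top L S) U}"

lemma topspace_struct_top: "topspace (struct_top L S) = structs L S"
  unfolding struct_top_def topology_generated_by_topspace by blast

lemma restrict_struct_self: "M \<in> structs L S \<Longrightarrow> restrict_struct M S = M"
  by (auto simp: restrict_struct_def structs_def tuples_def prod_eq_iff list_eq_iff_nth_eq)

lemma struct_top_finite:
  assumes "finite S" "S \<subseteq> {1..}"
  shows "struct_top L S = discrete_topology (structs L S)"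
proof -
  obtain n where n: "S \<subseteq> {1..n}"
  proof
    show "S \<subseteq> {1..Max S}" using assms by fastforce
  qed
  have "openin (struct_top L S) {M}" if "M \<in> structs L S" for M
  proof -
    have "{M} = {M' \<in> structs L S. restrict_struct M' (S \<inter> {1..n}) = M}"
      using that n by (auto simp: Int_absorb2 restrict_struct_self)
    also have "openin (struct_top L S) \<dots>"
      unfolding struct_top_def by (rule topology_generated_by_Basis) blast
    finally show ?thesis .
  qed
  then show ?thesis
    by (metis discrete_topology_unique topspace_struct_top)
qed

lemma limitin_struct_top_iff:
  "limitin (struct_top L S) f M F \<longleftrightarrow>
     M \<in> structs L S \<and> (\<forall>\<^sub>F x in F. f x \<in> structs L S) \<and>
     (\<forall>n. \<forall>\<^sub>F x in F. restrict_struct (f x) (S \<inter> {1..n}) = restrict_struct M (S \<inter> {1..n}))"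
  (is "?L \<longleftrightarrow> ?R")
proof
  assume L: ?L
  then have M: "M \<in> structs L S" by (simp add: limitin_def topspace_struct_top)
  have ev: "\<forall>\<^sub>F x in F. f x \<in> structs L S \<and>
      restrict_struct (f x) (S \<inter> {1..n}) = restrict_struct M (S \<inter> {1..n})" for n
  proof -
    let ?U = "{N \<in> structs L S. restrict_struct N (S \<inter> {1..n}) = restrict_struct M (S \<inter> {1..n})}"
    have "openin (struct_top L S) ?U"
      unfolding struct_top_def by (rule topology_generated_by_Basis) blast
    then have "\<forall>\<^sub>F x in F. f x \<in> ?U"
      using L M unfolding limitin_def by blast
    then show ?thesis by simp
  qed
  have "\<forall>\<^sub>F x in F. f x \<in> structs L S"
    using ev[of 0] by (rule eventually_mono) simp
  moreover have "\<forall>\<^sub>F x in F. restrict_struct (f x) (S \<inter> {1..n}) = restrict_struct M (S \<inter> {1..n})" for n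
    using ev[of n] by (rule eventually_mono) simp
  ultimately show ?R using M by blast
next
  assume R: ?R
  have "\<forall>\<^sub>F x in F. f x \<in> U"
    if "generate_topology_on {{M \<in> structs L S. restrict_struct M (S \<inter> {1..n}) = A} | n A. True} U"
      and "M \<in> U" for U
    using that
  proof induction
    case Empty then show ?case by simp
  next
    case (Int a b) then show ?case by (auto intro: eventually_conj)
  next
    case (UN K)
    then obtain k where "k \<in> K" "M \<in> k" by blast
    with UN.IH have "\<forall>\<^sub>F x in F. f x \<in> k" by blast
    then show ?case by (rule eventually_mono) (use \<open>k \<in> K\<close> in blast)
  next
    case (Basis s)
    then obtain n where s: "s = {N \<in> structs L S. restrict_struct N (S \<inter> {1..n}) =
        restrict_struct M (S \<inter> {1..n})}" by blast
    from R have "\<forall>\<^sub>F x in F. f x \<in> structs L S \<and>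
        restrict_struct (f x) (S \<inter> {1..n}) = restrict_struct M (S \<inter> {1..n})"
      by (auto intro: eventually_conj)
    then show ?case by (rule eventually_mono) (simp add: s)
  qed
  then show ?L
    using R unfolding limitin_def topspace_struct_top
    by (auto simp: struct_top_def openin_topology_generated_by_iff)
qed

section \<open>Combinatorial Levy processes and rate measures\<close>

text \<open>
  Processes are indexed by \<open>real\<close>; only times \<open>t \<ge> 0\<close> matter. Properties of paths are required
  almost surely.
\<close>

locale comb_levy_process = prob_space P
  for P :: "'a measure" and L :: "nat list" and S :: "nat set"
    and X :: "real \<Rightarrow> 'a \<Rightarrow> lstruct" +
  assumes random_var: "t \<ge> 0 \<Longrightarrow> X t \<in> P \<rightarrow>\<^sub>M struct_borel L S"
    and start: "AE \<omega> in P. X 0 \<omega> = zero_struct L S"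
    and stationary_increments: "s \<ge> 0 \<Longrightarrow> t \<ge> 0 \<Longrightarrow>
      distr P (struct_borel L S) (\<lambda>\<omega>. incr (X (t + s) \<omega>) (X s \<omega>)) =
      distr P (struct_borel L S) (X t)"
    and independent_increments: "0 \<le> \<tau> 0 \<Longrightarrow> mono_on {..r} \<tau> \<Longrightarrow>
      indep_vars (\<lambda>_. struct_borel L S) (\<lambda>i \<omega>. incr (X (\<tau> (Suc i)) \<omega>) (X (\<tau> i) \<omega>)) {..<r}"
    and cadlag: "AE \<omega> in P.
      (\<forall>t\<ge>0. limitin (struct_top L S) (\<lambda>s. X s \<omega>) (X t \<omega>) (at_right t)) \<and>
      (\<forall>t>0. \<exists>M. limitin (struct_top L S) (\<lambda>s. X s \<omega>) M (at_left t))"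

definition levy_measure :: "nat list \<Rightarrow> nat set \<Rightarrow> lstruct measure \<Rightarrow> bool" where
  "levy_measure L S \<mu> \<longleftrightarrow>
     sets \<mu> = sets (struct_borel L S) \<and>
     emeasure \<mu> {zero_struct L S} = 0 \<and>
     (\<forall>n\<ge>1. emeasure \<mu> {M \<in> structs L S.
        restrict_struct M (S \<inter> {1..n}) \<noteq> zero_struct L (S \<inter> {1..n})} < \<infinity>)"

definition nonzero_top :: "nat list \<Rightarrow> nat set \<Rightarrow> lstruct topology" where
  "nonzero_top L S = subtopology (struct_top L S) (structs L S - {zero_struct L S})"

definition test_function :: "nat list \<Rightarrow> nat set \<Rightarrow> (lstruct \<Rightarrow> real) \<Rightarrow> bool" where
  "test_function L S f \<longleftrightarrow>
     continuous_map (nonzero_top L S) euclideanreal f \<and>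
     (\<exists>K. compactin (nonzero_top L S) K \<and> (\<forall>M \<in> topspace (nonzero_top L S) - K. f M = 0))"

text \<open>
  The last clause is vague convergence of \<open>(1 / t) P(X t \<in> _)\<close> to \<open>\<mu>\<close> on the nonzero structures, as
  \<open>t\<close> decreases to 0.
\<close>

definition is_rate_measure ::
  "nat list \<Rightarrow> nat set \<Rightarrow> 'a measure \<Rightarrow> (real \<Rightarrow> 'a \<Rightarrow> lstruct) \<Rightarrow> lstruct measure \<Rightarrow> bool" where
  "is_rate_measure L S P X \<mu> \<longleftrightarrow>
     levy_measure L S \<mu> \<and>
     (\<forall>f. test_function L S f \<longrightarrow>
       ((\<lambda>t. (1 / t) *
           (LINT M : topspace (nonzero_top L S) | distr P (struct_borel L S) (X t). f M))
         \<longlongrightarrow> (LINT M : topspace (nonzero_top L S) | \<mu>. f M)) (at_right 0))"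

section \<open>Poisson point processes and canonical processes\<close>

text \<open>
  A point process is a random set of points, which is adequate for a Poisson point process whose
  intensity is diffuse, such as \<open>dt \<otimes> \<mu>\<close>. The measure \<open>count_space UNIV\<close> counts points with values
  in \<open>[0, \<infinity>]\<close>.
\<close>

definition poisson_point_process ::
  "'b measure \<Rightarrow> 'a measure \<Rightarrow> ('a \<Rightarrow> 'b set) \<Rightarrow> bool" where
  "poisson_point_process \<nu> P \<Delta> \<longleftrightarrow>
     prob_space P \<and>
     (\<forall>\<omega>\<in>space P. \<Delta> \<omega> \<subseteq> space \<nu>) \<and>
     (\<forall>A\<in>sets \<nu>. (\<lambda>\<omega>. emeasure (count_space UNIV) (\<Delta> \<omega> \<inter> A)) \<in> borel_measurable P) \<and>
     (\<forall>A\<in>sets \<nu>. emeasure \<nu> A < \<infinity> \<longrightarrow>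
       (\<forall>k::nat. measure P {\<omega> \<in> space P. emeasure (count_space UNIV) (\<Delta> \<omega> \<inter> A) = of_nat k} =
          measure \<nu> A ^ k / fact k * exp (- measure \<nu> A))) \<and>
     (\<forall>A\<in>sets \<nu>. emeasure \<nu> A = \<infinity> \<longrightarrow>
       (AE \<omega> in P. emeasure (count_space UNIV) (\<Delta> \<omega> \<inter> A) = \<infinity>)) \<and>
     (\<forall>(m::nat) A. (\<forall>i<m. A i \<in> sets \<nu>) \<and> disjoint_family_on A {..<m} \<longrightarrow>
       prob_space.indep_vars P (\<lambda>_. borel)
         (\<lambda>i \<omega>. emeasure (count_space UNIV) (\<Delta> \<omega> \<inter> A i)) {..<m})"

definition jump_intensity :: "lstruct measure \<Rightarrow> (real \<times> lstruct) measure" where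
  "jump_intensity \<mu> = restrict_space lborel {0..} \<Otimes>\<^sub>M \<mu>"

text \<open>
  \<open>driven_path L S n D x\<close>: the path \<open>x\<close> of structures over \<open>S \<inter> {1..n}\<close> starts at zero, is
  incremented by the restricted atom at each atom of \<open>D\<close> whose restriction is nonzero, and is
  constant in between. The state space is discrete, so the left limit of \<open>x\<close> at \<open>t\<close> is the value that \<open>x s\<close>
  eventually has as \<open>s\<close> increases to \<open>t\<close>.
\<close>

definition driven_path ::
  "nat list \<Rightarrow> nat set \<Rightarrow> nat \<Rightarrow> (real \<times> lstruct) set \<Rightarrow> (real \<Rightarrow> lstruct) \<Rightarrow> bool" where
  "driven_path L S n D x \<longleftrightarrow>
     x 0 = zero_struct L (S \<inter> {1..n}) \<and>
     (\<forall>(t, M)\<in>D. restrict_struct M (S \<inter> {1..n}) \<noteq> zero_struct L (S \<inter> {1..n}) \<longrightarrow>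
       (\<exists>Y. (\<forall>\<^sub>F s in at_left t. x s = Y) \<and> x t = incr Y (restrict_struct M (S \<inter> {1..n})))) \<and>
     (\<forall>s t. 0 \<le> s \<and> s \<le> t \<and>
       (\<forall>(u, M)\<in>D. s < u \<and> u \<le> t \<longrightarrow>
         restrict_struct M (S \<inter> {1..n}) = zero_struct L (S \<inter> {1..n})) \<longrightarrow> x t = x s)"

text \<open>
  The clauses of \<open>driven_path\<close> determine \<open>x\<close> on \<open>[0, \<infinity>)\<close> whenever the atoms with nonzero restriction
  are locally finite in time, have distinct times and do not occur at time 0, which is almost
  surely the case.
\<close>

definition canonical_levy_process ::
  "nat list \<Rightarrow> nat set \<Rightarrow> lstruct measure \<Rightarrow>
   'a measure \<Rightarrow> ('a \<Rightarrow> (real \<times> lstruct) set) \<Rightarrow> (real \<Rightarrow> 'a \<Rightarrow> lstruct) \<Rightarrow> bool" where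
  "canonical_levy_process L S \<mu> P \<Delta> X \<longleftrightarrow>
     levy_measure L S \<mu> \<and>
     poisson_point_process (jump_intensity \<mu>) P \<Delta> \<and>
     (\<forall>t\<ge>0. X t \<in> P \<rightarrow>\<^sub>M struct_borel L S) \<and>
     (AE \<omega> in P. \<forall>n\<ge>1. driven_path L S n (\<Delta> \<omega>) (\<lambda>t. restrict_struct (X t \<omega>) (S \<inter> {1..n})))"

definition same_fdds ::
  "'s measure \<Rightarrow> 'a measure \<Rightarrow> (real \<Rightarrow> 'a \<Rightarrow> 's) \<Rightarrow> 'b measure \<Rightarrow> (real \<Rightarrow> 'b \<Rightarrow> 's) \<Rightarrow> bool" where
  "same_fdds N P X Q Y \<longleftrightarrow>
     (\<forall>J. finite J \<and> J \<subseteq> {0..} \<longrightarrow>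
       distr P (PiM J (\<lambda>_. N)) (\<lambda>\<omega>. \<lambda>t\<in>J. X t \<omega>) =
       distr Q (PiM J (\<lambda>_. N)) (\<lambda>\<omega>. \<lambda>t\<in>J. Y t \<omega>))"

text \<open>
  HOL cannot quantify existentially over the type of sample points, so existence of a canonical
  process is stated on one fixed type that is rich enough to enumerate the atoms of the process.
\<close>

type_synonym atom_sequence = "nat \<Rightarrow> real \<times> lstruct"

end

theory Submission
  imports Defs
begin

text \<open>
  Encode a structure over \<open>S\<close> by the set of its coordinates, the pairs of a relation index and a tuple
  in that relation. The increment becomes the symmetric difference, so the structures form a compact
  group in which every element is its own inverse. The law of a random element of such a group is
  governed by its characters, the continuous homomorphisms \<open>\<psi>\<close> into \<open>{1, -1}\<close>: the indicator of an event
  that depends on finitely many coordinates is a linear combination of characters.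

  Let \<open>X\<close> be a combinatorial Levy process and \<open>\<psi>\<close> a character. Stationary independent increments make
  \<open>t \<mapsto> E \<psi>(X t)\<close> multiplicative, and right continuity of the paths makes it tend to 1 at time 0; hence
  it equals \<open>exp (- \<kappa> t)\<close> for some \<open>\<kappa> \<ge> 0\<close> (\<open>character_exponent\<close>). The set \<open>{\<psi> = -1}\<close> is clopen and does not
  contain the zero structure, so \<open>(1 - \<psi>) / 2\<close> is a test function for vague convergence. A rate measure
  \<open>\<mu>\<close> therefore satisfies \<open>\<kappa> = 2 \<mu>{\<psi> = -1}\<close> (\<open>rate_measure_has_exponents\<close>). Expectations of products of characters of
  increments are now known, and they determine the finite-dimensional distributions
  (\<open>has_exponents_imp_same_fdds\<close>).

  In a canonical process driven by a Poisson point process, \<open>\<psi>\<close> of an increment over \<open>(s, t]\<close> is \<open>(-1)\<close> to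
  the power of the number of atoms in \<open>(s, t] \<times> {\<psi> = -1}\<close>. That number is Poisson with mean
  \<open>(t - s) \<mu>{\<psi> = -1}\<close>, and a Poisson variable \<open>K\<close> with mean \<open>l\<close> has \<open>E (-1)^K = exp (- 2 l)\<close>. So the
  canonical process has the same exponents (\<open>canonical_has_exponents\<close>).

  Two existence statements remain. For an arbitrary Levy process, \<open>P(X t \<in> C) / t\<close> converges for every
  cylinder \<open>C\<close> that does not contain the zero structure, because the indicator of \<open>C\<close> is a linear combination
  of characters. The limit is additive in \<open>C\<close>, by compactness it is countably additive, and
  Caratheodory's theorem extends it to a measure \<open>\<mu>\<close> (\<open>ex_levy_measure\<close>). Conversely, every admissible \<open>\<mu>\<close>
  drives a canonical process (\<open>ex_canonical_levy_process\<close>). Its Poisson point process has independent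
  Poisson numbers of independent points in the blocks of a countable partition into sets of finite
  intensity, and its Poisson and independence properties follow from one computation of a joint
  generating function (\<open>joint_generating_function\<close>). The value at time \<open>t\<close> contains a coordinate iff an odd
  number of atoms up to time \<open>t\<close> contain it.
\<close>

section \<open>Structures as sets of coordinates\<close>

text \<open>
  The coordinates of a structure over \<open>S\<close>: a structure corresponds to the set of coordinates that it
  has, with the increment as symmetric difference and restriction as intersection.
\<close>

definition coords :: "nat list \<Rightarrow> nat set \<Rightarrow> (nat \<times> nat list) set" where
  "coords L S = {(j, xs). j < length L \<and> xs \<in> tuples S (L ! j)}"

definition has_tuple :: "nat \<times> nat list \<Rightarrow> lstruct \<Rightarrow> bool" where
  "has_tuple a M \<longleftrightarrow> snd a \<in> snd M ! fst a"

definition struct_of :: "nat list \<Rightarrow> nat set \<Rightarrow> (nat \<times> nat list) set \<Rightarrow> lstruct" where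
  "struct_of L S C = (S, map (\<lambda>j. {xs \<in> tuples S (L ! j). (j, xs) \<in> C}) [0..<length L])"

abbreviation initial :: "nat set \<Rightarrow> nat \<Rightarrow> nat set" where
  "initial S n \<equiv> S \<inter> {1..n}"

lemma struct_of_in_structs: "struct_of L S C \<in> structs L S"
  by (auto simp: struct_of_def structs_def)

lemma has_tuple_struct_of: "a \<in> coords L S \<Longrightarrow> has_tuple a (struct_of L S C) \<longleftrightarrow> a \<in> C"
  by (auto simp: has_tuple_def struct_of_def coords_def)

lemma structs_eqI:
  assumes "M \<in> structs L S" "N \<in> structs L S" "\<And>a. a \<in> coords L S \<Longrightarrow> has_tuple a M = has_tuple a N"
  shows "M = N"
proof -
  have "snd M = snd N"
  proof (rule nth_equalityI)
    show "length (snd M) = length (snd N)" using assms by (auto simp: structs_def)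
    fix j assume j: "j < length (snd M)"
    with assms have jL: "j < length L" by (auto simp: structs_def)
    have "xs \<in> snd M ! j \<longleftrightarrow> xs \<in> snd N ! j" for xs
    proof (cases "xs \<in> tuples S (L ! j)")
      case True
      then show ?thesis using assms(3)[of "(j, xs)"] jL by (auto simp: coords_def has_tuple_def)
    next
      case False
      then show ?thesis using assms(1,2) jL by (auto simp: structs_def)
    qed
    then show "snd M ! j = snd N ! j" by blast
  qed
  then show ?thesis using assms(1,2) by (auto simp: structs_def prod_eq_iff)
qed

lemma structs_eq_iff:
  "M \<in> structs L S \<Longrightarrow> N \<in> structs L S \<Longrightarrow> M = N \<longleftrightarrow> (\<forall>a\<in>coords L S. has_tuple a M = has_tuple a N)"
  using structs_eqI by metis

lemma coords_mono: "S \<subseteq> S' \<Longrightarrow> coords L S \<subseteq> coords L S'"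
  by (auto simp: coords_def tuples_def)

lemma initial_mono: "m \<le> n \<Longrightarrow> coords L (initial S m) \<subseteq> coords L (initial S n)"
  by (intro coords_mono) auto

lemma initial_coords: "a \<in> coords L (initial S n) \<Longrightarrow> a \<in> coords L S"
  using coords_mono[of "initial S n" S L] by auto

lemma finite_coords: "finite S \<Longrightarrow> finite (coords L S)"
proof -
  assume "finite S"
  have "coords L S = (SIGMA j:{..<length L}. tuples S (L ! j))" by (auto simp: coords_def)
  then show ?thesis using finite_lists_length_eq[OF \<open>finite S\<close>] by (auto simp: tuples_def)
qed

lemma coords_eventually:
  assumes "S \<subseteq> {1..}" "a \<in> coords L S"
  shows "\<exists>n\<ge>1. a \<in> coords L (initial S n)"
proof -
  obtain j xs where a: "a = (j, xs)" by force
  let ?n = "Max (insert 1 (set xs))"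
  have "x \<le> ?n" if "x \<in> set xs" for x using that by simp
  then have "a \<in> coords L (initial S ?n)"
    using assms by (auto simp: a coords_def tuples_def)
  moreover have "1 \<le> ?n" by simp
  ultimately show ?thesis by blast
qed

lemma has_tuple_zero_struct: "a \<in> coords L S' \<Longrightarrow> \<not> has_tuple a (zero_struct L S)"
  by (auto simp: has_tuple_def zero_struct_def coords_def)

lemma zero_struct_in_structs: "zero_struct L S \<in> structs L S"
  by (auto simp: structs_def zero_struct_def)

lemma incr_in_structs: "M \<in> structs L S \<Longrightarrow> N \<in> structs L S \<Longrightarrow> incr M N \<in> structs L S"
  by (simp add: structs_def incr_def) blast

lemma has_tuple_incr:
  assumes "M \<in> structs L S" "N \<in> structs L S" "a \<in> coords L S"
  shows "has_tuple a (incr M N) \<longleftrightarrow> has_tuple a M \<noteq> has_tuple a N"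
  using assms by (auto simp: structs_def incr_def has_tuple_def coords_def)

lemma restrict_in_structs: "M \<in> structs L S \<Longrightarrow> S' \<subseteq> S \<Longrightarrow> restrict_struct M S' \<in> structs L S'"
  by (auto simp: structs_def restrict_struct_def tuples_def)

lemma has_tuple_restrict:
  assumes "M \<in> structs L S" "a \<in> coords L S'"
  shows "has_tuple a (restrict_struct M S') \<longleftrightarrow> has_tuple a M"
  using assms by (auto simp: structs_def restrict_struct_def has_tuple_def coords_def tuples_def)

lemma restrict_eq_iff:
  assumes "M \<in> structs L S" "N \<in> structs L S" "S' \<subseteq> S"
  shows "restrict_struct M S' = restrict_struct N S' \<longleftrightarrow> (\<forall>a\<in>coords L S'. has_tuple a M = has_tuple a N)"
  by (simp add: structs_eq_iff[OF restrict_in_structs[OF assms(1,3)] restrict_in_structs[OF assms(2,3)]]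
     has_tuple_restrict[OF assms(1)] has_tuple_restrict[OF assms(2)])

lemma restrict_zero_iff:
  assumes "M \<in> structs L S" "S' \<subseteq> S"
  shows "restrict_struct M S' = zero_struct L S' \<longleftrightarrow> (\<forall>a\<in>coords L S'. \<not> has_tuple a M)"
  by (simp add: structs_eq_iff[OF restrict_in_structs[OF assms] zero_struct_in_structs]
     has_tuple_restrict[OF assms(1)] has_tuple_zero_struct)

text \<open>
  The basic neighbourhoods of \<open>M\<close>: agreement with \<open>M\<close> on the finitely many coordinates of level \<open>n\<close>.
\<close>

definition cyl :: "nat list \<Rightarrow> nat set \<Rightarrow> nat \<Rightarrow> lstruct \<Rightarrow> lstruct set" where
  "cyl L S n M = {N \<in> structs L S. \<forall>a\<in>coords L (initial S n). has_tuple a N = has_tuple a M}"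

lemma cyl_eq_restrict:
  "M \<in> structs L S \<Longrightarrow> cyl L S n M = {N \<in> structs L S. restrict_struct N (initial S n) = restrict_struct M (initial S n)}"
  unfolding cyl_def using restrict_eq_iff[of _ L S M "initial S n"] by auto

lemma cyl_mono: "m \<le> n \<Longrightarrow> cyl L S n M \<subseteq> cyl L S m M"
  unfolding cyl_def using initial_mono[of m n L S] by auto

text \<open>
  Cylinders shrink as the level grows, so the cylinders around a point are closed under finite
  intersections up to refinement and form a neighbourhood base.
\<close>

lemma openin_struct_top_iff:
  "openin (struct_top L S) U \<longleftrightarrow> U \<subseteq> structs L S \<and> (\<forall>M\<in>U. \<exists>n\<ge>1. cyl L S n M \<subseteq> U)"
proof
  assume U: "openin (struct_top L S) U"
  then have sub: "U \<subseteq> structs L S" using openin_subset topspace_struct_top by metis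
  from U have "generate_topology_on {{M \<in> structs L S. restrict_struct M (S \<inter> {1..n}) = A} | n A. True} U"
    by (simp add: struct_top_def openin_topology_generated_by_iff)
  then have "\<forall>M\<in>U. \<exists>n\<ge>1. cyl L S n M \<subseteq> U"
  proof induction
    case (Int a b)
    show ?case
    proof
      fix M assume "M \<in> a \<inter> b"
      then obtain m n where "m \<ge> 1" "cyl L S m M \<subseteq> a" "n \<ge> 1" "cyl L S n M \<subseteq> b" using Int.IH by (meson IntD1 IntD2)
      then show "\<exists>n\<ge>1. cyl L S n M \<subseteq> a \<inter> b"
        using cyl_mono[of m "max m n" L S M] cyl_mono[of n "max m n" L S M]
        by (intro exI[of _ "max m n"]) auto
    qed
  next
    case (UN K)
    then show ?case by (meson Union_iff Sup_upper subset_trans)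
  next
    case (Basis s)
    then obtain n A where s: "s = {M \<in> structs L S. restrict_struct M (initial S n) = A}" by blast
    show ?case
    proof
      fix M assume "M \<in> s"
      then have "cyl L S n M = s" using s cyl_eq_restrict[of M L S n] by auto
      then show "\<exists>n\<ge>1. cyl L S n M \<subseteq> s" using cyl_mono[of n "max 1 n" L S M] 
        by (intro exI[of _ "max 1 n"]) auto
    qed
  qed simp
  with sub show "U \<subseteq> structs L S \<and> (\<forall>M\<in>U. \<exists>n\<ge>1. cyl L S n M \<subseteq> U)" by blast
next
  assume R: "U \<subseteq> structs L S \<and> (\<forall>M\<in>U. \<exists>n\<ge>1. cyl L S n M \<subseteq> U)"
  have "\<exists>T. openin (struct_top L S) T \<and> M \<in> T \<and> T \<subseteq> U" if M: "M \<in> U" for M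
  proof -
    obtain n where n: "cyl L S n M \<subseteq> U" using R M by blast
    have "openin (struct_top L S) (cyl L S n M)"
      using R M unfolding struct_top_def
      by (subst cyl_eq_restrict) (blast, rule topology_generated_by_Basis, blast)
    moreover have "M \<in> cyl L S n M" using R M by (auto simp: cyl_def)
    ultimately show ?thesis using n by blast
  qed
  then show "openin (struct_top L S) U" by (subst openin_subopen) blast
qed

lemma space_struct_borel: "space (struct_borel L S) = structs L S"
  unfolding struct_borel_def by (rule space_measure_of) (auto simp: openin_struct_top_iff)

lemma open_in_struct_borel: "openin (struct_top L S) U \<Longrightarrow> U \<in> sets (struct_borel L S)"
  unfolding struct_borel_def by (subst sets_measure_of) (auto simp: openin_struct_top_iff)

lemma openin_has_tuple:
  assumes "S \<subseteq> {1..}" "a \<in> coords L S"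
  shows "openin (struct_top L S) {M \<in> structs L S. has_tuple a M}"
  using coords_eventually[OF assms] by (auto simp: openin_struct_top_iff cyl_def)

lemma has_tuple_in_borel:
  assumes "S \<subseteq> {1..}" "a \<in> coords L S"
  shows "{M \<in> structs L S. has_tuple a M} \<in> sets (struct_borel L S)"
  by (rule open_in_struct_borel[OF openin_has_tuple[OF assms]])

lemma cyl_depends: "cyl L S n M = cyl L S n (struct_of L S {a \<in> coords L (initial S n). has_tuple a M})"
proof -
  have "has_tuple a (struct_of L S {a \<in> coords L (initial S n). has_tuple a M}) = has_tuple a M"
    if "a \<in> coords L (initial S n)" for a
    using has_tuple_struct_of[OF initial_coords[OF that]] that by simp
  then show ?thesis unfolding cyl_def by simp
qed

lemma countable_cyls: "countable {cyl L S n M | n M. True}"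
proof -
  have "{cyl L S n M | n M. True} \<subseteq>
     (\<Union>n. (\<lambda>C. cyl L S n (struct_of L S C)) ` Pow (coords L (initial S n)))" (is "_ \<subseteq> ?R")
  proof
    fix A assume "A \<in> {cyl L S n M | n M. True}"
    then obtain n M where A: "A = cyl L S n M" by blast
    let ?C = "{a \<in> coords L (initial S n). has_tuple a M}"
    have "A = cyl L S n (struct_of L S ?C)" unfolding A by (rule cyl_depends)
    then show "A \<in> ?R" by blast
  qed
  moreover have "countable \<dots>"
    by (intro countable_UN countable_image countableI_type, rule countable_finite) (simp add: finite_coords)
  ultimately show ?thesis by (rule countable_subset)
qed

text \<open>
  There are only countably many cylinders, since each level has finitely many coordinates. An open set
  is thus a countable union of cylinders, and each cylinder is a finite Boolean combination of
  coordinate events.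
\<close>

lemma measurable_struct_borelI:
  assumes S: "S \<subseteq> {1..}" and f: "\<And>\<omega>. \<omega> \<in> space P \<Longrightarrow> f \<omega> \<in> structs L S"
    and h: "\<And>a. a \<in> coords L S \<Longrightarrow> {\<omega> \<in> space P. has_tuple a (f \<omega>)} \<in> sets P"
  shows "f \<in> P \<rightarrow>\<^sub>M struct_borel L S"
  unfolding struct_borel_def
proof (rule measurable_measure_of)
  show "{U. openin (struct_top L S) U} \<subseteq> Pow (structs L S)" by (auto simp: openin_struct_top_iff)
  show "f \<in> space P \<rightarrow> structs L S" using f by blast
  fix U assume "U \<in> {U. openin (struct_top L S) U}"
  then have U': "U \<subseteq> structs L S" "\<forall>M\<in>U. \<exists>n\<ge>1. cyl L S n M \<subseteq> U"
    by (simp_all add: openin_struct_top_iff)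
  have cyl: "f -` cyl L S n M \<inter> space P \<in> sets P" for n M
  proof -
    have "f -` cyl L S n M \<inter> space P = {\<omega> \<in> space P. \<forall>a\<in>coords L (initial S n). has_tuple a (f \<omega>) = has_tuple a M}"
      using f by (auto simp: cyl_def)
    also have "\<dots> \<in> sets P"
    proof (rule sets.sets_Collect_finite_All)
      show "finite (coords L (initial S n))" by (simp add: finite_coords)
      fix a assume "a \<in> coords L (initial S n)"
      then have "{\<omega> \<in> space P. has_tuple a (f \<omega>)} \<in> sets P" using h initial_coords by blast
      from sets.sets_Collect_neg[OF this] this
      show "{\<omega> \<in> space P. has_tuple a (f \<omega>) = has_tuple a M} \<in> sets P" by (cases "has_tuple a M") auto
    qed
    finally show ?thesis .
  qed
  define K where "K = {C \<in> {cyl L S n M | n M. True}. C \<subseteq> U}"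
  have "f -` U \<inter> space P = (\<Union>C\<in>K. f -` C \<inter> space P)"
  proof -
    have "\<exists>C\<in>K. M \<in> C" if MU: "M \<in> U" for M
    proof -
      obtain n where n: "cyl L S n M \<subseteq> U" and M: "M \<in> structs L S"
        using U' MU by blast
      have "M \<in> cyl L S n M" using M by (simp add: cyl_def)
      moreover have "cyl L S n M \<in> K" unfolding K_def using n by blast
      ultimately show ?thesis by blast
    qed
    moreover have "C \<subseteq> U" if "C \<in> K" for C using that by (simp add: K_def)
    ultimately have "U = \<Union>K" by blast
    then show ?thesis by auto
  qed
  also have "\<dots> \<in> sets P"
  proof (rule sets.countable_UN')
    show "countable K" unfolding K_def
      by (rule countable_subset[OF _ countable_cyls]) auto
    show "(\<lambda>C. f -` C \<inter> space P) ` K \<subseteq> sets P"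
    proof
      fix B assume "B \<in> (\<lambda>C. f -` C \<inter> space P) ` K"
      then obtain n M where "B = f -` cyl L S n M \<inter> space P" unfolding K_def by blast
      then show "B \<in> sets P" using cyl by simp
    qed
  qed
  finally show "f -` U \<inter> space P \<in> sets P" .
qed

lemma measurable_struct_borelD:
  assumes "S \<subseteq> {1..}" "f \<in> P \<rightarrow>\<^sub>M struct_borel L S"
  shows "\<omega> \<in> space P \<Longrightarrow> f \<omega> \<in> structs L S"
    and "a \<in> coords L S \<Longrightarrow> {\<omega> \<in> space P. has_tuple a (f \<omega>)} \<in> sets P"
proof -
  show st: "f \<omega> \<in> structs L S" if "\<omega> \<in> space P" for \<omega>
    using measurable_space[OF assms(2) that] by (simp add: space_struct_borel)
  assume "a \<in> coords L S"
  from measurable_sets[OF assms(2) has_tuple_in_borel[OF assms(1) this]]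
  show "{\<omega> \<in> space P. has_tuple a (f \<omega>)} \<in> sets P"
    by (rule back_subst[of "\<lambda>A. A \<in> sets P"]) (auto dest: st)
qed

lemma measurable_incr:
  assumes S: "S \<subseteq> {1..}" and f: "f \<in> P \<rightarrow>\<^sub>M struct_borel L S" and g: "g \<in> P \<rightarrow>\<^sub>M struct_borel L S"
  shows "(\<lambda>\<omega>. incr (f \<omega>) (g \<omega>)) \<in> P \<rightarrow>\<^sub>M struct_borel L S"
proof (rule measurable_struct_borelI[OF S])
  note fD = measurable_struct_borelD[OF S f] and gD = measurable_struct_borelD[OF S g]
  show "incr (f \<omega>) (g \<omega>) \<in> structs L S" if "\<omega> \<in> space P" for \<omega>
    using incr_in_structs fD(1) gD(1) that by blast
  fix a assume a: "a \<in> coords L S"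
  have "{\<omega> \<in> space P. has_tuple a (incr (f \<omega>) (g \<omega>))} =
     sym_diff {\<omega> \<in> space P. has_tuple a (f \<omega>)} {\<omega> \<in> space P. has_tuple a (g \<omega>)}"
    using has_tuple_incr[OF fD(1) gD(1) a] by auto
  then show "{\<omega> \<in> space P. has_tuple a (incr (f \<omega>) (g \<omega>))} \<in> sets P"
    using fD(2)[OF a] gD(2)[OF a] by auto
qed

text \<open>
  The space of structures is a continuous image of a product of two-point spaces, which is compact by
  Tychonoff's theorem.
\<close>

lemma compact_struct_top:
  assumes S: "S \<subseteq> {1..}"
  shows "compact_space (struct_top L S)"
proof -
  let ?T = "product_topology (\<lambda>_. discrete_topology (UNIV :: bool set)) (coords L S)"
  let ?g = "\<lambda>f. struct_of L S {a. f a}"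
  have cs: "compact_space ?T"
    by (simp add: compact_space_product_topology compact_space_discrete_topology)
  have cont: "continuous_map ?T (struct_top L S) ?g"
    unfolding continuous_map_def
  proof (intro conjI allI impI)
    show "?g \<in> topspace ?T \<rightarrow> topspace (struct_top L S)"
      by (auto simp: topspace_struct_top struct_of_in_structs)
    fix U assume U: "openin (struct_top L S) U"
    show "openin ?T {f \<in> topspace ?T. ?g f \<in> U}"
    proof (subst openin_subopen, intro ballI)
      fix f assume f: "f \<in> {f \<in> topspace ?T. ?g f \<in> U}"
      then obtain n where n: "cyl L S n (?g f) \<subseteq> U" using U unfolding openin_struct_top_iff by blast
      let ?V = "\<Pi>\<^sub>E a\<in>coords L S. if a \<in> coords L (initial S n) then {f a} else UNIV"
      have fin: "finite {a. (if a \<in> coords L (initial S n) then {f a} else (UNIV::bool set)) \<noteq> topspace (discrete_topology UNIV)}"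
        by (rule finite_subset[of _ "coords L (initial S n)"]) (auto simp: finite_coords)
      have "openin ?T ?V"
        by (rule product_topology_basis[OF _ fin]) auto
      moreover have "f \<in> ?V" using f by (auto simp: PiE_iff)
      moreover have "?V \<subseteq> {f \<in> topspace ?T. ?g f \<in> U}"
      proof safe
        fix g assume g: "g \<in> ?V"
        show "g \<in> topspace ?T" using g by (auto simp: PiE_iff)
        have "?g g \<in> cyl L S n (?g f)"
          unfolding cyl_def
        proof (safe)
          show "?g g \<in> structs L S" by (rule struct_of_in_structs)
          fix j xs assume a: "(j, xs) \<in> coords L (initial S n)"
          then have "(j, xs) \<in> coords L S" by (rule initial_coords)
          moreover have "g (j, xs) = f (j, xs)" using g a initial_coords[OF a] by (fastforce simp: PiE_iff)
          ultimately show "has_tuple (j, xs) (?g g) \<Longrightarrow> has_tuple (j, xs) (?g f)" "has_tuple (j, xs) (?g f) \<Longrightarrow> has_tuple (j, xs) (?g g)"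
            by (auto simp: has_tuple_struct_of)
        qed
        then show "?g g \<in> U" using n by blast
      qed
      ultimately show "\<exists>V. openin ?T V \<and> f \<in> V \<and> V \<subseteq> {f \<in> topspace ?T. ?g f \<in> U}" by blast
    qed
  qed
  have "?g ` topspace ?T = structs L S"
  proof (intro equalityI subsetI)
    show "M \<in> structs L S" if "M \<in> ?g ` topspace ?T" for M
      using that struct_of_in_structs by auto
    show "M \<in> ?g ` topspace ?T" if M: "M \<in> structs L S" for M
    proof
      let ?f = "restrict (\<lambda>a. has_tuple a M) (coords L S)"
      show "M = ?g ?f"
        by (rule structs_eqI[OF M struct_of_in_structs]) (simp add: has_tuple_struct_of)
      show "?f \<in> topspace ?T" by simp
    qed
  qed
  with image_compactin[OF cs[unfolded compact_space_def] cont]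
  show ?thesis by (simp add: compact_space_def topspace_struct_top)
qed

section \<open>Characters\<close>

text \<open>
  The characters of the group of structures. The last clause, dependence on a finite level only,
  is continuity.
\<close>

definition character :: "nat list \<Rightarrow> nat set \<Rightarrow> (lstruct \<Rightarrow> real) \<Rightarrow> bool" where
  "character L S \<psi> \<longleftrightarrow>
     (\<forall>M\<in>structs L S. \<psi> M \<in> {1, -1}) \<and>
     (\<forall>M\<in>structs L S. \<forall>N\<in>structs L S. \<psi> (incr M N) = \<psi> M * \<psi> N) \<and>
     (\<exists>n\<ge>1. \<forall>M\<in>structs L S. \<forall>N\<in>structs L S.
        (\<forall>a\<in>coords L (initial S n). has_tuple a M = has_tuple a N) \<longrightarrow> \<psi> M = \<psi> N)"

definition sign_at :: "nat \<times> nat list \<Rightarrow> lstruct \<Rightarrow> real" where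
  "sign_at a M = (if has_tuple a M then -1 else 1)"

text \<open>
  The complement of the kernel of a character. All measures below are compared on these sets.
\<close>

definition odd_part :: "nat list \<Rightarrow> nat set \<Rightarrow> (lstruct \<Rightarrow> real) \<Rightarrow> lstruct set" where
  "odd_part L S \<psi> = {M \<in> structs L S. \<psi> M = -1}"

lemma characterD:
  assumes "character L S \<psi>" "M \<in> structs L S"
  shows "\<psi> M = 1 \<or> \<psi> M = -1" "\<psi> M * \<psi> M = 1" "\<bar>\<psi> M\<bar> = 1"
proof -
  have "\<psi> M \<in> {1, -1}" using assms unfolding character_def by blast
  then show "\<psi> M = 1 \<or> \<psi> M = -1" "\<psi> M * \<psi> M = 1" "\<bar>\<psi> M\<bar> = 1" by auto
qed

lemma character_incr:
  "character L S \<psi> \<Longrightarrow> M \<in> structs L S \<Longrightarrow> N \<in> structs L S \<Longrightarrow> \<psi> (incr M N) = \<psi> M * \<psi> N"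
  unfolding character_def by blast

text \<open>
  Every structure is its own inverse, so adding back the increment recovers the value.
\<close>

lemma character_incr_cancel:
  assumes "character L S \<psi>" "M \<in> structs L S" "N \<in> structs L S"
  shows "\<psi> M = \<psi> (incr M N) * \<psi> N"
  using characterD(2)[OF assms(1,3)] by (simp add: character_incr[OF assms])

lemma character_level:
  assumes "character L S \<psi>"
  obtains n where "n \<ge> 1" "\<And>M N. M \<in> structs L S \<Longrightarrow> N \<in> structs L S \<Longrightarrow>
     (\<And>a. a \<in> coords L (initial S n) \<Longrightarrow> has_tuple a M = has_tuple a N) \<Longrightarrow> \<psi> M = \<psi> N"
  using assms unfolding character_def by metis

lemma character_zero: "character L S \<psi> \<Longrightarrow> \<psi> (zero_struct L S) = 1"
proof -
  assume c: "character L S \<psi>"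
  let ?z = "zero_struct L S"
  have z: "?z \<in> structs L S" by (rule zero_struct_in_structs)
  have "incr ?z ?z = ?z"
    by (rule structs_eqI[OF incr_in_structs[OF z z] z]) (simp add: has_tuple_incr[OF z z] has_tuple_zero_struct)
  then have "\<psi> ?z = \<psi> ?z * \<psi> ?z" using character_incr[OF c z z] by simp
  then show ?thesis using characterD(1)[OF c z] by auto
qed

lemma character_one: "character L S (\<lambda>M. 1)"
  by (auto simp: character_def)

lemma character_mult:
  assumes "character L S \<psi>" "character L S \<theta>"
  shows "character L S (\<lambda>M. \<psi> M * \<theta> M)"
proof -
  obtain m where m: "m \<ge> 1" "\<And>M N. M \<in> structs L S \<Longrightarrow> N \<in> structs L S \<Longrightarrow>
     (\<And>a. a \<in> coords L (initial S m) \<Longrightarrow> has_tuple a M = has_tuple a N) \<Longrightarrow> \<psi> M = \<psi> N"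
    using character_level[OF assms(1)] by metis
  obtain n where n: "n \<ge> 1" "\<And>M N. M \<in> structs L S \<Longrightarrow> N \<in> structs L S \<Longrightarrow>
     (\<And>a. a \<in> coords L (initial S n) \<Longrightarrow> has_tuple a M = has_tuple a N) \<Longrightarrow> \<theta> M = \<theta> N"
    using character_level[OF assms(2)] by metis
  have "\<psi> M * \<theta> M = \<psi> N * \<theta> N"
    if M: "M \<in> structs L S" and N: "N \<in> structs L S"
      and h: "\<forall>a\<in>coords L (initial S (max m n)). has_tuple a M = has_tuple a N" for M N
  proof -
    have "\<psi> M = \<psi> N"
      by (rule m(2)[OF M N]) (use h initial_mono[of m "max m n" L S] in auto)
    moreover have "\<theta> M = \<theta> N"
      by (rule n(2)[OF M N]) (use h initial_mono[of n "max m n" L S] in auto)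
    ultimately show ?thesis by simp
  qed
  moreover have "\<psi> M * \<theta> M \<in> {1, -1}" if "M \<in> structs L S" for M
    using characterD(1)[OF assms(1) that] characterD(1)[OF assms(2) that] by auto
  moreover have "max m n \<ge> 1" using m(1) by simp
  moreover have "\<psi> (incr M N) * \<theta> (incr M N) = \<psi> M * \<theta> M * (\<psi> N * \<theta> N)"
    if "M \<in> structs L S" "N \<in> structs L S" for M N
    by (simp add: character_incr[OF assms(1) that] character_incr[OF assms(2) that])
  ultimately show ?thesis unfolding character_def by blast
qed

lemma character_prod:
  "finite I \<Longrightarrow> (\<And>i. i \<in> I \<Longrightarrow> character L S (\<psi> i)) \<Longrightarrow> character L S (\<lambda>M. \<Prod>i\<in>I. \<psi> i M)"
  by (induction I rule: finite_induct) (auto intro: character_one character_mult)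

lemma character_sign_at:
  assumes "S \<subseteq> {1..}" "a \<in> coords L S"
  shows "character L S (sign_at a)"
proof -
  obtain n where "n \<ge> 1" "a \<in> coords L (initial S n)" using coords_eventually[OF assms] by blast
  then have "\<exists>n\<ge>1. \<forall>M\<in>structs L S. \<forall>N\<in>structs L S.
        (\<forall>a\<in>coords L (initial S n). has_tuple a M = has_tuple a N) \<longrightarrow> sign_at a M = sign_at a N"
    unfolding sign_at_def by (intro exI[of _ n]) simp
  then show ?thesis
    unfolding character_def by (auto simp: sign_at_def has_tuple_incr[OF _ _ assms(2)])
qed

lemma openin_character:
  assumes "character L S \<psi>"
  shows "openin (struct_top L S) {M \<in> structs L S. \<psi> M \<in> A}"
proof -
  obtain n where n: "n \<ge> 1" "\<And>M N. M \<in> structs L S \<Longrightarrow> N \<in> structs L S \<Longrightarrow>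
     (\<And>a. a \<in> coords L (initial S n) \<Longrightarrow> has_tuple a M = has_tuple a N) \<Longrightarrow> \<psi> M = \<psi> N"
    using character_level[OF assms] by metis
  have "cyl L S n M \<subseteq> {M \<in> structs L S. \<psi> M \<in> A}" if "M \<in> structs L S" "\<psi> M \<in> A" for M
    unfolding cyl_def using n(2) that by (smt (verit, best) mem_Collect_eq subsetI)
  then show ?thesis unfolding openin_struct_top_iff using n(1) by blast
qed

lemma openin_odd_part: "character L S \<psi> \<Longrightarrow> openin (struct_top L S) (odd_part L S \<psi>)"
  using openin_character[of L S \<psi> "{-1}"] by (simp add: odd_part_def)

lemma odd_part_in_borel: "character L S \<psi> \<Longrightarrow> odd_part L S \<psi> \<in> sets (struct_borel L S)"
  by (rule open_in_struct_borel[OF openin_odd_part])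

lemma measurable_character:
  assumes "character L S \<psi>"
  shows "\<psi> \<in> borel_measurable (struct_borel L S)"
proof (rule measurableI)
  fix A :: "real set"
  have "\<psi> -` A \<inter> space (struct_borel L S) = {M \<in> structs L S. \<psi> M \<in> A}"
    by (auto simp: space_struct_borel)
  then show "\<psi> -` A \<inter> space (struct_borel L S) \<in> sets (struct_borel L S)"
    using open_in_struct_borel[OF openin_character[OF assms]] by simp
qed simp

section \<open>Characters along a Levy process\<close>

text \<open>
  The function is positive, as its values near 0 are positive and \<open>\<phi> t\<close> is a power of \<open>\<phi> (t / n)\<close>.
  Then \<open>- ln \<phi>\<close> is additive and, being nonnegative, monotone; such a function is linear.
\<close>

lemma multiplicative_imp_exp:
  fixes \<phi> :: "real \<Rightarrow> real"
  assumes mult: "\<And>s t. 0 \<le> s \<Longrightarrow> 0 \<le> t \<Longrightarrow> \<phi> (s + t) = \<phi> s * \<phi> t"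
    and le1: "\<And>t. 0 \<le> t \<Longrightarrow> \<phi> t \<le> 1" and zero: "\<phi> 0 = 1"
    and lim: "(\<phi> \<longlongrightarrow> 1) (at_right 0)"
  shows "\<exists>c\<ge>0. \<forall>t\<ge>0. \<phi> t = exp (- c * t)"
proof -
  have pow: "\<phi> (real n * s) = \<phi> s ^ n" if "0 \<le> s" for n s
  proof (induction n)
    case (Suc n)
    have "\<phi> (real (Suc n) * s) = \<phi> (s + real n * s)" by (simp add: algebra_simps)
    then show ?case using mult[of s "real n * s"] Suc that by simp
  qed (simp add: zero)
  have "\<forall>\<^sub>F x in at_right 0. 0 < \<phi> x" using order_tendstoD(1)[OF lim, of 0] by simp
  then obtain d where d: "d > 0" "\<And>x. 0 < x \<Longrightarrow> x < d \<Longrightarrow> 0 < \<phi> x"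
    unfolding eventually_at_right_field by auto
  have pos: "0 < \<phi> t" if "t > 0" for t
  proof -
    obtain n where n: "t / d < real n" using reals_Archimedean2 by blast
    have n0: "n > 0" using n d(1) that by (cases n) (auto simp: field_simps)
    have "t / real n < d" using n n0 d(1) by (simp add: field_simps)
    then have "0 < \<phi> (t / real n)" using d(2) that n0 by simp
    moreover have "\<phi> t = \<phi> (t / real n) ^ n" using pow[of "t / real n" n] that n0 by simp
    ultimately show ?thesis by simp
  qed
  define f where "f t = - ln (\<phi> t)" for t
  have pos': "0 < \<phi> t" if "t \<ge> 0" for t using pos[of t] that zero by (cases "t = 0") auto
  have f0: "0 \<le> f t" if "0 \<le> t" for t
    using le1[OF that] pos'[OF that] by (simp add: f_def)
  have add: "f (s + t) = f s + f t" if "0 \<le> s" "0 \<le> t" for s t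
    using mult[OF that] pos'[OF that(1)] pos'[OF that(2)] by (simp add: f_def ln_mult)
  have mono: "f s \<le> f t" if "0 \<le> s" "s \<le> t" for s t
    using add[of s "t - s"] f0[of "t - s"] that by simp
  have mul: "f (real n * s) = real n * f s" if "0 \<le> s" for n s
    using pow[OF that, of n] pos'[OF that] by (simp add: f_def ln_realpow)
  have frac: "f (real k / real n) = real k / real n * f 1" if "n > 0" for k n
    using mul[of "real k / real n" n] mul[of 1 k] that by (simp add: field_simps)
  have "f t = f 1 * t" if t: "t \<ge> 0" for t
  proof (rule ccontr)
    assume "f t \<noteq> f 1 * t"
    then have e: "0 < \<bar>f t - f 1 * t\<bar>" by simp
    \<comment> \<open>Squeezing \<open>t\<close> between multiples of \<open>1 / n\<close> leaves an error of at most \<open>f 1 / n\<close>.\<close>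
    obtain n where n: "f 1 / \<bar>f t - f 1 * t\<bar> < real n" using reals_Archimedean2 by blast
    have n0: "n > 0" using n f0[of 1] e by (cases n) (auto simp: field_simps)
    define m where "m = nat \<lfloor>real n * t\<rfloor>"
    have m: "real m \<le> real n * t" "real n * t < real m + 1" unfolding m_def using t by auto
    have mt: "real m / real n \<le> t" "t \<le> real (Suc m) / real n"
      using m n0 by (auto simp: field_simps)
    have 1: "real m / real n * f 1 \<le> f t"
      using mono[OF _ mt(1)] frac[OF n0, of m] by simp
    have 2: "f t \<le> real (Suc m) / real n * f 1"
      using mono[OF t mt(2)] frac[OF n0, of "Suc m"] by simp
    have 3: "real m / real n * f 1 \<le> t * f 1" "t * f 1 \<le> real (Suc m) / real n * f 1"
      using mult_right_mono[OF mt(1) f0[of 1]] mult_right_mono[OF mt(2) f0[of 1]] by simp_all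
    have "real (Suc m) / real n * f 1 - real m / real n * f 1 = f 1 / real n"
      using n0 by (simp add: field_simps)
    then have "\<bar>f t - f 1 * t\<bar> \<le> f 1 / real n" using 1 2 3 unfolding abs_le_iff mult.commute[of t] by linarith
    moreover have "f 1 / real n < \<bar>f t - f 1 * t\<bar>" using n e n0 by (simp add: field_simps)
    ultimately show False by simp
  qed
  then have lin: "f t = f 1 * t" if "t \<ge> 0" for t using that .
  have "\<phi> t = exp (- f t)" if "t \<ge> 0" for t using pos'[OF that] by (simp add: f_def)
  then have "\<phi> t = exp (- f 1 * t)" if "t \<ge> 0" for t using lin[OF that] that by simp
  then show ?thesis using f0[of 1] by auto
qed

lemma (in prob_space) integrable_character:
  assumes "character L S \<psi>" "f \<in> M \<rightarrow>\<^sub>M struct_borel L S"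
  shows "integrable M (\<lambda>\<omega>. \<psi> (f \<omega>))"
proof (rule integrable_const_bound[where B = 1])
  show "(\<lambda>\<omega>. \<psi> (f \<omega>)) \<in> borel_measurable M"
    by (rule measurable_compose[OF assms(2) measurable_character[OF assms(1)]])
  show "AE \<omega> in M. norm (\<psi> (f \<omega>)) \<le> 1"
    using characterD(3)[OF assms(1)] measurable_space[OF assms(2)] by (simp add: space_struct_borel)
qed

lemma (in prob_space) expectation_character:
  assumes c: "character L S \<psi>" and f: "f \<in> M \<rightarrow>\<^sub>M struct_borel L S"
  shows "expectation (\<lambda>\<omega>. \<psi> (f \<omega>)) = 1 - 2 * measure (distr M (struct_borel L S) f) (odd_part L S \<psi>)"
proof -
  let ?A = "f -` odd_part L S \<psi> \<inter> space M"
  have A: "?A \<in> events" by (rule measurable_sets[OF f odd_part_in_borel[OF c]])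
  have "expectation (\<lambda>\<omega>. \<psi> (f \<omega>)) = expectation (\<lambda>\<omega>. 1 - 2 * indicator ?A \<omega>)"
  proof (rule Bochner_Integration.integral_cong[OF refl])
    fix \<omega> assume w: "\<omega> \<in> space M"
    then have "f \<omega> \<in> structs L S" using measurable_space[OF f] by (simp add: space_struct_borel)
    from characterD(1)[OF c this] this w
    show "\<psi> (f \<omega>) = 1 - 2 * indicator ?A \<omega>"
      by (auto simp: odd_part_def split: split_indicator)
  qed
  also have "\<dots> = 1 - 2 * prob ?A" by (subst Bochner_Integration.integral_diff) (use A in \<open>auto simp: prob_space less_top[symmetric]\<close>)
  also have "prob ?A = measure (distr M (struct_borel L S) f) (odd_part L S \<psi>)"
    by (rule measure_distr[symmetric, OF f odd_part_in_borel[OF c]])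
  finally show ?thesis .
qed

context comb_levy_process
begin

text \<open>
  Independence factorises the expectation and stationarity moves each increment to time 0.
\<close>

lemma expectation_prod_increments:
  assumes S: "S \<subseteq> {1..}" and \<tau>: "0 \<le> \<tau> 0" "mono_on {..r} \<tau>"
    and c: "\<And>i. i < r \<Longrightarrow> character L S (\<psi> i)"
  shows "expectation (\<lambda>\<omega>. \<Prod>i<r. \<psi> i (incr (X (\<tau> (Suc i)) \<omega>) (X (\<tau> i) \<omega>))) =
         (\<Prod>i<r. expectation (\<lambda>\<omega>. \<psi> i (X (\<tau> (Suc i) - \<tau> i) \<omega>)))"
proof -
  have \<tau>i: "0 \<le> \<tau> i" "\<tau> i \<le> \<tau> (Suc i)" if "i < r" for i
    using mono_onD[OF \<tau>(2), of 0 i] mono_onD[OF \<tau>(2), of i "Suc i"] \<tau>(1) that by auto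
  have rv: "(\<lambda>\<omega>. incr (X (\<tau> (Suc i)) \<omega>) (X (\<tau> i) \<omega>)) \<in> P \<rightarrow>\<^sub>M struct_borel L S" if "i < r" for i
    using \<tau>i[OF that] by (intro measurable_incr[OF S] random_var) auto
  have ind: "indep_vars (\<lambda>_. borel) (\<lambda>i \<omega>. \<psi> i (incr (X (\<tau> (Suc i)) \<omega>) (X (\<tau> i) \<omega>))) {..<r}"
    by (rule indep_vars_compose2[OF independent_increments[OF \<tau>]])
       (auto intro: measurable_character c)
  have "expectation (\<lambda>\<omega>. \<Prod>i<r. \<psi> i (incr (X (\<tau> (Suc i)) \<omega>) (X (\<tau> i) \<omega>))) =
     (\<Prod>i<r. expectation (\<lambda>\<omega>. \<psi> i (incr (X (\<tau> (Suc i)) \<omega>) (X (\<tau> i) \<omega>))))"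
    by (rule indep_vars_lebesgue_integral[OF _ ind]) (auto intro: integrable_character[OF c rv])
  also have "\<dots> = (\<Prod>i<r. expectation (\<lambda>\<omega>. \<psi> i (X (\<tau> (Suc i) - \<tau> i) \<omega>)))"
  proof (rule prod.cong[OF refl])
    fix i assume "i \<in> {..<r}"
    then have i: "i < r" by simp
    let ?N = "struct_borel L S"
    have "expectation (\<lambda>\<omega>. \<psi> i (incr (X (\<tau> (Suc i)) \<omega>) (X (\<tau> i) \<omega>))) =
       (\<integral>M. \<psi> i M \<partial>distr P ?N (\<lambda>\<omega>. incr (X (\<tau> (Suc i)) \<omega>) (X (\<tau> i) \<omega>)))"
      by (rule integral_distr[symmetric, OF rv[OF i] measurable_character[OF c[OF i]]])
    also have "distr P ?N (\<lambda>\<omega>. incr (X (\<tau> (Suc i)) \<omega>) (X (\<tau> i) \<omega>)) = distr P ?N (X (\<tau> (Suc i) - \<tau> i))"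
      using stationary_increments[of "\<tau> i" "\<tau> (Suc i) - \<tau> i"] \<tau>i[OF i] by simp
    also have "(\<integral>M. \<psi> i M \<partial>distr P ?N (X (\<tau> (Suc i) - \<tau> i))) =
        expectation (\<lambda>\<omega>. \<psi> i (X (\<tau> (Suc i) - \<tau> i) \<omega>))"
      using \<tau>i[OF i] by (intro integral_distr random_var measurable_character[OF c[OF i]]) auto
    finally show "expectation (\<lambda>\<omega>. \<psi> i (incr (X (\<tau> (Suc i)) \<omega>) (X (\<tau> i) \<omega>))) =
        expectation (\<lambda>\<omega>. \<psi> i (X (\<tau> (Suc i) - \<tau> i) \<omega>))" .
  qed
  finally show ?thesis .
qed

lemma X_in_structs: "t \<ge> 0 \<Longrightarrow> \<omega> \<in> space P \<Longrightarrow> X t \<omega> \<in> structs L S"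
  using measurable_space[OF random_var] by (simp add: space_struct_borel)

text \<open>
  A character only sees a finite level, where convergence of structures means eventual equality. So
  \<open>\<psi> (X t)\<close> is eventually equal to \<open>\<psi> (X 0) = 1\<close> along almost every path, and dominated convergence applies.
\<close>

lemma character_right_continuous:
  assumes c: "character L S \<psi>"
  shows "((\<lambda>t. expectation (\<lambda>\<omega>. \<psi> (X t \<omega>))) \<longlongrightarrow> 1) (at_right 0)"
proof (rule tendsto_at_right_sequentially[of 0 1])
  fix T :: "nat \<Rightarrow> real"
  assume T: "\<And>n. 0 < T n" "T \<longlonglongrightarrow> 0"
  then have T': "filterlim T (at_right 0) sequentially"
    by (intro tendsto_imp_filterlim_at_right) auto
  obtain n where n: "n \<ge> 1" "\<And>M N. M \<in> structs L S \<Longrightarrow> N \<in> structs L S \<Longrightarrow>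
     (\<And>a. a \<in> coords L (initial S n) \<Longrightarrow> has_tuple a M = has_tuple a N) \<Longrightarrow> \<psi> M = \<psi> N"
    using character_level[OF c] by metis
  have "(\<lambda>k. expectation (\<lambda>\<omega>. \<psi> (X (T k) \<omega>))) \<longlonglongrightarrow> expectation (\<lambda>\<omega>. 1)"
  proof (rule integral_dominated_convergence[where w = "\<lambda>_. 1"])
    show "(\<lambda>\<omega>. \<psi> (X (T k) \<omega>)) \<in> borel_measurable P" for k
      using T(1)[of k] by (intro borel_measurable_integrable integrable_character[OF c] random_var) simp
    show "AE \<omega> in P. norm (\<psi> (X (T k) \<omega>)) \<le> 1" for k
      using characterD(3)[OF c] X_in_structs[of "T k"] T(1)[of k] by simp
    show "AE \<omega> in P. (\<lambda>k. \<psi> (X (T k) \<omega>)) \<longlonglongrightarrow> 1"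
      using cadlag start AE_space
    proof eventually_elim
      case (elim \<omega>)
      then have "limitin (struct_top L S) (\<lambda>s. X s \<omega>) (X 0 \<omega>) (at_right 0)" by blast
      then have "\<forall>\<^sub>F s in at_right 0. X s \<omega> \<in> structs L S \<and>
          restrict_struct (X s \<omega>) (initial S n) = restrict_struct (X 0 \<omega>) (initial S n)"
        unfolding limitin_struct_top_iff by (auto intro: eventually_conj)
      then have "\<forall>\<^sub>F s in at_right 0. \<psi> (X s \<omega>) = 1"
      proof eventually_elim
        case (elim s)
        have X0: "X 0 \<omega> \<in> structs L S" using X_in_structs[of 0] \<open>\<omega> \<in> space P\<close> by simp
        have "\<psi> (X s \<omega>) = \<psi> (X 0 \<omega>)"
          using elim restrict_eq_iff[OF _ X0, of "X s \<omega>" "initial S n"]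
          by (intro n(2)[OF _ X0]) blast+
        then show ?case using \<open>X 0 \<omega> = _\<close> character_zero[OF c] by simp
      qed
      then have "\<forall>\<^sub>F k in sequentially. \<psi> (X (T k) \<omega>) = 1"
        using T' unfolding filterlim_iff by blast
      then show ?case by (rule tendsto_eventually)
    qed
  qed auto
  then show "(\<lambda>k. expectation (\<lambda>\<omega>. \<psi> (X (T k) \<omega>))) \<longlonglongrightarrow> 1" by (simp add: prob_space)
qed simp

lemma character_multiplicative:
  assumes S: "S \<subseteq> {1..}" and c: "character L S \<psi>" and s: "0 \<le> s" and t: "0 \<le> t"
  shows "expectation (\<lambda>\<omega>. \<psi> (X (s + t) \<omega>)) = expectation (\<lambda>\<omega>. \<psi> (X s \<omega>)) * expectation (\<lambda>\<omega>. \<psi> (X t \<omega>))"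
proof -
  \<comment> \<open>The two increments over \<open>[0, s]\<close> and \<open>[s, s + t]\<close>.\<close>
  define \<tau> :: "nat \<Rightarrow> real" where "\<tau> i = (if i = 0 then 0 else if i = 1 then s else s + t)" for i
  have mono: "mono_on {..2} \<tau>" using s t by (auto simp: mono_on_def \<tau>_def)
  have "expectation (\<lambda>\<omega>. \<psi> (X (s + t) \<omega>)) =
     expectation (\<lambda>\<omega>. \<Prod>i<2. \<psi> (incr (X (\<tau> (Suc i)) \<omega>) (X (\<tau> i) \<omega>)))"
  proof (rule integral_cong_AE)
    show "(\<lambda>\<omega>. \<psi> (X (s + t) \<omega>)) \<in> borel_measurable P"
      using s t by (intro borel_measurable_integrable integrable_character[OF c] random_var) simp
    show "(\<lambda>\<omega>. \<Prod>i<2. \<psi> (incr (X (\<tau> (Suc i)) \<omega>) (X (\<tau> i) \<omega>))) \<in> borel_measurable P"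
      using s t by (intro borel_measurable_prod borel_measurable_integrable integrable_character[OF c]
          measurable_incr[OF S] random_var) (auto simp: \<tau>_def)
    show "AE \<omega> in P. \<psi> (X (s + t) \<omega>) = (\<Prod>i<2. \<psi> (incr (X (\<tau> (Suc i)) \<omega>) (X (\<tau> i) \<omega>)))"
      using start AE_space
    proof eventually_elim
      case (elim \<omega>)
      have st: "X s \<omega> \<in> structs L S" "X (s + t) \<omega> \<in> structs L S" "X 0 \<omega> \<in> structs L S"
        using X_in_structs elim s t by (auto simp: zero_struct_in_structs)
      then have "\<psi> (X (s + t) \<omega>) = \<psi> (incr (X (s + t) \<omega>) (X s \<omega>)) * \<psi> (X s \<omega>)"
        by (intro character_incr_cancel[OF c])
      moreover have "\<psi> (X s \<omega>) = \<psi> (incr (X s \<omega>) (X 0 \<omega>))"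
        using character_incr[OF c st(1,3)] character_zero[OF c] elim by simp
      ultimately show ?case by (simp add: numeral_2_eq_2 \<tau>_def mult.commute)
    qed
  qed
  also have "\<dots> = (\<Prod>i<2. expectation (\<lambda>\<omega>. \<psi> (X (\<tau> (Suc i) - \<tau> i) \<omega>)))"
    by (rule expectation_prod_increments[OF S _ mono]) (auto simp: \<tau>_def c)
  also have "\<dots> = expectation (\<lambda>\<omega>. \<psi> (X s \<omega>)) * expectation (\<lambda>\<omega>. \<psi> (X t \<omega>))"
    by (simp add: numeral_2_eq_2 \<tau>_def)
  finally show ?thesis .
qed

lemma character_exponent:
  assumes S: "S \<subseteq> {1..}" and c: "character L S \<psi>"
  shows "\<exists>\<kappa>\<ge>0. \<forall>t\<ge>0. expectation (\<lambda>\<omega>. \<psi> (X t \<omega>)) = exp (- \<kappa> * t)"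
proof (rule multiplicative_imp_exp)
  show "expectation (\<lambda>\<omega>. \<psi> (X t \<omega>)) \<le> 1" if "0 \<le> t" for t
    using expectation_character[OF c random_var[OF that]] by simp
  have "expectation (\<lambda>\<omega>. \<psi> (X 0 \<omega>)) = expectation (\<lambda>\<omega>. 1)"
    using random_var[of 0] start character_zero[OF c]
    by (intro integral_cong_AE borel_measurable_integrable integrable_character[OF c]) auto
  then show "expectation (\<lambda>\<omega>. \<psi> (X 0 \<omega>)) = 1" by (simp add: prob_space)
qed (use character_multiplicative[OF S c] character_right_continuous[OF c] in auto)

end

section \<open>Exponents determine the finite-dimensional distributions\<close>

text \<open>
  The information that is extracted from a process in order to compare laws. Both a Levy process with
  rate measure \<open>\<mu>\<close> and a \<open>\<mu>\<close>-canonical process have it, and it determines the finite-dimensional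
  distributions.
\<close>

definition has_exponents ::
  "nat list \<Rightarrow> nat set \<Rightarrow> lstruct measure \<Rightarrow> 'a measure \<Rightarrow> (real \<Rightarrow> 'a \<Rightarrow> lstruct) \<Rightarrow> bool" where
  "has_exponents L S \<mu> P X \<longleftrightarrow>
     prob_space P \<and> (\<forall>t\<ge>0. X t \<in> P \<rightarrow>\<^sub>M struct_borel L S) \<and> (AE \<omega> in P. X 0 \<omega> = zero_struct L S) \<and>
     (\<forall>r \<tau> \<psi>. \<tau> 0 = 0 \<longrightarrow> mono_on {..r} \<tau> \<longrightarrow> (\<forall>i<r. character L S (\<psi> i)) \<longrightarrow>
        (\<integral>\<omega>. (\<Prod>i<r. \<psi> i (incr (X (\<tau> (Suc i)) \<omega>) (X (\<tau> i) \<omega>))) \<partial>P) =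
        (\<Prod>i<r. exp (- 2 * (\<tau> (Suc i) - \<tau> i) * measure \<mu> (odd_part L S (\<psi> i)))))"

lemma character_telescope:
  assumes c: "character L S \<psi>" and x: "\<And>i. i \<le> l \<Longrightarrow> x i \<in> structs L S" "x 0 = zero_struct L S"
  shows "\<psi> (x l) = (\<Prod>i<l. \<psi> (incr (x (Suc i)) (x i)))"
  using x
proof (induction l)
  case 0
  then show ?case by (simp add: character_zero[OF c])
next
  case (Suc l)
  then show ?case
    using character_incr_cancel[OF c, of "x (Suc l)" "x l"] by (simp add: mult.commute)
qed

text \<open>
  Each factor \<open>\<psi> l (X (\<tau> l))\<close> telescopes into a product over the increments before \<open>\<tau> l\<close>. Collecting the
  factors by increments, the \<open>i\<close>-th increment carries the character \<open>\<Prod>l>i. \<psi> l\<close>.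
\<close>

lemma has_exponents_joint_sorted:
  assumes S: "S \<subseteq> {1..}" and X: "has_exponents L S \<mu> P X"
    and \<tau>: "\<tau> 0 = 0" "mono_on {..r} \<tau>" and c: "\<And>l. l \<le> r \<Longrightarrow> character L S (\<psi> l)"
  shows "(\<integral>\<omega>. (\<Prod>l\<le>r. \<psi> l (X (\<tau> l) \<omega>)) \<partial>P) =
    (\<Prod>i<r. exp (- 2 * (\<tau> (Suc i) - \<tau> i) * measure \<mu> (odd_part L S (\<lambda>M. \<Prod>l=Suc i..r. \<psi> l M))))"
proof -
  interpret prob_space P using X by (simp add: has_exponents_def)
  have rv: "X t \<in> P \<rightarrow>\<^sub>M struct_borel L S" if "t \<ge> 0" for t using X that by (simp add: has_exponents_def)
  have \<tau>0: "0 \<le> \<tau> l" if "l \<le> r" for l using mono_onD[OF \<tau>(2), of 0 l] \<tau>(1) that by simp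
  have c': "character L S (\<lambda>M. \<Prod>l=Suc i..r. \<psi> l M)" for i
    by (rule character_prod) (auto intro: c)
  have "(\<integral>\<omega>. (\<Prod>l\<le>r. \<psi> l (X (\<tau> l) \<omega>)) \<partial>P) =
        (\<integral>\<omega>. (\<Prod>i<r. \<Prod>l=Suc i..r. \<psi> l (incr (X (\<tau> (Suc i)) \<omega>) (X (\<tau> i) \<omega>))) \<partial>P)"
  proof (rule integral_cong_AE)
    show "(\<lambda>\<omega>. \<Prod>l\<le>r. \<psi> l (X (\<tau> l) \<omega>)) \<in> borel_measurable P"
      by (intro borel_measurable_prod measurable_compose[OF rv measurable_character] \<tau>0 c) auto
    show "(\<lambda>\<omega>. \<Prod>i<r. \<Prod>l=Suc i..r. \<psi> l (incr (X (\<tau> (Suc i)) \<omega>) (X (\<tau> i) \<omega>))) \<in> borel_measurable P"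
      by (intro borel_measurable_prod measurable_compose[OF measurable_incr[OF S rv rv] measurable_character] \<tau>0 c) auto
    have "AE \<omega> in P. X 0 \<omega> = zero_struct L S" using X by (simp add: has_exponents_def)
    then show "AE \<omega> in P. (\<Prod>l\<le>r. \<psi> l (X (\<tau> l) \<omega>)) =
        (\<Prod>i<r. \<Prod>l=Suc i..r. \<psi> l (incr (X (\<tau> (Suc i)) \<omega>) (X (\<tau> i) \<omega>)))"
      using AE_space
    proof eventually_elim
      case (elim \<omega>)
      have "(\<Prod>l\<le>r. \<psi> l (X (\<tau> l) \<omega>)) =
          (\<Prod>l\<le>r. \<Prod>i<l. \<psi> l (incr (X (\<tau> (Suc i)) \<omega>) (X (\<tau> i) \<omega>)))"
      proof (rule prod.cong[OF refl])
        fix l assume "l \<in> {..r}"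
        then show "\<psi> l (X (\<tau> l) \<omega>) = (\<Prod>i<l. \<psi> l (incr (X (\<tau> (Suc i)) \<omega>) (X (\<tau> i) \<omega>)))"
          using character_telescope[OF c, of l l "\<lambda>i. X (\<tau> i) \<omega>"] elim \<tau>(1)
            measurable_space[OF rv[OF \<tau>0] elim(2)]
          by (simp add: space_struct_borel)
      qed
      also have "\<dots> = (\<Prod>i<r. \<Prod>l=Suc i..r. \<psi> l (incr (X (\<tau> (Suc i)) \<omega>) (X (\<tau> i) \<omega>)))"
        by (rule prod.nested_swap')
      finally show ?case .
    qed
  qed
  also have "\<dots> = (\<Prod>i<r. exp (- 2 * (\<tau> (Suc i) - \<tau> i) * measure \<mu> (odd_part L S (\<lambda>M. \<Prod>l=Suc i..r. \<psi> l M))))"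
    using X \<tau> c' unfolding has_exponents_def
    by (elim conjE allE[of _ r] allE[of _ \<tau>] allE[of _ "\<lambda>i M. \<Prod>l=Suc i..r. \<psi> l M"]) simp
  finally show ?thesis .
qed

text \<open>
  The times of \<open>J\<close> are enumerated in increasing order. Time 0 is added as the starting point of
  the first increment; if it is not in \<open>J\<close>, it carries the trivial character.
\<close>

lemma has_exponents_joint:
  fixes J :: "real set"
  assumes S: "S \<subseteq> {1..}" and X: "has_exponents L S \<mu> P X" and Y: "has_exponents L S \<mu> Q Y"
    and J: "finite J" "J \<subseteq> {0..}" and c: "\<And>t. t \<in> J \<Longrightarrow> character L S (\<psi> t)"
  shows "(\<integral>\<omega>. (\<Prod>t\<in>J. \<psi> t (X t \<omega>)) \<partial>P) = (\<integral>\<omega>. (\<Prod>t\<in>J. \<psi> t (Y t \<omega>)) \<partial>Q)"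
proof -
  define J' where "J' = insert 0 J"
  define \<psi>' where "\<psi>' t = (if t \<in> J then \<psi> t else (\<lambda>_. 1))" for t
  define xs where "xs = sorted_list_of_set J'"
  define r where "r = length xs - 1"
  define \<tau> where "\<tau> i = xs ! i" for i
  have fin: "finite J'" using J by (simp add: J'_def)
  have xs: "set xs = J'" "sorted xs" "distinct xs" using fin by (simp_all add: xs_def)
  have len: "length xs = Suc r"
    using xs(1) by (cases xs) (auto simp: r_def J'_def)
  have bij: "bij_betw \<tau> {..r} J'"
    using bij_betw_nth[OF xs(3), of "{..<Suc r}" J'] xs(1) len
    by (simp add: \<tau>_def[abs_def] lessThan_Suc_atMost)
  have mono: "mono_on {..r} \<tau>"
    using sorted_nth_mono[OF xs(2)] len by (auto simp: mono_on_def \<tau>_def)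
  have \<tau>0: "\<tau> 0 = 0"
  proof -
    have "0 \<in> \<tau> ` {..r}" using bij by (simp add: bij_betw_def J'_def)
    then obtain i where "i \<le> r" "\<tau> i = 0" by force
    then have "\<tau> 0 \<le> 0" using mono_onD[OF mono, of 0 i] by simp
    moreover have "\<tau> 0 \<in> J'" using bij by (auto simp: bij_betw_def)
    ultimately show ?thesis using J(2) by (auto simp: J'_def)
  qed
  have c': "character L S (\<psi>' t)" for t using c by (auto simp: \<psi>'_def character_one)
  have eq: "(\<Prod>t\<in>J. \<psi> t (x t)) = (\<Prod>l\<le>r. \<psi>' (\<tau> l) (x (\<tau> l)))" for x
  proof -
    have "(\<Prod>l\<le>r. \<psi>' (\<tau> l) (x (\<tau> l))) = (\<Prod>t\<in>J'. \<psi>' t (x t))"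
      by (rule prod.reindex_bij_betw[OF bij])
    also have "\<dots> = (\<Prod>t\<in>J. \<psi>' t (x t))"
      by (rule prod.mono_neutral_right[OF fin]) (auto simp: J'_def \<psi>'_def)
    finally show ?thesis by (simp add: \<psi>'_def)
  qed
  show ?thesis
    unfolding eq
    using has_exponents_joint_sorted[OF S X \<tau>0 mono, of "\<lambda>l. \<psi>' (\<tau> l)"]
      has_exponents_joint_sorted[OF S Y \<tau>0 mono, of "\<lambda>l. \<psi>' (\<tau> l)"] c' by simp
qed

lemma measurable_of_bool_has_tuple:
  assumes "S \<subseteq> {1..}" "a \<in> coords L S" "f \<in> P \<rightarrow>\<^sub>M struct_borel L S"
  shows "(\<lambda>\<omega>. of_bool (has_tuple a (f \<omega>)) :: real) \<in> borel_measurable P"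
proof -
  have "(\<lambda>\<omega>. indicator {\<omega> \<in> space P. has_tuple a (f \<omega>)} \<omega> :: real) \<in> borel_measurable P"
    using measurable_struct_borelD(2)[OF assms(1,3,2)] by simp
  then show ?thesis
    by (rule measurable_cong[THEN iffD1, rotated]) (auto split: split_indicator)
qed

text \<open>
  The indicator of a coordinate is \<open>(1 - sign_at a) / 2\<close>. Expanding one factor of the second product
  leaves two expectations of the same form, one of which has the character at time \<open>t\<close> multiplied by
  \<open>sign_at a\<close>. The induction ends with products of characters.
\<close>

lemma has_exponents_tuple_probabilities:
  assumes S: "S \<subseteq> {1..}" and X: "has_exponents L S \<mu> P X" and Y: "has_exponents L S \<mu> Q Y"
    and J: "finite J" "J \<subseteq> {0..}" and F: "finite F" "F \<subseteq> J \<times> coords L S"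
    and c: "\<And>t. t \<in> J \<Longrightarrow> character L S (\<psi> t)"
  shows "(\<integral>\<omega>. (\<Prod>t\<in>J. \<psi> t (X t \<omega>)) * (\<Prod>(t, a)\<in>F. of_bool (has_tuple a (X t \<omega>))) \<partial>P) =
         (\<integral>\<omega>. (\<Prod>t\<in>J. \<psi> t (Y t \<omega>)) * (\<Prod>(t, a)\<in>F. of_bool (has_tuple a (Y t \<omega>))) \<partial>Q)"
  using F c
proof (induction arbitrary: \<psi> rule: finite_induct)
  case empty
  then show ?case using has_exponents_joint[OF S X Y J] by simp
next
  case (insert p F)
  obtain t a where p: "p = (t, a)" by (cases p)
  have t: "t \<in> J" and a: "a \<in> coords L S" using insert.prems by (auto simp: p)
  define \<theta> where "\<theta> = \<psi>(t := \<lambda>M. \<psi> t M * sign_at a M)"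
  have c\<theta>: "character L S (\<theta> u)" if "u \<in> J" for u
    using insert.prems(2)[OF that] character_sign_at[OF S a] by (auto simp: \<theta>_def character_mult)
  have prod\<theta>: "(\<Prod>u\<in>J. \<theta> u (x u)) = (\<Prod>u\<in>J. \<psi> u (x u)) * sign_at a (x t)" for x
  proof -
    have "(\<Prod>u\<in>J. \<theta> u (x u)) = \<theta> t (x t) * (\<Prod>u\<in>J-{t}. \<theta> u (x u))"
      by (rule prod.remove[OF J(1) t])
    also have "(\<Prod>u\<in>J-{t}. \<theta> u (x u)) = (\<Prod>u\<in>J-{t}. \<psi> u (x u))"
      by (rule prod.cong) (auto simp: \<theta>_def)
    also have "\<theta> t (x t) = \<psi> t (x t) * sign_at a (x t)" by (simp add: \<theta>_def)
    finally show ?thesis using prod.remove[OF J(1) t, of "\<lambda>u. \<psi> u (x u)"] by simp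
  qed
  have split: "(\<integral>\<omega>. (\<Prod>t\<in>J. \<psi> t (Z t \<omega>)) * (\<Prod>(t, a)\<in>insert p F. of_bool (has_tuple a (Z t \<omega>))) \<partial>R) =
     1/2 * (\<integral>\<omega>. (\<Prod>t\<in>J. \<psi> t (Z t \<omega>)) * (\<Prod>(t, a)\<in>F. of_bool (has_tuple a (Z t \<omega>))) \<partial>R) -
     1/2 * (\<integral>\<omega>. (\<Prod>t\<in>J. \<theta> t (Z t \<omega>)) * (\<Prod>(t, a)\<in>F. of_bool (has_tuple a (Z t \<omega>))) \<partial>R)"
    if Z: "has_exponents L S \<mu> R Z" for R :: "'c measure" and Z
  proof -
    interpret R: prob_space R using Z by (simp add: has_exponents_def)
    have rv: "Z t \<in> R \<rightarrow>\<^sub>M struct_borel L S" if "t \<ge> 0" for t using Z that by (simp add: has_exponents_def)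
    have int: "integrable R (\<lambda>\<omega>. (\<Prod>t\<in>J. \<eta> t (Z t \<omega>)) * (\<Prod>(t, a)\<in>F. of_bool (has_tuple a (Z t \<omega>))) :: real)"
      if c\<eta>: "\<And>u. u \<in> J \<Longrightarrow> character L S (\<eta> u)" for \<eta>
    proof (rule R.integrable_const_bound[where B = 1])
      show "(\<lambda>\<omega>. (\<Prod>t\<in>J. \<eta> t (Z t \<omega>)) * (\<Prod>(t, a)\<in>F. of_bool (has_tuple a (Z t \<omega>))) :: real) \<in> borel_measurable R"
      proof (intro borel_measurable_times borel_measurable_prod)
        show "(\<lambda>\<omega>. \<eta> t (Z t \<omega>)) \<in> borel_measurable R" if "t \<in> J" for t
          using J that by (intro measurable_compose[OF rv measurable_character[OF c\<eta>]]) auto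
        show "(\<lambda>\<omega>. (case q of (t, a) \<Rightarrow> of_bool (has_tuple a (Z t \<omega>))) :: real) \<in> borel_measurable R" if "q \<in> F" for q
        proof -
          have "q \<in> J \<times> coords L S" using insert.prems(1) that by blast
          then have "snd q \<in> coords L S" "0 \<le> fst q" using J(2) by auto
          then show ?thesis using measurable_of_bool_has_tuple[OF S _ rv] by (simp add: case_prod_beta')
        qed
      qed
      show "AE \<omega> in R. norm ((\<Prod>t\<in>J. \<eta> t (Z t \<omega>)) * (\<Prod>(t, a)\<in>F. of_bool (has_tuple a (Z t \<omega>))) :: real) \<le> 1"
      proof (rule AE_I2)
        fix \<omega> assume w: "\<omega> \<in> space R"
        have "\<bar>\<Prod>t\<in>J. \<eta> t (Z t \<omega>)\<bar> = 1"
          unfolding abs_prod using J(2)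
          by (intro prod.neutral ballI characterD(3)[OF c\<eta>])
             (use measurable_space[OF rv w] in \<open>auto simp: space_struct_borel\<close>)
        moreover have "\<bar>\<Prod>(t, a)\<in>F. of_bool (has_tuple a (Z t \<omega>)) :: real\<bar> \<le> 1"
          unfolding abs_prod by (rule prod_le_1) auto
        ultimately show "norm ((\<Prod>t\<in>J. \<eta> t (Z t \<omega>)) * (\<Prod>(t, a)\<in>F. of_bool (has_tuple a (Z t \<omega>))) :: real) \<le> 1"
          by (simp add: abs_mult)
      qed
    qed
    have "(\<integral>\<omega>. (\<Prod>t\<in>J. \<psi> t (Z t \<omega>)) * (\<Prod>(t, a)\<in>insert p F. of_bool (has_tuple a (Z t \<omega>))) \<partial>R) =
      (\<integral>\<omega>. 1/2 * ((\<Prod>t\<in>J. \<psi> t (Z t \<omega>)) * (\<Prod>(t, a)\<in>F. of_bool (has_tuple a (Z t \<omega>)))) -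
           1/2 * ((\<Prod>t\<in>J. \<theta> t (Z t \<omega>)) * (\<Prod>(t, a)\<in>F. of_bool (has_tuple a (Z t \<omega>)))) \<partial>R)"
    proof (rule Bochner_Integration.integral_cong[OF refl])
      fix \<omega>
      show "(\<Prod>t\<in>J. \<psi> t (Z t \<omega>)) * (\<Prod>(t, a)\<in>insert p F. of_bool (has_tuple a (Z t \<omega>))) =
        1/2 * ((\<Prod>t\<in>J. \<psi> t (Z t \<omega>)) * (\<Prod>(t, a)\<in>F. of_bool (has_tuple a (Z t \<omega>)))) -
           1/2 * ((\<Prod>t\<in>J. \<theta> t (Z t \<omega>)) * (\<Prod>(t, a)\<in>F. of_bool (has_tuple a (Z t \<omega>))))"
        unfolding prod\<theta>[of "\<lambda>t. Z t \<omega>"] using insert.hyps by (simp add: p sign_at_def)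
    qed
    also have "\<dots> = 1/2 * (\<integral>\<omega>. (\<Prod>t\<in>J. \<psi> t (Z t \<omega>)) * (\<Prod>(t, a)\<in>F. of_bool (has_tuple a (Z t \<omega>))) \<partial>R) -
     1/2 * (\<integral>\<omega>. (\<Prod>t\<in>J. \<theta> t (Z t \<omega>)) * (\<Prod>(t, a)\<in>F. of_bool (has_tuple a (Z t \<omega>))) \<partial>R)"
      by (subst Bochner_Integration.integral_diff)
         (auto intro!: integrable_mult_right int[OF insert.prems(2)] int[OF c\<theta>] simp del: of_bool_def)
    finally show ?thesis .
  qed
  show ?case
    unfolding split[OF X] split[OF Y]
    using insert.IH[of \<psi>] insert.IH[of \<theta>] insert.prems c\<theta> by simp
qed

text \<open>
  The events that finitely many given coordinates are present at given times form a generator of the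
  product \<open>\<sigma>\<close>-algebra that is closed under intersection, and their probabilities agree by the previous lemma.
\<close>

lemma has_exponents_imp_same_fdds:
  assumes S: "S \<subseteq> {1..}" and X: "has_exponents L S \<mu> P X" and Y: "has_exponents L S \<mu> Q Y"
  shows "same_fdds (struct_borel L S) P X Q Y"
  unfolding same_fdds_def
proof (intro allI impI)
  fix J :: "real set" assume J: "finite J \<and> J \<subseteq> {0..}"
  let ?N = "PiM J (\<lambda>_. struct_borel L S)"
  let ?\<Omega> = "space ?N"
  let ?ev = "\<lambda>F. {f \<in> ?\<Omega>. \<forall>p\<in>F. has_tuple (snd p) (f (fst p))}"
  define E where "E = {?ev F | F. finite F \<and> F \<subseteq> J \<times> coords L S}"
  have sub: "E \<subseteq> Pow ?\<Omega>" by (auto simp: E_def)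
  have ev: "?ev F \<in> sets ?N" if "finite F" "F \<subseteq> J \<times> coords L S" for F
  proof (rule sets.sets_Collect_finite_All[OF _ that(1)])
    fix p assume p: "p \<in> F"
    have "(\<lambda>f. f (fst p)) \<in> ?N \<rightarrow>\<^sub>M struct_borel L S"
      by (rule measurable_component_singleton) (use p that in auto)
    from measurable_struct_borelD(2)[OF S this]
    show "{f \<in> ?\<Omega>. has_tuple (snd p) (f (fst p))} \<in> sets ?N" using p that by auto
  qed
  have sets: "sets ?N = sigma_sets ?\<Omega> E"
  proof
    show "sigma_sets ?\<Omega> E \<subseteq> sets ?N"
      by (rule sets.sigma_sets_subset) (use ev in \<open>auto simp: E_def\<close>)
    have id: "(\<lambda>f. f) \<in> sigma ?\<Omega> E \<rightarrow>\<^sub>M ?N"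
    proof (rule measurable_PiM_single')
      fix t assume t: "t \<in> J"
      show "(\<lambda>f. f t) \<in> sigma ?\<Omega> E \<rightarrow>\<^sub>M struct_borel L S"
      proof (rule measurable_struct_borelI[OF S])
        fix f assume "f \<in> space (sigma ?\<Omega> E)"
        then show "f t \<in> structs L S" using sub t by (auto simp: space_PiM space_struct_borel)
      next
        fix a assume "a \<in> coords L S"
        then have "?ev {(t, a)} \<in> E" using t unfolding E_def by blast
        then have "?ev {(t, a)} \<in> sets (sigma ?\<Omega> E)" using sub by auto
        then show "{f \<in> space (sigma ?\<Omega> E). has_tuple a (f t)} \<in> sets (sigma ?\<Omega> E)" using sub by simp
      qed
    next
      show "(\<lambda>f. f) \<in> space (sigma ?\<Omega> E) \<rightarrow> J \<rightarrow>\<^sub>E space (struct_borel L S)"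
        using sub by (auto simp: space_PiM)
    qed
    show "sets ?N \<subseteq> sigma_sets ?\<Omega> E"
    proof
      fix A assume A: "A \<in> sets ?N"
      have "(\<lambda>f. f) -` A \<inter> space (sigma ?\<Omega> E) = A" using sets.sets_into_space[OF A] sub by auto
      with measurable_sets[OF id A] show "A \<in> sigma_sets ?\<Omega> E" using sub by simp
    qed
  qed
  have meas: "(\<lambda>\<omega>. \<lambda>t\<in>J. Z t \<omega>) \<in> R \<rightarrow>\<^sub>M ?N" if "has_exponents L S \<mu> R Z" for R :: "'c measure" and Z
    using that J by (intro measurable_restrict) (auto simp: has_exponents_def)
  have em: "emeasure (distr R ?N (\<lambda>\<omega>. \<lambda>t\<in>J. Z t \<omega>)) (?ev F) =
     ennreal (\<integral>\<omega>. (\<Prod>t\<in>J. 1) * (\<Prod>(t, a)\<in>F. of_bool (has_tuple a (Z t \<omega>))) \<partial>R)"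
    if F: "finite F" "F \<subseteq> J \<times> coords L S" and Z: "has_exponents L S \<mu> R Z" for R :: "'c measure" and Z F
  proof -
    interpret R: prob_space R using Z by (simp add: has_exponents_def)
    let ?A = "(\<lambda>\<omega>. \<lambda>t\<in>J. Z t \<omega>) -` ?ev F \<inter> space R"
    have A: "?A \<in> sets R" by (rule measurable_sets[OF meas[OF Z] ev[OF F]])
    have "emeasure (distr R ?N (\<lambda>\<omega>. \<lambda>t\<in>J. Z t \<omega>)) (?ev F) = emeasure R ?A"
      by (rule emeasure_distr[OF meas[OF Z] ev[OF F]])
    also have "\<dots> = ennreal (\<integral>\<omega>. indicator ?A \<omega> \<partial>R)"
      using A by (simp add: R.emeasure_eq_measure)
    also have "(\<integral>\<omega>. indicator ?A \<omega> \<partial>R) = (\<integral>\<omega>. (\<Prod>t\<in>J. 1) * (\<Prod>(t, a)\<in>F. of_bool (has_tuple a (Z t \<omega>)) :: real) \<partial>R)"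
    proof (rule Bochner_Integration.integral_cong[OF refl])
      fix \<omega> assume w: "\<omega> \<in> space R"
      have "(\<Prod>(t, a)\<in>F. of_bool (has_tuple a (Z t \<omega>))) = (of_bool (\<forall>p\<in>F. has_tuple (snd p) (Z (fst p) \<omega>)) :: real)"
        using F(1) by (induction F) auto
      moreover have "\<omega> \<in> ?A \<longleftrightarrow> (\<forall>p\<in>F. has_tuple (snd p) (Z (fst p) \<omega>))"
        using w measurable_space[OF meas[OF Z] w] F(2) by fastforce
      ultimately show "indicator ?A \<omega> = (\<Prod>t\<in>J. 1) * (\<Prod>(t, a)\<in>F. of_bool (has_tuple a (Z t \<omega>)) :: real)"
        by (simp add: indicator_def)
    qed
    finally show ?thesis .
  qed
  interpret P: prob_space P using X by (simp add: has_exponents_def)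
  show "distr P ?N (\<lambda>\<omega>. \<lambda>t\<in>J. X t \<omega>) = distr Q ?N (\<lambda>\<omega>. \<lambda>t\<in>J. Y t \<omega>)"
  proof (rule measure_eqI_generator_eq[where E = E and \<Omega> = ?\<Omega> and A = "\<lambda>_. ?\<Omega>"])
    show "Int_stable E"
    proof (rule Int_stableI)
      fix A B assume "A \<in> E" "B \<in> E"
      then obtain F G where F: "A = ?ev F" "finite F" "F \<subseteq> J \<times> coords L S"
        and G: "B = ?ev G" "finite G" "G \<subseteq> J \<times> coords L S" unfolding E_def by blast
      have "A \<inter> B = ?ev (F \<union> G)" unfolding F(1) G(1) by blast
      then show "A \<inter> B \<in> E" using F(2,3) G(2,3) unfolding E_def by blast
    qed
    fix A assume "A \<in> E"
    then obtain F where F: "A = ?ev F" "finite F" "F \<subseteq> J \<times> coords L S" unfolding E_def by blast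
    show "emeasure (distr P ?N (\<lambda>\<omega>. \<lambda>t\<in>J. X t \<omega>)) A = emeasure (distr Q ?N (\<lambda>\<omega>. \<lambda>t\<in>J. Y t \<omega>)) A"
      unfolding F(1) em[OF F(2,3) X] em[OF F(2,3) Y]
      using has_exponents_tuple_probabilities[OF S X Y _ _ F(2,3), of "\<lambda>_ _. 1"] J character_one by simp
  next
    have "?ev {} \<in> E" unfolding E_def by blast
    then show "range (\<lambda>_. ?\<Omega>) \<subseteq> E" by simp
    show "emeasure (distr P ?N (\<lambda>\<omega>. \<lambda>t\<in>J. X t \<omega>)) ?\<Omega> \<noteq> \<infinity>"
      using P.prob_space_distr[OF meas[OF X]] prob_space.emeasure_space_1 by fastforce
  qed (use sub sets in auto)
qed

section \<open>The rate measure gives the exponents\<close>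

lemma openin_nonzero: 
  assumes "S \<subseteq> {1..}"
  shows "openin (struct_top L S) (structs L S - {zero_struct L S})"
  unfolding openin_struct_top_iff
proof (intro conjI ballI)
  fix M assume M: "M \<in> structs L S - {zero_struct L S}"
  then obtain a where a: "a \<in> coords L S" "has_tuple a M"
    using structs_eqI[of M L S "zero_struct L S"] zero_struct_in_structs[of L S] has_tuple_zero_struct[of _ L S S]
    by blast
  obtain n where "n \<ge> 1" "a \<in> coords L (initial S n)" using coords_eventually[OF assms a(1)] by blast
  then show "\<exists>n\<ge>1. cyl L S n M \<subseteq> structs L S - {zero_struct L S}"
    using a has_tuple_zero_struct[OF a(1), of S] unfolding cyl_def by (intro exI[of _ n]) auto
qed auto

lemma exp_difference_quotient:
  fixes \<kappa> :: real
  shows "((\<lambda>t. (exp (- \<kappa> * t) - 1) / t) \<longlongrightarrow> - \<kappa>) (at_right 0)"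
proof -
  have "((\<lambda>t. exp (- \<kappa> * t)) has_real_derivative - \<kappa>) (at 0)"
    by (auto intro!: derivative_eq_intros)
  then have "((\<lambda>t. (exp (- \<kappa> * t) - 1) / t) \<longlongrightarrow> - \<kappa>) (at 0)"
    by (simp add: DERIV_def)
  then show ?thesis by (simp add: filterlim_at_split)
qed

text \<open>
  The function is the indicator of the odd part, which is clopen. So the function is continuous, and its
  support is closed in a compact space and does not contain the zero structure.
\<close>

lemma test_function_character:
  assumes S: "S \<subseteq> {1..}" and c: "character L S \<psi>"
  shows "test_function L S (\<lambda>M. (1 - \<psi> M) / 2)"
  unfolding test_function_def
proof
  have top: "topspace (nonzero_top L S) = structs L S - {zero_struct L S}"
    by (auto simp: nonzero_top_def topspace_struct_top)
  show "continuous_map (nonzero_top L S) euclideanreal (\<lambda>M. (1 - \<psi> M) / 2)"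
    unfolding continuous_map_def
  proof (intro conjI allI impI)
    fix U :: "real set" 
    have "{M \<in> topspace (nonzero_top L S). (1 - \<psi> M) / 2 \<in> U} =
       {M \<in> structs L S. \<psi> M \<in> {v. (1 - v) / 2 \<in> U}} \<inter> (structs L S - {zero_struct L S})"
      unfolding top by auto
    then show "openin (nonzero_top L S) {M \<in> topspace (nonzero_top L S). (1 - \<psi> M) / 2 \<in> U}"
      unfolding nonzero_top_def openin_subtopology using openin_character[OF c] by blast
  qed simp
  show "\<exists>K. compactin (nonzero_top L S) K \<and> (\<forall>M\<in>topspace (nonzero_top L S) - K. (1 - \<psi> M) / 2 = 0)"
  proof (intro exI conjI ballI)
    have "structs L S - odd_part L S \<psi> = {M \<in> structs L S. \<psi> M \<in> {1}}"
      using characterD(1)[OF c] by (auto simp: odd_part_def)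
    then have "closedin (struct_top L S) (odd_part L S \<psi>)"
      using openin_character[OF c, of "{1}"] by (auto simp: closedin_def topspace_struct_top odd_part_def)
    then have "compactin (struct_top L S) (odd_part L S \<psi>)"
      by (rule closedin_compact_space[OF compact_struct_top[OF S]])
    then show "compactin (nonzero_top L S) (odd_part L S \<psi>)"
      using character_zero[OF c] by (auto simp: nonzero_top_def compactin_subtopology odd_part_def)
    fix M assume "M \<in> topspace (nonzero_top L S) - odd_part L S \<psi>"
    then show "(1 - \<psi> M) / 2 = 0" using characterD(1)[OF c, of M] by (auto simp: top odd_part_def)
  qed
qed

lemma integral_character_test:
  assumes c: "character L S \<psi>" and sets: "sets \<mu> = sets (struct_borel L S)"
  shows "(LINT M : topspace (nonzero_top L S) | \<mu>. (1 - \<psi> M) / 2) = measure \<mu> (odd_part L S \<psi>)"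
proof -
  have top: "topspace (nonzero_top L S) = structs L S - {zero_struct L S}"
    by (auto simp: nonzero_top_def topspace_struct_top)
  have sp: "space \<mu> = structs L S" using sets_eq_imp_space_eq[OF sets] by (simp add: space_struct_borel)
  have "(LINT M : topspace (nonzero_top L S) | \<mu>. (1 - \<psi> M) / 2) = (\<integral>M. indicator (odd_part L S \<psi>) M \<partial>\<mu>)"
    unfolding set_lebesgue_integral_def
  proof (rule Bochner_Integration.integral_cong[OF refl])
    fix M assume "M \<in> space \<mu>"
    then show "indicator (topspace (nonzero_top L S)) M *\<^sub>R ((1 - \<psi> M) / 2) = indicator (odd_part L S \<psi>) M"
      using characterD(1)[OF c, of M] character_zero[OF c]
      by (auto simp: top odd_part_def sp split: split_indicator)
  qed
  also have "\<dots> = measure \<mu> (odd_part L S \<psi>)"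
    using sp by (simp add: Int_absorb2 odd_part_def)
  finally show ?thesis .
qed

context comb_levy_process
begin

text \<open>
  \<open>P(\<psi>(X t) = -1) = (1 - exp (- \<kappa> t)) / 2\<close>, so the limit of \<open>P(\<psi>(X t) = -1) / t\<close> determines \<open>\<kappa>\<close>.
\<close>

lemma has_exponentsI:
  assumes S: "S \<subseteq> {1..}"
    and lim: "\<And>\<psi>. character L S \<psi> \<Longrightarrow>
      ((\<lambda>t. 1 / t * measure (distr P (struct_borel L S) (X t)) (odd_part L S \<psi>)) \<longlongrightarrow>
         measure \<mu> (odd_part L S \<psi>)) (at_right 0)"
  shows "has_exponents L S \<mu> P X"
proof -
  have *: "expectation (\<lambda>\<omega>. \<psi> (X t \<omega>)) = exp (- 2 * t * measure \<mu> (odd_part L S \<psi>))"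
    if c: "character L S \<psi>" and t: "0 \<le> t" for \<psi> t
  proof -
    obtain \<kappa> where \<kappa>: "\<And>t. t \<ge> 0 \<Longrightarrow> expectation (\<lambda>\<omega>. \<psi> (X t \<omega>)) = exp (- \<kappa> * t)"
      using character_exponent[OF S c] by blast
    from exp_difference_quotient[of \<kappa>] have "((\<lambda>t. (-1/2) * ((exp (- \<kappa> * t) - 1) / t)) \<longlongrightarrow> (-1/2) * - \<kappa>) (at_right 0)"
      by (rule tendsto_mult_left)
    moreover have "\<forall>\<^sub>F t in at_right 0. (-1/2) * ((exp (- \<kappa> * t) - 1) / t) =
        1 / t * measure (distr P (struct_borel L S) (X t)) (odd_part L S \<psi>)"
      using eventually_at_right_less[of 0]
    proof eventually_elim
      case (elim t)
      then have m: "measure (distr P (struct_borel L S) (X t)) (odd_part L S \<psi>) = (1 - exp (- \<kappa> * t)) / 2"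
        using expectation_character[OF c random_var[of t]] \<kappa>[of t] by simp
      show ?case unfolding m by (simp add: diff_divide_distrib)
    qed
    ultimately have "((\<lambda>t. 1 / t * measure (distr P (struct_borel L S) (X t)) (odd_part L S \<psi>)) \<longlongrightarrow>
        (-1/2) * - \<kappa>) (at_right 0)"
      by (rule Lim_transform_eventually)
    from tendsto_unique[OF _ this lim[OF c]] have "\<kappa> = 2 * measure \<mu> (odd_part L S \<psi>)" by simp
    then show ?thesis using \<kappa>[OF t] by (simp add: mult.commute mult.left_commute)
  qed
  show ?thesis
    unfolding has_exponents_def
  proof (intro conjI allI impI)
    fix r :: nat and \<tau> :: "nat \<Rightarrow> real" and \<psi> assume \<tau>: "\<tau> 0 = 0" "mono_on {..r} \<tau>" and c: "\<forall>i<r. character L S (\<psi> i)"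
    have "expectation (\<lambda>\<omega>. \<Prod>i<r. \<psi> i (incr (X (\<tau> (Suc i)) \<omega>) (X (\<tau> i) \<omega>))) =
         (\<Prod>i<r. expectation (\<lambda>\<omega>. \<psi> i (X (\<tau> (Suc i) - \<tau> i) \<omega>)))"
      by (rule expectation_prod_increments[OF S _ \<tau>(2)]) (use \<tau> c in auto)
    also have "\<dots> = (\<Prod>i<r. exp (- 2 * (\<tau> (Suc i) - \<tau> i) * measure \<mu> (odd_part L S (\<psi> i))))"
      by (rule prod.cong[OF refl], rule *) (use c mono_onD[OF \<tau>(2)] in auto)
    finally show "expectation (\<lambda>\<omega>. \<Prod>i<r. \<psi> i (incr (X (\<tau> (Suc i)) \<omega>) (X (\<tau> i) \<omega>))) =
         (\<Prod>i<r. exp (- 2 * (\<tau> (Suc i) - \<tau> i) * measure \<mu> (odd_part L S (\<psi> i))))" .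
  qed (use random_var start prob_space_axioms in auto)
qed

lemma rate_measure_has_exponents:
  assumes S: "S \<subseteq> {1..}" and \<mu>: "is_rate_measure L S P X \<mu>"
  shows "has_exponents L S \<mu> P X"
proof (rule has_exponentsI[OF S])
  fix \<psi> assume c: "character L S \<psi>"
  have sets: "sets \<mu> = sets (struct_borel L S)" using \<mu> by (simp add: is_rate_measure_def levy_measure_def)
  from \<mu> test_function_character[OF S c]
  have "((\<lambda>t. (1 / t) *
           (LINT M : topspace (nonzero_top L S) | distr P (struct_borel L S) (X t). (1 - \<psi> M) / 2))
         \<longlongrightarrow> (LINT M : topspace (nonzero_top L S) | \<mu>. (1 - \<psi> M) / 2)) (at_right 0)"
    unfolding is_rate_measure_def by blast
  then show "((\<lambda>t. 1 / t * measure (distr P (struct_borel L S) (X t)) (odd_part L S \<psi>)) \<longlongrightarrow>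
         measure \<mu> (odd_part L S \<psi>)) (at_right 0)"
    by (simp only: integral_character_test[OF c sets] integral_character_test[OF c sets_distr])
qed

end

section \<open>Existence of the jump measure\<close>

context comb_levy_process
begin

text \<open>
  The bounded measurable functions \<open>f\<close> for which \<open>E f(X t)\<close> is differentiable from the right at time 0.
  They form a vector space that contains the characters.
\<close>

definition has_rate :: "(lstruct \<Rightarrow> real) \<Rightarrow> bool" where
  "has_rate f \<longleftrightarrow> f \<in> borel_measurable (struct_borel L S) \<and> (\<exists>B. \<forall>M\<in>structs L S. \<bar>f M\<bar> \<le> B) \<and>
     (\<exists>l. ((\<lambda>t. (expectation (\<lambda>\<omega>. f (X t \<omega>)) - f (zero_struct L S)) / t) \<longlongrightarrow> l) (at_right 0))"

lemma has_rate_integrable: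
  assumes "has_rate f" "0 \<le> t"
  shows "integrable P (\<lambda>\<omega>. f (X t \<omega>))"
proof -
  obtain B where B: "\<And>M. M \<in> structs L S \<Longrightarrow> \<bar>f M\<bar> \<le> B" using assms(1) unfolding has_rate_def by blast
  show ?thesis
  proof (rule integrable_const_bound[where B = B])
    show "(\<lambda>\<omega>. f (X t \<omega>)) \<in> borel_measurable P"
      using assms by (intro measurable_compose[OF random_var]) (auto simp: has_rate_def)
    show "AE \<omega> in P. norm (f (X t \<omega>)) \<le> B" using B X_in_structs[OF assms(2)] by auto
  qed
qed

lemma has_rate_linear:
  assumes f: "has_rate f" and g: "has_rate g"
  shows "has_rate (\<lambda>M. a * f M + b * g M)"
proof -
  obtain A B where A: "\<forall>M\<in>structs L S. \<bar>f M\<bar> \<le> A" and B: "\<forall>M\<in>structs L S. \<bar>g M\<bar> \<le> B"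
    using f g unfolding has_rate_def by blast
  have "\<bar>a * f M + b * g M\<bar> \<le> \<bar>a\<bar> * A + \<bar>b\<bar> * B" if "M \<in> structs L S" for M
  proof -
    have "\<bar>a * f M + b * g M\<bar> \<le> \<bar>a\<bar> * \<bar>f M\<bar> + \<bar>b\<bar> * \<bar>g M\<bar>"
      using abs_triangle_ineq[of "a * f M" "b * g M"] by (simp add: abs_mult)
    also have "\<dots> \<le> \<bar>a\<bar> * A + \<bar>b\<bar> * B" using A B that by (intro add_mono mult_left_mono) auto
    finally show ?thesis .
  qed
  moreover obtain l m where
    lm: "((\<lambda>t. (expectation (\<lambda>\<omega>. f (X t \<omega>)) - f (zero_struct L S)) / t) \<longlongrightarrow> l) (at_right 0)"
     "((\<lambda>t. (expectation (\<lambda>\<omega>. g (X t \<omega>)) - g (zero_struct L S)) / t) \<longlongrightarrow> m) (at_right 0)"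
    using f g unfolding has_rate_def by blast
  have "((\<lambda>t. (expectation (\<lambda>\<omega>. a * f (X t \<omega>) + b * g (X t \<omega>)) -
      (a * f (zero_struct L S) + b * g (zero_struct L S))) / t) \<longlongrightarrow> a * l + b * m) (at_right 0)"
  proof (rule Lim_transform_eventually)
    show "((\<lambda>t. a * ((expectation (\<lambda>\<omega>. f (X t \<omega>)) - f (zero_struct L S)) / t) +
       b * ((expectation (\<lambda>\<omega>. g (X t \<omega>)) - g (zero_struct L S)) / t)) \<longlongrightarrow> a * l + b * m) (at_right 0)"
      by (intro tendsto_intros lm)
    show "\<forall>\<^sub>F t in at_right 0. a * ((expectation (\<lambda>\<omega>. f (X t \<omega>)) - f (zero_struct L S)) / t) +
       b * ((expectation (\<lambda>\<omega>. g (X t \<omega>)) - g (zero_struct L S)) / t) =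
       (expectation (\<lambda>\<omega>. a * f (X t \<omega>) + b * g (X t \<omega>)) -
      (a * f (zero_struct L S) + b * g (zero_struct L S))) / t"
      using eventually_at_right_less[of 0]
      by eventually_elim
        (use has_rate_integrable[OF f] has_rate_integrable[OF g] in \<open>simp add: field_simps\<close>)
  qed
  moreover have "(\<lambda>M. a * f M + b * g M) \<in> borel_measurable (struct_borel L S)"
    using f g unfolding has_rate_def by (intro borel_measurable_add borel_measurable_times) auto
  ultimately show ?thesis unfolding has_rate_def by blast
qed

lemma has_rate_cong:
  assumes "has_rate f" "\<And>M. M \<in> structs L S \<Longrightarrow> f M = g M"
  shows "has_rate g"
proof -
  have "f \<in> borel_measurable (struct_borel L S) \<longleftrightarrow> g \<in> borel_measurable (struct_borel L S)"
    by (rule measurable_cong) (simp add: assms(2) space_struct_borel)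
  then have 1: "g \<in> borel_measurable (struct_borel L S)" using assms(1) by (simp add: has_rate_def)
  obtain B where "\<forall>M\<in>structs L S. \<bar>f M\<bar> \<le> B" using assms(1) unfolding has_rate_def by blast
  then have 2: "\<forall>M\<in>structs L S. \<bar>g M\<bar> \<le> B" using assms(2) by simp
  obtain l where l: "((\<lambda>t. (expectation (\<lambda>\<omega>. f (X t \<omega>)) - f (zero_struct L S)) / t) \<longlongrightarrow> l) (at_right 0)"
    using assms(1) unfolding has_rate_def by blast
  have ex: "expectation (\<lambda>\<omega>. f (X t \<omega>)) = expectation (\<lambda>\<omega>. g (X t \<omega>))" if "t > 0" for t
    using X_in_structs[of t] that by (intro Bochner_Integration.integral_cong) (auto simp: assms(2))
  have "\<forall>\<^sub>F t in at_right 0. (expectation (\<lambda>\<omega>. f (X t \<omega>)) - f (zero_struct L S)) / t =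
     (expectation (\<lambda>\<omega>. g (X t \<omega>)) - g (zero_struct L S)) / t"
    using eventually_at_right_less[of 0]
    by eventually_elim (simp add: assms(2) ex zero_struct_in_structs)
  with l have "((\<lambda>t. (expectation (\<lambda>\<omega>. g (X t \<omega>)) - g (zero_struct L S)) / t) \<longlongrightarrow> l) (at_right 0)"
    by (rule Lim_transform_eventually)
  with 1 2 show ?thesis unfolding has_rate_def by blast
qed

lemma has_rate_character:
  assumes S: "S \<subseteq> {1..}" and c: "character L S \<psi>"
  shows "has_rate \<psi>"
proof -
  obtain \<kappa> where \<kappa>: "\<And>t. t \<ge> 0 \<Longrightarrow> expectation (\<lambda>\<omega>. \<psi> (X t \<omega>)) = exp (- \<kappa> * t)"
    using character_exponent[OF S c] by blast
  note exp_difference_quotient[of \<kappa>]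
  moreover have "\<forall>\<^sub>F t in at_right 0. (exp (- \<kappa> * t) - 1) / t =
      (expectation (\<lambda>\<omega>. \<psi> (X t \<omega>)) - \<psi> (zero_struct L S)) / t"
    using eventually_at_right_less[of 0] by eventually_elim (simp add: \<kappa> character_zero[OF c])
  ultimately have "((\<lambda>t. (expectation (\<lambda>\<omega>. \<psi> (X t \<omega>)) - \<psi> (zero_struct L S)) / t) \<longlongrightarrow> - \<kappa>) (at_right 0)"
    by (rule Lim_transform_eventually)
  moreover have "\<forall>M\<in>structs L S. \<bar>\<psi> M\<bar> \<le> 1" using characterD(3)[OF c] by simp
  ultimately show ?thesis using measurable_character[OF c] unfolding has_rate_def by blast
qed

text \<open>
  Each factor is \<open>(1 + sign_at a) / 2\<close> or \<open>(1 - sign_at a) / 2\<close>; multiplying by \<open>sign_at a\<close> turns \<open>\<psi>\<close> into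
  another character, which is why the statement is generalised over \<open>\<psi>\<close>.
\<close>

lemma has_rate_pattern:
  assumes S: "S \<subseteq> {1..}" and F: "finite F" "F \<subseteq> coords L S" and c: "character L S \<psi>"
  shows "has_rate (\<lambda>M. \<psi> M * (\<Prod>a\<in>F. of_bool (has_tuple a M = b a)))"
  using F c
proof (induction arbitrary: \<psi> rule: finite_induct)
  case empty
  then show ?case using has_rate_character[OF S] by simp
next
  case (insert a F)
  have 1: "has_rate (\<lambda>M. \<psi> M * (\<Prod>a\<in>F. of_bool (has_tuple a M = b a)))"
    using insert.IH insert.prems by simp
  have 2: "has_rate (\<lambda>M. (\<psi> M * sign_at a M) * (\<Prod>a\<in>F. of_bool (has_tuple a M = b a)))"
    using insert.prems by (intro insert.IH character_mult character_sign_at[OF S]) auto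
  show ?case
    by (rule has_rate_cong[OF has_rate_linear[OF 1 2, of "1/2" "if b a then -1/2 else 1/2"]])
      (use insert.hyps in \<open>auto simp: sign_at_def\<close>)
qed

lemma has_rate_sum:
  assumes "finite I" "\<And>i. i \<in> I \<Longrightarrow> has_rate (f i)" "S \<subseteq> {1..}"
  shows "has_rate (\<lambda>M. \<Sum>i\<in>I. f i M)"
  using assms(1,2)
proof (induction rule: finite_induct)
  case empty
  show ?case using has_rate_linear[OF has_rate_character[OF assms(3) character_one] has_rate_character[OF assms(3) character_one], of 0 0]
    by simp
next
  case (insert i I)
  then show ?case using has_rate_linear[of "f i" "\<lambda>M. \<Sum>i\<in>I. f i M" 1 1] by simp
qed

end

text \<open>
  The sets on which the jump measure is finite and given by a limit. They form a ring of sets, but not an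
  algebra, because the whole space contains the zero structure.
\<close>

definition zero_free_cylinders :: "nat list \<Rightarrow> nat set \<Rightarrow> lstruct set set" where
  "zero_free_cylinders L S = {C. C \<subseteq> structs L S \<and> zero_struct L S \<notin> C \<and>
     (\<exists>n\<ge>1. \<forall>M\<in>structs L S. \<forall>N\<in>structs L S.
        (\<forall>a\<in>coords L (initial S n). has_tuple a M = has_tuple a N) \<longrightarrow> M \<in> C \<longrightarrow> N \<in> C)}"

lemma zero_free_cylindersI:
  assumes "C \<subseteq> structs L S" "zero_struct L S \<notin> C" "n \<ge> 1"
    and "\<And>M N. M \<in> structs L S \<Longrightarrow> N \<in> structs L S \<Longrightarrow>
       \<forall>a\<in>coords L (initial S n). has_tuple a M = has_tuple a N \<Longrightarrow> M \<in> C \<Longrightarrow> N \<in> C"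
  shows "C \<in> zero_free_cylinders L S"
  unfolding zero_free_cylinders_def
  by (intro CollectI conjI exI[of _ n] ballI impI assms(1-3)) (rule assms(4))

lemma zero_free_cylindersD:
  assumes "C \<in> zero_free_cylinders L S"
  obtains n where "n \<ge> 1" "\<And>m M N. n \<le> m \<Longrightarrow> M \<in> structs L S \<Longrightarrow> N \<in> structs L S \<Longrightarrow>
     \<forall>a\<in>coords L (initial S m). has_tuple a M = has_tuple a N \<Longrightarrow> M \<in> C \<longleftrightarrow> N \<in> C"
proof -
  obtain n where n: "n \<ge> 1" "\<And>M N. M \<in> structs L S \<Longrightarrow> N \<in> structs L S \<Longrightarrow>
       \<forall>a\<in>coords L (initial S n). has_tuple a M = has_tuple a N \<Longrightarrow> M \<in> C \<Longrightarrow> N \<in> C"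
    using assms unfolding zero_free_cylinders_def by blast
  show thesis
  proof (rule that[OF n(1)])
    fix m M N assume m: "n \<le> m" and MN: "M \<in> structs L S" "N \<in> structs L S"
      and "\<forall>a\<in>coords L (initial S m). has_tuple a M = has_tuple a N"
    then have "\<forall>a\<in>coords L (initial S n). has_tuple a M = has_tuple a N" "\<forall>a\<in>coords L (initial S n). has_tuple a N = has_tuple a M"
      using initial_mono[OF m, of L S] by auto
    then show "M \<in> C \<longleftrightarrow> N \<in> C" using n(2)[OF MN] n(2)[OF MN(2,1)] by blast
  qed
qed

lemma zero_free_cylinders_sub: "C \<in> zero_free_cylinders L S \<Longrightarrow> C \<subseteq> structs L S"
  "C \<in> zero_free_cylinders L S \<Longrightarrow> zero_struct L S \<notin> C"
  by (auto simp: zero_free_cylinders_def)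

lemma zero_free_cylinders_clopen:
  assumes "C \<in> zero_free_cylinders L S"
  shows "openin (struct_top L S) C" "closedin (struct_top L S) C"
proof -
  obtain n where n: "n \<ge> 1" "\<And>m M N. n \<le> m \<Longrightarrow> M \<in> structs L S \<Longrightarrow> N \<in> structs L S \<Longrightarrow>
     \<forall>a\<in>coords L (initial S m). has_tuple a M = has_tuple a N \<Longrightarrow> M \<in> C \<longleftrightarrow> N \<in> C"
    using zero_free_cylindersD[OF assms] by metis
  note sub = zero_free_cylinders_sub(1)[OF assms]
  have "cyl L S n M \<subseteq> C" if "M \<in> C" for M
    using n(2)[of n _ M] that sub unfolding cyl_def by auto
  then show "openin (struct_top L S) C" using sub n(1) unfolding openin_struct_top_iff by blast
  have "cyl L S n M \<subseteq> structs L S - C" if "M \<in> structs L S - C" for M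
    using n(2)[of n _ M] that sub unfolding cyl_def by auto
  then show "closedin (struct_top L S) C"
    using sub n(1) unfolding closedin_def topspace_struct_top openin_struct_top_iff by blast
qed

lemma ring_of_sets_zero_free_cylinders: "ring_of_sets (structs L S) (zero_free_cylinders L S)"
proof (rule ring_of_setsI)
  show "zero_free_cylinders L S \<subseteq> Pow (structs L S)" using zero_free_cylinders_sub by blast
  show "{} \<in> zero_free_cylinders L S" by (auto simp: zero_free_cylinders_def)
next
  fix C D assume CD: "C \<in> zero_free_cylinders L S" "D \<in> zero_free_cylinders L S"
  obtain m where m: "m \<ge> 1" "\<And>k M N. m \<le> k \<Longrightarrow> M \<in> structs L S \<Longrightarrow> N \<in> structs L S \<Longrightarrow>
     \<forall>a\<in>coords L (initial S k). has_tuple a M = has_tuple a N \<Longrightarrow> M \<in> C \<longleftrightarrow> N \<in> C"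
    using zero_free_cylindersD[OF CD(1)] by metis
  obtain n where n: "n \<ge> 1" "\<And>k M N. n \<le> k \<Longrightarrow> M \<in> structs L S \<Longrightarrow> N \<in> structs L S \<Longrightarrow>
     \<forall>a\<in>coords L (initial S k). has_tuple a M = has_tuple a N \<Longrightarrow> M \<in> D \<longleftrightarrow> N \<in> D"
    using zero_free_cylindersD[OF CD(2)] by metis
  note * = m(2)[of "max m n"] n(2)[of "max m n"]
  have "N \<in> C \<union> D" if "M \<in> structs L S" "N \<in> structs L S"
       "\<forall>a\<in>coords L (initial S (max m n)). has_tuple a M = has_tuple a N" "M \<in> C \<union> D" for M N
    using *[OF _ that(1-3)] that(4) by simp
  moreover have "N \<in> C - D" if "M \<in> structs L S" "N \<in> structs L S"
       "\<forall>a\<in>coords L (initial S (max m n)). has_tuple a M = has_tuple a N" "M \<in> C - D" for M N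
    using *[OF _ that(1-3)] that(4) by simp
  moreover have "max m n \<ge> 1" using m(1) by simp
  moreover note sub = zero_free_cylinders_sub[OF CD(1)] zero_free_cylinders_sub[OF CD(2)]
  have "C \<union> D \<subseteq> structs L S" "zero_struct L S \<notin> C \<union> D" "C - D \<subseteq> structs L S" "zero_struct L S \<notin> C - D"
    using sub by auto
  ultimately show "C \<union> D \<in> zero_free_cylinders L S" "C - D \<in> zero_free_cylinders L S"
    by - (rule zero_free_cylindersI; assumption)+
qed

lemma odd_part_zero_free:
  assumes c: "character L S \<psi>"
  shows "odd_part L S \<psi> \<in> zero_free_cylinders L S"
proof -
  obtain n where "n \<ge> 1" "\<And>M N. M \<in> structs L S \<Longrightarrow> N \<in> structs L S \<Longrightarrow>
     (\<And>a. a \<in> coords L (initial S n) \<Longrightarrow> has_tuple a M = has_tuple a N) \<Longrightarrow> \<psi> M = \<psi> N"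
    using character_level[OF c] by metis
  note n = this
  show ?thesis
  proof (rule zero_free_cylindersI[OF _ _ n(1)])
    fix M N assume MN: "M \<in> structs L S" "N \<in> structs L S" "M \<in> odd_part L S \<psi>"
      and h: "\<forall>a\<in>coords L (initial S n). has_tuple a M = has_tuple a N"
    have "\<psi> M = \<psi> N" using h by (intro n(2) MN) blast
    then show "N \<in> odd_part L S \<psi>" using MN by (simp add: odd_part_def)
  qed (simp_all add: odd_part_def character_zero[OF c])
qed

lemma nonzero_level_zero_free:
  assumes "n \<ge> 1"
  shows "{M \<in> structs L S. restrict_struct M (initial S n) \<noteq> zero_struct L (initial S n)} \<in> zero_free_cylinders L S"
proof -
  have eq: "{M \<in> structs L S. restrict_struct M (initial S n) \<noteq> zero_struct L (initial S n)} =
      {M \<in> structs L S. \<exists>a\<in>coords L (initial S n). has_tuple a M}"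
    using restrict_zero_iff[of _ L S "initial S n"] by auto
  show ?thesis
    unfolding eq
  proof (rule zero_free_cylindersI[OF _ _ assms])
    show "zero_struct L S \<notin> {M \<in> structs L S. \<exists>a\<in>coords L (initial S n). has_tuple a M}"
      by (simp add: has_tuple_zero_struct)
  qed simp_all
qed

text \<open>
  A coordinate event is the odd part of \<open>sign_at a\<close>, hence a cylinder without the zero structure.
\<close>

lemma sets_struct_borel_zero_free:
  assumes S: "S \<subseteq> {1..}"
  shows "sets (struct_borel L S) = sigma_sets (structs L S) (zero_free_cylinders L S)"
proof
  let ?\<Sigma> = "sigma (structs L S) (zero_free_cylinders L S)"
  have sub: "zero_free_cylinders L S \<subseteq> Pow (structs L S)" using zero_free_cylinders_sub by blast
  show "sigma_sets (structs L S) (zero_free_cylinders L S) \<subseteq> sets (struct_borel L S)"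
    using sets.sigma_sets_subset[of "zero_free_cylinders L S" "struct_borel L S"]
      open_in_struct_borel[OF zero_free_cylinders_clopen(1)]
    by (auto simp: space_struct_borel)
  have id: "(\<lambda>M. M) \<in> ?\<Sigma> \<rightarrow>\<^sub>M struct_borel L S"
  proof (rule measurable_struct_borelI[OF S])
    fix M assume "M \<in> space ?\<Sigma>" then show "M \<in> structs L S" using sub by simp
  next
    fix a assume a: "a \<in> coords L S"
    have "odd_part L S (sign_at a) = {M \<in> structs L S. has_tuple a M}"
      by (auto simp: odd_part_def sign_at_def)
    then show "{M \<in> space ?\<Sigma>. has_tuple a M} \<in> sets ?\<Sigma>"
      using odd_part_zero_free[OF character_sign_at[OF S a]] sub by simp
  qed
  show "sets (struct_borel L S) \<subseteq> sigma_sets (structs L S) (zero_free_cylinders L S)"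
  proof
    fix A assume A: "A \<in> sets (struct_borel L S)"
    then have "A \<subseteq> structs L S" using sets.sets_into_space[OF A] by (simp add: space_struct_borel)
    then have "(\<lambda>M. M) -` A \<inter> space ?\<Sigma> = A" using sub by auto
    with measurable_sets[OF id A] show "A \<in> sigma_sets (structs L S) (zero_free_cylinders L S)"
      using sub by simp
  qed
qed

text \<open>
  If a cylinder is a disjoint union of countably many cylinders, then all but finitely many of them are
  empty, because it is compact and they are open. So finite additivity suffices.
\<close>

lemma countably_additive_by_compactness:
  fixes f :: "lstruct set \<Rightarrow> ennreal"
  assumes S: "S \<subseteq> {1..}" and pos: "f {} = 0"
    and add: "\<And>C D. C \<in> zero_free_cylinders L S \<Longrightarrow> D \<in> zero_free_cylinders L S \<Longrightarrow>
       C \<inter> D = {} \<Longrightarrow> f (C \<union> D) = f C + f D"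
  shows "countably_additive (zero_free_cylinders L S) f"
  unfolding countably_additive_def
proof (intro allI impI)
  interpret ring_of_sets "structs L S" "zero_free_cylinders L S" by (rule ring_of_sets_zero_free_cylinders)
  fix A :: "nat \<Rightarrow> lstruct set"
  assume A: "range A \<subseteq> zero_free_cylinders L S" "disjoint_family A"
    and U: "(\<Union>i. A i) \<in> zero_free_cylinders L S"
  have "compactin (struct_top L S) (\<Union>i. A i)"
    by (rule closedin_compact_space[OF compact_struct_top[OF S] zero_free_cylinders_clopen(2)[OF U]])
  then obtain \<F> where \<F>: "finite \<F>" "\<F> \<subseteq> range A" "(\<Union>i. A i) \<subseteq> \<Union>\<F>"
  proof -
    have "\<And>U. U \<in> range A \<Longrightarrow> openin (struct_top L S) U"
      using zero_free_cylinders_clopen(1) A(1) by blast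
    from compactinD[OF \<open>compactin _ _\<close> this subset_refl] show ?thesis using that by blast
  qed
  then obtain I where I: "finite I" "(\<Union>i. A i) \<subseteq> (\<Union>i\<in>I. A i)"
    using finite_subset_image[OF \<F>(1,2)] by blast
  have empty: "A i = {}" if "i \<notin> I" for i
  proof -
    have "A i \<inter> A j = {}" if "j \<in> I" for j
    proof -
      have "i \<noteq> j" using that \<open>i \<notin> I\<close> by blast
      then show ?thesis using A(2) by (simp add: disjoint_family_on_def)
    qed
    moreover have "A i \<subseteq> (\<Union>j\<in>I. A j)" using I(2) by blast
    ultimately show ?thesis by blast
  qed
  have "(\<Union>i\<in>J. A i) \<in> zero_free_cylinders L S \<and> f (\<Union>i\<in>J. A i) = (\<Sum>i\<in>J. f (A i))" if "finite J" for J
    using that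
  proof (induction J rule: finite_induct)
    case empty
    then show ?case by (simp add: pos)
  next
    case (insert i J)
    have "A i \<inter> A j = {}" if "j \<in> J" for j
    proof -
      have "i \<noteq> j" using that insert.hyps(2) by blast
      then show ?thesis using A(2) by (simp add: disjoint_family_on_def)
    qed
    then have "A i \<inter> (\<Union>j\<in>J. A j) = {}" by blast
    moreover have Ai: "A i \<in> zero_free_cylinders L S" using A(1) by blast
    ultimately show ?case
      using insert.hyps insert.IH add[of "A i" "\<Union>j\<in>J. A j"] Un[OF Ai conjunct1[OF insert.IH]] by simp
  qed
  note this[OF I(1)]
  moreover have "(\<Union>i\<in>I. A i) = (\<Union>i. A i)" using I(2) by blast
  moreover have "(\<Sum>i. f (A i)) = (\<Sum>i\<in>I. f (A i))"
    by (rule suminf_finite[OF I(1)]) (simp add: empty pos)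
  ultimately show "(\<Sum>i. f (A i)) = f (\<Union>i. A i)" by simp
qed

context comb_levy_process
begin

text \<open>
  The indicator of a cylinder is the sum, over the finitely many patterns that belong to it, of
  indicators of patterns.
\<close>

lemma zero_free_cylinder_rate:
  assumes S: "S \<subseteq> {1..}" and C: "C \<in> zero_free_cylinders L S"
  shows "\<exists>l\<ge>0. ((\<lambda>t. 1 / t * measure (distr P (struct_borel L S) (X t)) C) \<longlongrightarrow> l) (at_right 0)"
proof -
  obtain n where n: "n \<ge> 1" "\<And>m M N. n \<le> m \<Longrightarrow> M \<in> structs L S \<Longrightarrow> N \<in> structs L S \<Longrightarrow>
     \<forall>a\<in>coords L (initial S m). has_tuple a M = has_tuple a N \<Longrightarrow> M \<in> C \<longleftrightarrow> N \<in> C"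
    using zero_free_cylindersD[OF C] by metis
  let ?K = "coords L (initial S n)"
  have fin: "finite ?K" by (simp add: finite_coords)
  have K: "?K \<subseteq> coords L S" using initial_coords by blast
  \<comment> \<open>The patterns on the coordinates of level \<open>n\<close> that belong to \<open>C\<close>.\<close>
  define \<A> where "\<A> = {A \<in> Pow ?K. struct_of L S A \<in> C}"
  have \<A>: "finite \<A>" using fin by (simp add: \<A>_def)
  have "has_rate (\<lambda>M. \<Sum>A\<in>\<A>. 1 * (\<Prod>a\<in>?K. of_bool (has_tuple a M = (a \<in> A))))"
    by (intro has_rate_sum[OF \<A> _ S] has_rate_pattern[OF S fin K] character_one)
  then have "has_rate (indicator C)"
  proof (rule has_rate_cong)
    fix M assume M: "M \<in> structs L S"
    let ?A = "{a \<in> ?K. has_tuple a M}"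
    have *: "(\<Prod>a\<in>?K. of_bool (has_tuple a M = (a \<in> A))) = (of_bool (A = ?A) :: real)" if "A \<subseteq> ?K" for A
    proof -
      have "(\<Prod>a\<in>F. of_bool (has_tuple a M = (a \<in> A))) = (of_bool (\<forall>a\<in>F. has_tuple a M = (a \<in> A)) :: real)" if "finite F" for F
        using that by (induction F) auto
      from this[OF fin] show ?thesis using that by (auto intro!: arg_cong[where f = of_bool])
    qed
    have "(\<Sum>A\<in>\<A>. 1 * (\<Prod>a\<in>?K. of_bool (has_tuple a M = (a \<in> A)))) = (\<Sum>A\<in>\<A>. of_bool (A = ?A) :: real)"
      by (rule sum.cong[OF refl]) (subst *; auto simp: \<A>_def)
    also have "\<dots> = of_bool (?A \<in> \<A>)"
      using \<A> by (simp add: of_bool_def sum.delta)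
    also have "?A \<in> \<A> \<longleftrightarrow> M \<in> C"
    proof -
      have "struct_of L S ?A \<in> C \<longleftrightarrow> M \<in> C"
      proof (rule n(2)[OF order_refl struct_of_in_structs M], rule ballI)
        fix a assume a: "a \<in> ?K"
        show "has_tuple a (struct_of L S ?A) = has_tuple a M" using has_tuple_struct_of[OF initial_coords[OF a]] a by simp
      qed
      then show ?thesis by (auto simp: \<A>_def)
    qed
    finally show "(\<Sum>A\<in>\<A>. 1 * (\<Prod>a\<in>?K. of_bool (has_tuple a M = (a \<in> A)))) = (indicator C M :: real)"
      by (simp add: indicator_def)
  qed
  then obtain l where l: "((\<lambda>t. (expectation (\<lambda>\<omega>. indicator C (X t \<omega>)) - indicator C (zero_struct L S)) / t) \<longlongrightarrow> l) (at_right 0)"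
    unfolding has_rate_def by blast
  have Cb: "C \<in> sets (struct_borel L S)"
    by (rule open_in_struct_borel[OF zero_free_cylinders_clopen(1)[OF C]])
  have "\<forall>\<^sub>F t in at_right 0. (expectation (\<lambda>\<omega>. indicator C (X t \<omega>)) - indicator C (zero_struct L S)) / t =
     1 / t * measure (distr P (struct_borel L S) (X t)) C"
    using eventually_at_right_less[of 0]
  proof eventually_elim
    case (elim t)
    have "expectation (\<lambda>\<omega>. indicator C (X t \<omega>) :: real) = (\<integral>M. indicator C M \<partial>distr P (struct_borel L S) (X t))"
      using elim Cb by (intro integral_distr[symmetric] random_var) auto
    also have "\<dots> = measure (distr P (struct_borel L S) (X t)) C"
      using zero_free_cylinders_sub(1)[OF C] by (simp add: Int_absorb2 space_struct_borel)
    finally show ?case using zero_free_cylinders_sub(2)[OF C] by simp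
  qed
  with l have lim: "((\<lambda>t. 1 / t * measure (distr P (struct_borel L S) (X t)) C) \<longlongrightarrow> l) (at_right 0)"
    by (rule Lim_transform_eventually)
  have "\<forall>\<^sub>F t in at_right 0. 0 \<le> 1 / t * measure (distr P (struct_borel L S) (X t)) C"
    using eventually_at_right_less[of 0] by eventually_elim simp
  then have "l \<ge> 0" by (rule tendsto_lowerbound[OF lim]) simp
  with lim show ?thesis by blast
qed

text \<open>
  Apply Caratheodory's theorem to the limits of \<open>P(X t \<in> C) / t\<close>. No countable union of cylinders in the
  ring covers the zero structure, so the extension puts uncontrolled mass there. It is removed by
  restricting to the nonzero structures.
\<close>

lemma ex_levy_measure:
  assumes S: "S \<subseteq> {1..}"
  shows "\<exists>\<mu>. levy_measure L S \<mu> \<and> has_exponents L S \<mu> P X"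
proof -
  let ?R = "zero_free_cylinders L S"
  interpret ring_of_sets "structs L S" ?R by (rule ring_of_sets_zero_free_cylinders)
  have "\<forall>C\<in>?R. \<exists>l\<ge>0. ((\<lambda>t. 1 / t * measure (distr P (struct_borel L S) (X t)) C) \<longlongrightarrow> l) (at_right 0)"
    using zero_free_cylinder_rate[OF S] by blast
  from bchoice[OF this] obtain \<rho> where \<rho>: "\<And>C. C \<in> ?R \<Longrightarrow> 0 \<le> \<rho> C"
    "\<And>C. C \<in> ?R \<Longrightarrow> ((\<lambda>t. 1 / t * measure (distr P (struct_borel L S) (X t)) C) \<longlongrightarrow> \<rho> C) (at_right 0)"
    by blast
  have borel: "C \<in> sets (struct_borel L S)" if "C \<in> ?R" for C
    by (rule open_in_struct_borel[OF zero_free_cylinders_clopen(1)[OF that]])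
  have add: "\<rho> (C \<union> D) = \<rho> C + \<rho> D" if C: "C \<in> ?R" and D: "D \<in> ?R" and CD: "C \<inter> D = {}" for C D
  proof (rule tendsto_unique[OF _ \<rho>(2)])
    show "C \<union> D \<in> ?R" using C D by blast
    have "\<forall>\<^sub>F t in at_right 0. 1 / t * measure (distr P (struct_borel L S) (X t)) C +
        1 / t * measure (distr P (struct_borel L S) (X t)) D =
        1 / t * measure (distr P (struct_borel L S) (X t)) (C \<union> D)"
      using eventually_at_right_less[of 0]
    proof eventually_elim
      case (elim t)
      interpret D: prob_space "distr P (struct_borel L S) (X t)"
        using elim by (intro prob_space_distr random_var) simp
      show ?case using D.finite_measure_Union[of C D] borel C D CD by (simp add: add_divide_distrib)
    qed
    with tendsto_add[OF \<rho>(2)[OF C] \<rho>(2)[OF D]]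
    show "((\<lambda>t. 1 / t * measure (distr P (struct_borel L S) (X t)) (C \<union> D)) \<longlongrightarrow> \<rho> C + \<rho> D) (at_right 0)"
      by (rule Lim_transform_eventually)
  qed simp
  have "\<rho> {} = 0" using add[of "{}" "{}"] by simp
  then have "positive ?R (\<lambda>C. ennreal (\<rho> C))" by (simp add: positive_def)
  moreover have "countably_additive ?R (\<lambda>C. ennreal (\<rho> C))"
    by (rule countably_additive_by_compactness[OF S]) (simp_all add: \<open>\<rho> {} = 0\<close> add \<rho>(1))
  ultimately obtain \<nu> where \<nu>: "\<forall>C\<in>?R. \<nu> C = ennreal (\<rho> C)"
      "measure_space (structs L S) (sigma_sets (structs L S) ?R) \<nu>"
    using caratheodory' by blast
  define m where "m = measure_of (structs L S) (sigma_sets (structs L S) ?R) \<nu>"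
  have sets_m: "sets m = sets (struct_borel L S)" "space m = structs L S"
    using \<nu>(2) unfolding m_def sets_struct_borel_zero_free[OF S]
    by (auto simp: measure_space_def intro!: sigma_algebra.sets_measure_of_eq sigma_algebra.space_measure_of_eq)
  have em_m: "emeasure m A = \<nu> A" if "A \<in> sets m" for A
    using \<nu>(2) that unfolding m_def sets_m(1)[unfolded m_def] sets_struct_borel_zero_free[OF S]
    by (intro emeasure_measure_of_sigma) (auto simp: measure_space_def)
  define N where "N = structs L S - {zero_struct L S}"
  have N: "N \<in> sets m" unfolding N_def sets_m(1) by (rule open_in_struct_borel[OF openin_nonzero[OF S]])
  define \<mu> where "\<mu> = density m (indicator N)"
  have em: "emeasure \<mu> A = emeasure m (N \<inter> A)" if "A \<in> sets m" for A
    using that N unfolding \<mu>_def by (subst emeasure_density) (auto simp: indicator_inter_arith[symmetric])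
  have em_ring: "emeasure \<mu> C = ennreal (\<rho> C)" if C: "C \<in> ?R" for C
  proof -
    have "N \<inter> C = C" using zero_free_cylinders_sub[OF C] by (auto simp: N_def)
    then show ?thesis using em[of C] em_m[of C] borel[OF C] \<nu>(1) C sets_m by simp
  qed
  have "levy_measure L S \<mu>"
    unfolding levy_measure_def
  proof (intro conjI allI impI)
    show "sets \<mu> = sets (struct_borel L S)" by (simp add: \<mu>_def sets_m)
    have "{zero_struct L S} = space m - N" using zero_struct_in_structs by (auto simp: N_def sets_m)
    then have "{zero_struct L S} \<in> sets m" using N by auto
    moreover have "N \<inter> {zero_struct L S} = {}" by (auto simp: N_def)
    ultimately show "emeasure \<mu> {zero_struct L S} = 0" by (simp add: em)
    fix n :: nat assume "1 \<le> n"
    then show "emeasure \<mu> {M \<in> structs L S. restrict_struct M (initial S n) \<noteq> zero_struct L (initial S n)} < \<infinity>"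
      by (subst em_ring[OF nonzero_level_zero_free]) auto
  qed
  moreover have "has_exponents L S \<mu> P X"
  proof (rule has_exponentsI[OF S])
    fix \<psi> assume c: "character L S \<psi>"
    have "measure \<mu> (odd_part L S \<psi>) = \<rho> (odd_part L S \<psi>)"
      using em_ring[OF odd_part_zero_free[OF c]] \<rho>(1)[OF odd_part_zero_free[OF c]] by (simp add: measure_def)
    then show "((\<lambda>t. 1 / t * measure (distr P (struct_borel L S) (X t)) (odd_part L S \<psi>)) \<longlongrightarrow>
         measure \<mu> (odd_part L S \<psi>)) (at_right 0)"
      using \<rho>(2)[OF odd_part_zero_free[OF c]] by simp
  qed
  ultimately show ?thesis by blast
qed

end

section \<open>Generating functions of counting variables\<close>

text \<open>
  Counts take values in \<open>{0, 1, 2, \<dots>, \<infinity>}\<close>, embedded in the extended nonnegative reals. This lifts a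
  function on the natural numbers to such counts, with value 0 at infinity.
\<close>

definition on_nat :: "(nat \<Rightarrow> real) \<Rightarrow> ennreal \<Rightarrow> real" where
  "on_nat g k = (if k \<in> range of_nat then g (nat \<lfloor>enn2real k\<rfloor>) else 0)"

text \<open>
  The power \<open>s ^ k\<close> of a possibly infinite count. At \<open>k = \<infinity>\<close> it is the limit of \<open>s ^ n\<close>, which is 0 for \<open>s < 1\<close>
  and 1 for \<open>s = 1\<close>; the latter makes a generating function at \<open>s = 1\<close> equal to the total mass, including
  the mass of an infinite count.
\<close>

definition gpow :: "real \<Rightarrow> ennreal \<Rightarrow> real" where
  "gpow s k = (if s = 1 then 1 else on_nat (\<lambda>n. s ^ n) k)"

lemma on_nat_of_nat [simp]: "on_nat g (of_nat n) = g n"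
  by (simp add: on_nat_def)

lemma on_nat_top [simp]: "on_nat g \<top> = 0"
  by (auto simp: on_nat_def)

lemma measurable_on_nat [measurable]: "on_nat g \<in> borel_measurable borel"
proof -
  have "range (of_nat :: nat \<Rightarrow> ennreal) = (\<Union>n. {of_nat n})" by auto
  also have "\<dots> \<in> sets borel" by (intro sets.countable_UN) auto
  finally have [measurable]: "range (of_nat :: nat \<Rightarrow> ennreal) \<in> sets borel" .
  have [measurable]: "(\<lambda>k::ennreal. g (nat \<lfloor>enn2real k\<rfloor>)) \<in> borel_measurable borel"
    by measurable
  show ?thesis unfolding on_nat_def[abs_def] by measurable
qed

lemma measurable_gpow [measurable]: "gpow s \<in> borel_measurable borel"
  by (cases "s = 1") (simp_all add: gpow_def[abs_def])

lemma gpow_bounds: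
  assumes "0 < s" "s \<le> 1"
  shows "0 \<le> gpow s k" "gpow s k \<le> 1"
  using assms by (auto simp: gpow_def on_nat_def power_le_one)

lemma abs_on_nat_le: "(\<And>n. \<bar>g n\<bar> \<le> B) \<Longrightarrow> \<bar>on_nat g k\<bar> \<le> B"
  using order_trans[OF abs_ge_zero, of "g 0" B] by (auto simp: on_nat_def)

text \<open>
  If the coefficients below \<open>m\<close> vanish, dividing by \<open>s ^ m\<close> leaves a power series with constant term
  \<open>a m\<close> that vanishes to the right of 0 and is continuous at 0.
\<close>

lemma power_series_zero_on_right:
  fixes a :: "nat \<Rightarrow> real"
  assumes bound: "\<And>n. \<bar>a n\<bar> \<le> B" and zero: "\<And>s. 0 < s \<Longrightarrow> s < 1 \<Longrightarrow> (\<lambda>n. a n * s ^ n) sums 0"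
  shows "a n = 0"
proof (induction n rule: less_induct)
  case (less m)
  have summ: "summable (\<lambda>n. a (n + m) * x ^ n)" if "norm x < 1" for x
  proof (rule summable_comparison_test'[where g = "\<lambda>n. B * norm x ^ n"])
    show "summable (\<lambda>n. B * norm x ^ n)" using that by (intro summable_mult summable_geometric) simp
    show "norm (a (n + m) * x ^ n) \<le> B * norm x ^ n" for n
      using bound[of "n + m"] by (simp add: abs_mult power_abs mult_right_mono)
  qed
  define F where "F x = (\<Sum>n. a (n + m) * x ^ n)" for x
  have "(F \<longlongrightarrow> a (0 + m)) (at 0)"
    by (rule powser_limit_0[where s = 1]) (simp_all add: F_def summable_sums summ)
  then have lim: "(F \<longlongrightarrow> a m) (at_right 0)" by (simp add: filterlim_at_split)
  have F0: "F s = 0" if s: "0 < s" "s < 1" for s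
  proof -
    have "(\<lambda>n. a (n + m) * s ^ (n + m)) sums (0 - (\<Sum>i<m. a i * s ^ i))"
      using zero[OF s] by (rule sums_split_initial_segment)
    moreover have "(\<Sum>i<m. a i * s ^ i) = 0" by (rule sum.neutral) (use less in auto)
    ultimately have "(\<lambda>n. (a (n + m) * s ^ n) * s ^ m) sums 0" by (simp add: power_add mult.assoc)
    moreover have "(\<lambda>n. (a (n + m) * s ^ n) * s ^ m) sums (F s * s ^ m)"
      unfolding F_def using s by (intro sums_mult2 summable_sums summ) simp
    ultimately have "F s * s ^ m = 0" using sums_unique2 by blast
    then show ?thesis using s by simp
  qed
  have "\<forall>\<^sub>F s in at_right 0. F s = 0"
    unfolding eventually_at_right_field using F0 by (intro exI[of _ 1]) simp
  then have "(F \<longlongrightarrow> 0) (at_right 0)" by (rule tendsto_eventually)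
  with lim show "a m = 0" by (intro tendsto_unique[OF _ lim]) auto
qed

lemma exp_series_weighted: "(\<lambda>n. c ^ n * (l ^ n / fact n * exp (- l))) sums exp (- (1 - c) * l)" for c l :: real
proof -
  have "(\<lambda>n. (c * l) ^ n / fact n * exp (- l)) sums (exp (c * l) * exp (- l))"
    using exp_converges[of "c * l"] by (intro sums_mult2) (simp add: field_simps)
  also have "exp (c * l) * exp (- l) = exp (- (1 - c) * l)"
    by (simp add: mult_exp_exp algebra_simps)
  finally show ?thesis by (simp add: power_mult_distrib mult_ac)
qed

context prob_space
begin

text \<open>
  The partial sums are the integrals of \<open>Z\<close> times \<open>g\<close> truncated to counts below \<open>n\<close>, and these are dominated
  by a multiple of \<open>\<bar>Z\<bar>\<close>.
\<close>

lemma sums_expectation_on_nat: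
  assumes Z: "integrable M Z" and K [measurable]: "K \<in> borel_measurable M" and g: "\<And>n. \<bar>g n\<bar> \<le> B"
  shows "(\<lambda>n. g n * expectation (\<lambda>\<omega>. Z \<omega> * indicator {\<omega>. K \<omega> = of_nat n} \<omega>)) sums
     expectation (\<lambda>\<omega>. Z \<omega> * on_nat g (K \<omega>))"
  unfolding sums_def
proof -
  note [measurable] = borel_measurable_integrable[OF Z]
  have int: "integrable M (\<lambda>\<omega>. Z \<omega> * indicator {\<omega>. K \<omega> = of_nat n} \<omega>)" for n
    by (rule Bochner_Integration.integrable_bound[OF Z]) (auto split: split_indicator)
  have partial: "(\<Sum>i<n. g i * expectation (\<lambda>\<omega>. Z \<omega> * indicator {\<omega>. K \<omega> = of_nat i} \<omega>)) =
      expectation (\<lambda>\<omega>. Z \<omega> * on_nat (\<lambda>i. if i < n then g i else 0) (K \<omega>))" for n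
  proof -
    have "(\<Sum>i<n. g i * expectation (\<lambda>\<omega>. Z \<omega> * indicator {\<omega>. K \<omega> = of_nat i} \<omega>)) =
       expectation (\<lambda>\<omega>. \<Sum>i<n. g i * (Z \<omega> * indicator {\<omega>. K \<omega> = of_nat i} \<omega>))"
      using int by (subst Bochner_Integration.integral_sum) auto
    also have "\<dots> = expectation (\<lambda>\<omega>. Z \<omega> * on_nat (\<lambda>i. if i < n then g i else 0) (K \<omega>))"
    proof (rule Bochner_Integration.integral_cong[OF refl])
      fix \<omega>
      show "(\<Sum>i<n. g i * (Z \<omega> * indicator {\<omega>. K \<omega> = of_nat i} \<omega>)) =
         Z \<omega> * on_nat (\<lambda>i. if i < n then g i else 0) (K \<omega>)"
      proof (cases "K \<omega> \<in> range of_nat")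
        case True
        then obtain m where m: "K \<omega> = of_nat m" by auto
        have "(\<Sum>i<n. g i * (Z \<omega> * indicator {\<omega>. K \<omega> = of_nat i} \<omega>)) = (\<Sum>i<n. if i = m then g i * Z \<omega> else 0)"
          by (rule sum.cong) (auto simp: m indicator_def)
        also have "\<dots> = Z \<omega> * on_nat (\<lambda>i. if i < n then g i else 0) (K \<omega>)"
          by (simp add: m)
        finally show ?thesis .
      next
        case False
        then have "indicator {\<omega>. K \<omega> = of_nat i} \<omega> = (0::real)" for i by (auto simp: indicator_def)
        then show ?thesis using False by (simp add: on_nat_def)
      qed
    qed
    finally show ?thesis .
  qed
  show "(\<lambda>n. \<Sum>i<n. g i * expectation (\<lambda>\<omega>. Z \<omega> * indicator {\<omega>. K \<omega> = of_nat i} \<omega>)) \<longlonglongrightarrow>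
    expectation (\<lambda>\<omega>. Z \<omega> * on_nat g (K \<omega>))"
    unfolding partial
  proof (rule integral_dominated_convergence[where w = "\<lambda>\<omega>. B * \<bar>Z \<omega>\<bar>"])
    show "integrable M (\<lambda>\<omega>. B * \<bar>Z \<omega>\<bar>)" using Z by simp
    show "AE \<omega> in M. (\<lambda>n. Z \<omega> * on_nat (\<lambda>i. if i < n then g i else 0) (K \<omega>)) \<longlonglongrightarrow> Z \<omega> * on_nat g (K \<omega>)"
    proof (rule AE_I2)
      fix \<omega>
      have "\<forall>\<^sub>F n in sequentially. Z \<omega> * on_nat (\<lambda>i. if i < n then g i else 0) (K \<omega>) = Z \<omega> * on_nat g (K \<omega>)"
        unfolding on_nat_def using eventually_gt_at_top[of "nat \<lfloor>enn2real (K \<omega>)\<rfloor>"]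
        by eventually_elim auto
      then show "(\<lambda>n. Z \<omega> * on_nat (\<lambda>i. if i < n then g i else 0) (K \<omega>)) \<longlonglongrightarrow> Z \<omega> * on_nat g (K \<omega>)"
        by (rule tendsto_eventually)
    qed
    fix n
    have "0 \<le> B" using g[of 0] by simp
    then have "\<bar>on_nat (\<lambda>i. if i < n then g i else 0) k\<bar> \<le> B" for k
      by (intro abs_on_nat_le) (use g in auto)
    then show "AE \<omega> in M. norm (Z \<omega> * on_nat (\<lambda>i. if i < n then g i else 0) (K \<omega>)) \<le> B * \<bar>Z \<omega>\<bar>"
      by (intro AE_I2) (simp add: abs_mult mult.commute[of B] mult_left_mono)
  qed measurable
qed

text \<open>
  Both sides are coefficients of the same power series in \<open>s\<close>, since
  \<open>exp (- (1 - s) \<kappa>) = exp (- \<kappa>) * exp (s \<kappa>)\<close>.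
\<close>

lemma poisson_of_generating_function:
  assumes K [measurable]: "K \<in> borel_measurable M"
    and gf: "\<And>s. 0 < s \<Longrightarrow> s < 1 \<Longrightarrow> expectation (\<lambda>\<omega>. gpow s (K \<omega>)) = exp (- (1 - s) * \<kappa>)" and "0 \<le> \<kappa>"
  shows "prob {\<omega> \<in> space M. K \<omega> = of_nat n} = \<kappa> ^ n / fact n * exp (- \<kappa>)"
proof -
  let ?p = "\<lambda>n. expectation (\<lambda>\<omega>. 1 * indicator {\<omega>. K \<omega> = of_nat n} \<omega>)"
  have p: "?p n = prob {\<omega> \<in> space M. K \<omega> = of_nat n}" for n
    by (auto simp: Int_def intro!: arg_cong[where f = prob])
  have "?p n - \<kappa> ^ n / fact n * exp (- \<kappa>) = 0"
  proof (rule power_series_zero_on_right[where B = "1 + 1" and a = "\<lambda>n. ?p n - \<kappa> ^ n / fact n * exp (- \<kappa>)"])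
    fix n
    have "(\<lambda>n. \<kappa> ^ n / fact n) sums exp \<kappa>" using exp_converges[of \<kappa>] by (simp add: field_simps)
    then have "(\<Sum>i<Suc n. \<kappa> ^ i / fact i) \<le> exp \<kappa>"
      using \<open>0 \<le> \<kappa>\<close> by (intro sum_le_suminf[THEN order_trans]) (auto simp: sums_iff)
    moreover have "\<kappa> ^ n / fact n \<le> (\<Sum>i<Suc n. \<kappa> ^ i / fact i)"
      using \<open>0 \<le> \<kappa>\<close> by (auto intro!: sum_nonneg)
    ultimately have "\<kappa> ^ n / fact n * exp (- \<kappa>) \<le> exp \<kappa> * exp (- \<kappa>)"
      by (intro mult_right_mono) auto
    then have "\<kappa> ^ n / fact n * exp (- \<kappa>) \<le> 1" by (simp add: exp_minus)
    moreover have "0 \<le> \<kappa> ^ n / fact n * exp (- \<kappa>)" using \<open>0 \<le> \<kappa>\<close> by simp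
    ultimately show "\<bar>?p n - \<kappa> ^ n / fact n * exp (- \<kappa>)\<bar> \<le> 1 + 1"
      unfolding p using prob_le_1[of "{\<omega> \<in> space M. K \<omega> = of_nat n}"] measure_nonneg[of M "{\<omega> \<in> space M. K \<omega> = of_nat n}"]
      by linarith
  next
    fix s :: real assume s: "0 < s" "s < 1"
    have "(\<lambda>n. s ^ n * ?p n) sums expectation (\<lambda>\<omega>. 1 * on_nat (\<lambda>n. s ^ n) (K \<omega>))"
      by (rule sums_expectation_on_nat[where B = 1]) (use s in \<open>auto simp: power_le_one\<close>)
    also have "expectation (\<lambda>\<omega>. 1 * on_nat (\<lambda>n. s ^ n) (K \<omega>)) = exp (- (1 - s) * \<kappa>)"
      using gf[OF s] s by (simp add: gpow_def)
    finally have 1: "(\<lambda>n. s ^ n * ?p n) sums exp (- (1 - s) * \<kappa>)" .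
    have "(\<lambda>n. s ^ n * ?p n - s ^ n * (\<kappa> ^ n / fact n * exp (- \<kappa>))) sums 0"
      using sums_diff[OF 1 exp_series_weighted[of s \<kappa>]] by (simp only: diff_self)
    also have "(\<lambda>n. s ^ n * ?p n - s ^ n * (\<kappa> ^ n / fact n * exp (- \<kappa>))) =
        (\<lambda>n. (?p n - \<kappa> ^ n / fact n * exp (- \<kappa>)) * s ^ n)"
      by (rule ext) (simp add: algebra_simps)
    finally show "(\<lambda>n. (?p n - \<kappa> ^ n / fact n * exp (- \<kappa>)) * s ^ n) sums 0" .
  qed
  then show ?thesis using p[of n] by simp
qed

text \<open>
  Comparing coefficients in \<open>s\<close> gives the claim for \<open>B = {n}\<close>, hence for the finite part of any \<open>B\<close>. The
  hypothesis at \<open>s = 1\<close> says \<open>E Z = C\<close> and so settles the value at infinity as well.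
\<close>

lemma factor_out_count:
  assumes K [measurable]: "K \<in> borel_measurable M" and vals: "\<And>\<omega>. \<omega> \<in> space M \<Longrightarrow> K \<omega> \<in> insert \<top> (range of_nat)"
    and Z [measurable]: "Z \<in> borel_measurable M" and Z1: "\<And>\<omega>. \<bar>Z \<omega>\<bar> \<le> 1"
    and gf: "\<And>s. 0 < s \<Longrightarrow> s \<le> 1 \<Longrightarrow> expectation (\<lambda>\<omega>. Z \<omega> * gpow s (K \<omega>)) = C * expectation (\<lambda>\<omega>. gpow s (K \<omega>))"
    and B [measurable]: "B \<in> sets borel"
  shows "expectation (\<lambda>\<omega>. Z \<omega> * indicator B (K \<omega>)) = C * expectation (\<lambda>\<omega>. indicator B (K \<omega>))"
proof -
  have intZ: "integrable M Z" by (rule integrable_const_bound[where B = 1]) (use Z1 in auto)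
  have int1: "integrable M (\<lambda>_. 1 :: real)" by simp
  let ?a = "\<lambda>W n. expectation (\<lambda>\<omega>. W \<omega> * indicator {\<omega>. K \<omega> = of_nat n} \<omega>)"
  have EZ: "expectation Z = C" using gf[of 1] by (simp add: gpow_def prob_space)
  have C1: "\<bar>C\<bar> \<le> 1"
  proof -
    have "\<bar>expectation Z\<bar> \<le> expectation (\<lambda>\<omega>. \<bar>Z \<omega>\<bar>)" by (rule integral_abs_bound)
    also have "\<dots> \<le> expectation (\<lambda>_. 1)" using intZ Z1 by (intro integral_mono) auto
    finally show ?thesis by (simp add: EZ prob_space)
  qed
  have bd: "\<bar>?a W n\<bar> \<le> 1" if W: "W \<in> borel_measurable M" "\<And>\<omega>. \<bar>W \<omega>\<bar> \<le> 1" for W :: "'a \<Rightarrow> real" and n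
  proof -
    note [measurable] = W(1)
    have i: "integrable M (\<lambda>\<omega>. W \<omega> * indicator {\<omega>. K \<omega> = of_nat n} \<omega>)"
      by (rule integrable_const_bound[where B = 1]) (use W(2) in \<open>auto split: split_indicator\<close>)
    have "\<bar>?a W n\<bar> \<le> expectation (\<lambda>\<omega>. \<bar>W \<omega> * indicator {\<omega>. K \<omega> = of_nat n} \<omega>\<bar>)" by (rule integral_abs_bound)
    also have "\<dots> \<le> expectation (\<lambda>_. 1)"
      using i W(2) by (intro integral_mono) (auto split: split_indicator)
    finally show ?thesis by (simp add: prob_space)
  qed
  have coeff: "?a Z n = C * ?a (\<lambda>_. 1) n" for n
  proof -
    have "?a Z n - C * ?a (\<lambda>_. 1) n = 0"
    proof (rule power_series_zero_on_right[where B = 2 and a = "\<lambda>n. ?a Z n - C * ?a (\<lambda>_. 1) n"])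
      fix n
      have "\<bar>C * ?a (\<lambda>_. 1) n\<bar> \<le> 1 * 1"
        unfolding abs_mult by (intro mult_mono C1 bd) auto
      then show "\<bar>?a Z n - C * ?a (\<lambda>_. 1) n\<bar> \<le> 2" using bd[OF Z Z1, of n] by linarith
    next
      fix s :: real assume s: "0 < s" "s < 1"
      have pw: "\<bar>s ^ n\<bar> \<le> 1" for n using s by (simp add: power_le_one)
      have "expectation (\<lambda>\<omega>. Z \<omega> * on_nat (\<lambda>n. s ^ n) (K \<omega>)) = C * expectation (\<lambda>\<omega>. 1 * on_nat (\<lambda>n. s ^ n) (K \<omega>))"
        using gf[of s] s by (simp add: gpow_def)
      with sums_diff[OF sums_expectation_on_nat[OF intZ K, of "\<lambda>n. s ^ n" 1, OF pw]
          sums_mult[OF sums_expectation_on_nat[OF int1 K, of "\<lambda>n. s ^ n" 1, OF pw], of C]]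
      show "(\<lambda>n. (?a Z n - C * ?a (\<lambda>_. 1) n) * s ^ n) sums 0" by (simp add: algebra_simps)
    qed
    then show ?thesis by simp
  qed
  have on: "expectation (\<lambda>\<omega>. Z \<omega> * on_nat g (K \<omega>)) = C * expectation (\<lambda>\<omega>. on_nat g (K \<omega>))"
    if g: "\<And>n. \<bar>g n\<bar> \<le> 1" for g
  proof -
    have "(\<lambda>n. g n * ?a Z n) sums (C * expectation (\<lambda>\<omega>. 1 * on_nat g (K \<omega>)))"
      using sums_mult[OF sums_expectation_on_nat[OF int1 K g], of C] by (simp add: coeff algebra_simps)
    from sums_unique2[OF sums_expectation_on_nat[OF intZ K g] this] show ?thesis by simp
  qed
  define g where "g n = (indicator B (of_nat n :: ennreal) :: real)" for n
  define b where "b = (indicator B \<top> :: real)"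
  \<comment> \<open>The last factor is the indicator of an infinite count.\<close>
  have ind: "indicator B (K \<omega>) = on_nat g (K \<omega>) + b * (1 - on_nat (\<lambda>_. 1) (K \<omega>))" if "\<omega> \<in> space M" for \<omega>
    using vals[OF that] by (auto simp: g_def b_def)
  have io: "integrable M (\<lambda>\<omega>. W \<omega> * on_nat h (K \<omega>))"
    if W: "W \<in> borel_measurable M" "\<And>\<omega>. \<bar>W \<omega>\<bar> \<le> 1" and h: "\<And>n. \<bar>h n\<bar> \<le> 1" for W :: "'a \<Rightarrow> real" and h
  proof (rule integrable_const_bound[where B = 1])
    note [measurable] = W(1)
    show "(\<lambda>\<omega>. W \<omega> * on_nat h (K \<omega>)) \<in> borel_measurable M" by measurable
    show "AE \<omega> in M. norm (W \<omega> * on_nat h (K \<omega>)) \<le> 1"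
      using mult_mono[OF W(2) abs_on_nat_le[OF h]] by (intro AE_I2) (simp add: abs_mult)
  qed
  have g1: "\<bar>g n\<bar> \<le> 1" for n by (simp add: g_def indicator_def)
  have E: "expectation (\<lambda>\<omega>. W \<omega> * indicator B (K \<omega>)) = expectation (\<lambda>\<omega>. W \<omega> * on_nat g (K \<omega>)) +
      b * (expectation W - expectation (\<lambda>\<omega>. W \<omega> * on_nat (\<lambda>_. 1) (K \<omega>)))"
    if W: "W \<in> borel_measurable M" "\<And>\<omega>. \<bar>W \<omega>\<bar> \<le> 1" for W :: "'a \<Rightarrow> real"
  proof -
    have iW: "integrable M W" by (rule integrable_const_bound[where B = 1]) (use W in auto)
    have "expectation (\<lambda>\<omega>. W \<omega> * indicator B (K \<omega>)) =
       expectation (\<lambda>\<omega>. W \<omega> * on_nat g (K \<omega>) + b * (W \<omega> - W \<omega> * on_nat (\<lambda>_. 1) (K \<omega>)))"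
      by (rule Bochner_Integration.integral_cong[OF refl]) (simp add: ind algebra_simps)
    also have "\<dots> = expectation (\<lambda>\<omega>. W \<omega> * on_nat g (K \<omega>)) +
      b * (expectation W - expectation (\<lambda>\<omega>. W \<omega> * on_nat (\<lambda>_. 1) (K \<omega>)))"
      using io[OF W g1] io[OF W, of "\<lambda>_. 1"] iW by simp
    finally show ?thesis .
  qed
  have "expectation (\<lambda>\<omega>. Z \<omega> * indicator B (K \<omega>)) =
      C * expectation (\<lambda>\<omega>. on_nat g (K \<omega>)) + b * (C - C * expectation (\<lambda>\<omega>. on_nat (\<lambda>_. 1) (K \<omega>)))"
    using E[OF Z Z1] on[of g, OF g1] on[of "\<lambda>_. 1"] EZ by simp
  also have "\<dots> = C * (expectation (\<lambda>\<omega>. on_nat g (K \<omega>)) + b * (1 - expectation (\<lambda>\<omega>. on_nat (\<lambda>_. 1) (K \<omega>))))"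
    by (simp add: algebra_simps)
  also have "\<dots> = C * expectation (\<lambda>\<omega>. indicator B (K \<omega>))"
    using E[of "\<lambda>_. 1"] by (simp add: prob_space)
  finally show ?thesis .
qed

text \<open>
  Replace the powers by indicators of measurable sets, one index at a time: with the other factors
  absorbed into \<open>Z\<close>, each step is an instance of the previous lemma.
\<close>

lemma indep_vars_of_generating_functions:
  assumes I: "finite I" and K: "\<And>i. i \<in> I \<Longrightarrow> K i \<in> borel_measurable M"
    and vals: "\<And>i \<omega>. i \<in> I \<Longrightarrow> \<omega> \<in> space M \<Longrightarrow> K i \<omega> \<in> insert \<top> (range of_nat)"
    and gf: "\<And>s. (\<And>i. i \<in> I \<Longrightarrow> 0 < s i \<and> s i \<le> 1) \<Longrightarrow>
       expectation (\<lambda>\<omega>. \<Prod>i\<in>I. gpow (s i) (K i \<omega>)) = (\<Prod>i\<in>I. expectation (\<lambda>\<omega>. gpow (s i) (K i \<omega>)))"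
  shows "indep_vars (\<lambda>_. borel) K I"
proof (cases "I = {}")
  case True
  then show ?thesis by (simp add: indep_vars_def indep_sets_def)
next
  case False
  have *: "expectation (\<lambda>\<omega>. (\<Prod>i\<in>J. indicator (B i) (K i \<omega>)) * (\<Prod>i\<in>I-J. gpow (s i) (K i \<omega>))) =
      (\<Prod>i\<in>J. expectation (\<lambda>\<omega>. indicator (B i) (K i \<omega>))) * (\<Prod>i\<in>I-J. expectation (\<lambda>\<omega>. gpow (s i) (K i \<omega>)))"
    if "finite J" "J \<subseteq> I" "\<And>i. i \<in> I \<Longrightarrow> B i \<in> sets borel" "\<And>i. i \<in> I \<Longrightarrow> 0 < s i \<and> s i \<le> 1" for J B s
    using that
  proof (induction J arbitrary: s rule: finite_induct)
    case empty
    then show ?case using gf by simp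
  next
    case (insert j J)
    have j: "j \<in> I" using insert.prems by auto
    have IJ: "I - J = insert j (I - insert j J)" using j insert.hyps by auto
    define Z where "Z \<omega> = (\<Prod>i\<in>J. indicator (B i) (K i \<omega>)) * (\<Prod>i\<in>I-insert j J. gpow (s i) (K i \<omega>))" for \<omega>
    define C where "C = (\<Prod>i\<in>J. expectation (\<lambda>\<omega>. indicator (B i) (K i \<omega>))) *
         (\<Prod>i\<in>I-insert j J. expectation (\<lambda>\<omega>. gpow (s i) (K i \<omega>)))"
    have "expectation (\<lambda>\<omega>. Z \<omega> * indicator (B j) (K j \<omega>)) = C * expectation (\<lambda>\<omega>. indicator (B j) (K j \<omega>))"
    proof (rule factor_out_count[OF K[OF j] vals[OF j]])
      show "Z \<in> borel_measurable M"
        unfolding Z_def[abs_def]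
        using insert.prems K
        by (intro borel_measurable_times borel_measurable_prod measurable_compose[OF K measurable_gpow]
            measurable_compose[OF K borel_measurable_indicator]) auto
      show "\<bar>Z \<omega>\<bar> \<le> 1" for \<omega>
      proof -
        have "\<bar>\<Prod>i\<in>J. indicator (B i) (K i \<omega>) :: real\<bar> \<le> 1"
          unfolding abs_prod by (rule prod_le_1) auto
        moreover have "\<bar>\<Prod>i\<in>I-insert j J. gpow (s i) (K i \<omega>)\<bar> \<le> 1"
          unfolding abs_prod using insert.prems(3) gpow_bounds by (intro prod_le_1) (auto simp: abs_of_nonneg)
        ultimately show ?thesis unfolding Z_def abs_mult using mult_mono[of _ 1 _ 1] by fastforce
      qed
      fix u :: real assume u: "0 < u" "u \<le> 1"
      have *: "expectation (\<lambda>\<omega>. (\<Prod>i\<in>J. indicator (B i) (K i \<omega>)) * (\<Prod>i\<in>I-J. gpow ((s(j := u)) i) (K i \<omega>))) =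
      (\<Prod>i\<in>J. expectation (\<lambda>\<omega>. indicator (B i) (K i \<omega>))) * (\<Prod>i\<in>I-J. expectation (\<lambda>\<omega>. gpow ((s(j := u)) i) (K i \<omega>)))"
        using insert.prems u by (intro insert.IH) auto
      have sp: "(\<Prod>i\<in>I-J. f ((s(j := u)) i) i) = f u j * (\<Prod>i\<in>I-insert j J. f (s i) i)" for f :: "real \<Rightarrow> _ \<Rightarrow> real"
        unfolding IJ using I by (subst prod.insert) auto
      show "expectation (\<lambda>\<omega>. Z \<omega> * gpow u (K j \<omega>)) = C * expectation (\<lambda>\<omega>. gpow u (K j \<omega>))"
        using * unfolding sp[of "\<lambda>u i. gpow u (K i _)"] sp[of "\<lambda>u i. expectation (\<lambda>\<omega>. gpow u (K i \<omega>))"]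
        by (simp add: Z_def C_def mult_ac)
    qed (use insert.prems j in auto)
    then show ?case using insert.hyps by (simp add: Z_def C_def mult_ac)
  qed
  have "prob (\<Inter>i\<in>I. K i -` A i \<inter> space M) = (\<Prod>i\<in>I. prob (K i -` A i \<inter> space M))"
    if A: "\<And>i. i \<in> I \<Longrightarrow> A i \<in> sets borel" for A
  proof -
    have ind: "expectation (\<lambda>\<omega>. indicator (A i) (K i \<omega>)) = prob (K i -` A i \<inter> space M)" if "i \<in> I" for i
    proof -
      have "expectation (\<lambda>\<omega>. indicator (A i) (K i \<omega>) :: real) = expectation (\<lambda>\<omega>. indicator (K i -` A i \<inter> space M) \<omega>)"
        by (rule Bochner_Integration.integral_cong) (auto split: split_indicator)
      then show ?thesis by (simp add: Int_assoc)
    qed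
    have "expectation (\<lambda>\<omega>. \<Prod>i\<in>I. indicator (A i) (K i \<omega>) :: real) = expectation (\<lambda>\<omega>. indicator (\<Inter>i\<in>I. K i -` A i \<inter> space M) \<omega>)"
    proof (rule Bochner_Integration.integral_cong[OF refl])
      fix \<omega> assume w: "\<omega> \<in> space M"
      have "(\<Prod>i\<in>J. indicator (A i) (K i \<omega>)) = (of_bool (\<forall>i\<in>J. K i \<omega> \<in> A i) :: real)" if "finite J" for J
        using that by (induction J) (auto simp: indicator_def)
      then show "(\<Prod>i\<in>I. indicator (A i) (K i \<omega>)) = (indicator (\<Inter>i\<in>I. K i -` A i \<inter> space M) \<omega> :: real)"
        using I w by (auto simp: indicator_def)
    qed
    also have "\<dots> = prob ((\<Inter>i\<in>I. K i -` A i \<inter> space M) \<inter> space M)"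
      by simp
    also have "(\<Inter>i\<in>I. K i -` A i \<inter> space M) \<inter> space M = (\<Inter>i\<in>I. K i -` A i \<inter> space M)"
      using False by blast
    finally have "prob (\<Inter>i\<in>I. K i -` A i \<inter> space M) = expectation (\<lambda>\<omega>. \<Prod>i\<in>I. indicator (A i) (K i \<omega>))" ..
    moreover have "expectation (\<lambda>\<omega>. (\<Prod>i\<in>I. indicator (A i) (K i \<omega>)) * (\<Prod>i\<in>I-I. gpow 1 (K i \<omega>))) =
      (\<Prod>i\<in>I. expectation (\<lambda>\<omega>. indicator (A i) (K i \<omega>))) * (\<Prod>i\<in>I-I. expectation (\<lambda>\<omega>. gpow 1 (K i \<omega>)))"
      by (rule *[OF I subset_refl A]) auto
    ultimately show ?thesis using ind by simp
  qed
  then have prod: "\<forall>A\<in>(\<Pi> i\<in>I. sets borel). prob (\<Inter>i\<in>I. K i -` A i \<inter> space M) = (\<Prod>i\<in>I. prob (K i -` A i \<inter> space M))"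
    by blast
  show ?thesis
  proof (rule iffD2[OF indep_vars_finite[OF False I] prod])
    show "sets borel = sigma_sets (space borel) (sets borel)" by (rule sets.sigma_sets_eq[symmetric])
    show "Int_stable (sets borel)" by (rule sets.Int_stable)
    show "sets borel \<subseteq> Pow (space borel)" by (rule sets.space_closed)
  qed (use K in auto)
qed

end

section \<open>The exponents of a canonical process\<close>

abbreviation nonzero_at :: "nat list \<Rightarrow> nat set \<Rightarrow> nat \<Rightarrow> lstruct \<Rightarrow> bool" where
  "nonzero_at L S n M \<equiv> restrict_struct M (initial S n) \<noteq> zero_struct L (initial S n)"

text \<open>
  Two simultaneous atoms with different marks differ at some level. At that level the path would have to
  jump by both marks from the same left limit, to the same value.
\<close>

lemma driven_path_distinct_times:
  assumes S: "S \<subseteq> {1..}" and D: "D \<subseteq> {0..} \<times> structs L S"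
    and x: "\<And>t. 0 \<le> t \<Longrightarrow> x t \<in> structs L S"
    and dr: "\<And>n. 1 \<le> n \<Longrightarrow> driven_path L S n D (\<lambda>t. restrict_struct (x t) (initial S n))"
    and u: "0 < u" "(u, M) \<in> D" "(u, M') \<in> D" and n: "nonzero_at L S n M" "nonzero_at L S n M'"
  shows "M = M'"
proof (rule ccontr)
  assume ne: "M \<noteq> M'"
  have M: "M \<in> structs L S" "M' \<in> structs L S" using D u by auto
  then obtain a where a: "a \<in> coords L S" "has_tuple a M \<noteq> has_tuple a M'" using ne structs_eqI by metis
  then obtain m where m: "1 \<le> m" "a \<in> coords L (initial S m)" using coords_eventually[OF S] by blast
  define k where "k = max n m"
  have k: "1 \<le> k" using m by (simp add: k_def)
  have ak: "a \<in> coords L (initial S k)" using m(2) initial_mono[of m k L S] by (auto simp: k_def)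
  have up: "initial S j \<subseteq> S" for j by auto
  have nz: "nonzero_at L S k N" if "nonzero_at L S n N" "N \<in> structs L S" for N
    using that(1) initial_mono[of n k L S]
    unfolding restrict_zero_iff[OF that(2) up] by (auto simp: k_def)
  obtain Y where Y: "\<forall>\<^sub>F s in at_left u. restrict_struct (x s) (initial S k) = Y"
     "restrict_struct (x u) (initial S k) = incr Y (restrict_struct M (initial S k))"
    using dr[OF k] u(2) nz[OF n(1) M(1)] unfolding driven_path_def by fast
  obtain Y' where Y': "\<forall>\<^sub>F s in at_left u. restrict_struct (x s) (initial S k) = Y'"
     "restrict_struct (x u) (initial S k) = incr Y' (restrict_struct M' (initial S k))"
    using dr[OF k] u(3) nz[OF n(2) M(2)] unfolding driven_path_def by fast
  have "\<forall>\<^sub>F s in at_left u. 0 < s" using u(1) by (auto simp: eventually_at_left_field)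
  with Y(1) Y'(1) have "\<forall>\<^sub>F s in at_left u. 0 < s \<and> restrict_struct (x s) (initial S k) = Y \<and> Y = Y'"
    by eventually_elim auto
  then obtain s where s: "0 < s" "restrict_struct (x s) (initial S k) = Y" "Y = Y'"
    using eventually_happens'[of "at_left u"] by auto
  have Ys: "Y \<in> structs L (initial S k)" using restrict_in_structs[OF x[of s] up] s by auto
  have "has_tuple a (incr Y (restrict_struct M (initial S k))) = has_tuple a (incr Y (restrict_struct M' (initial S k)))"
    using Y(2) Y'(2) s(3) by simp
  then show False
    using a(2) unfolding has_tuple_incr[OF Ys restrict_in_structs[OF M(1) up] ak]
       has_tuple_incr[OF Ys restrict_in_structs[OF M(2) up] ak] has_tuple_restrict[OF M(1) ak] has_tuple_restrict[OF M(2) ak]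
    by blast
qed

text \<open>
  The zero structure is in the kernel, so a structure that looks zero at the level of \<open>\<psi>\<close> is as well.
\<close>

lemma odd_part_nonzero_at:
  assumes c: "character L S \<psi>"
    and lev: "\<And>M N. M \<in> structs L S \<Longrightarrow> N \<in> structs L S \<Longrightarrow>
       (\<And>a. a \<in> coords L (initial S n) \<Longrightarrow> has_tuple a M = has_tuple a N) \<Longrightarrow> \<psi> M = \<psi> N"
    and "M \<in> odd_part L S \<psi>"
  shows "nonzero_at L S n M"
proof
  assume "restrict_struct M (initial S n) = zero_struct L (initial S n)"
  moreover have M: "M \<in> structs L S" using assms(3) by (simp add: odd_part_def)
  ultimately have z: "\<forall>a\<in>coords L (initial S n). \<not> has_tuple a M" using restrict_zero_iff[OF M, of "initial S n"] by blast
  have "\<psi> M = \<psi> (zero_struct L S)"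
  proof (rule lev[OF M zero_struct_in_structs])
    fix a assume a: "a \<in> coords L (initial S n)"
    show "has_tuple a M = has_tuple a (zero_struct L S)" using z a has_tuple_zero_struct[OF a, of S] by blast
  qed
  then show False using assms(3) character_zero[OF c] by (simp add: odd_part_def)
qed

text \<open>
  Induction on the number of atoms in \<open>(s, t]\<close> that are visible at level \<open>n\<close>. The path is constant after
  the last of these atoms, and the mark of that atom changes the value of \<open>\<psi>\<close> iff it is in the odd part.
  A time \<open>r\<close> shortly before this atom is after all the others, so the induction hypothesis applies to \<open>r\<close>.
\<close>

lemma driven_path_parity:
  assumes D: "D \<subseteq> {0..} \<times> structs L S" and x: "\<And>t. 0 \<le> t \<Longrightarrow> x t \<in> structs L S"
    and dr: "driven_path L S n D (\<lambda>t. restrict_struct (x t) (initial S n))"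
    and distinct: "\<And>u M M'. 0 < u \<Longrightarrow> (u, M) \<in> D \<Longrightarrow> (u, M') \<in> D \<Longrightarrow>
       nonzero_at L S n M \<Longrightarrow> nonzero_at L S n M' \<Longrightarrow> M = M'"
    and c: "character L S \<psi>"
    and lev: "\<And>M N. M \<in> structs L S \<Longrightarrow> N \<in> structs L S \<Longrightarrow>
       (\<And>a. a \<in> coords L (initial S n) \<Longrightarrow> has_tuple a M = has_tuple a N) \<Longrightarrow> \<psi> M = \<psi> N"
    and s: "0 \<le> s"
    and st: "s \<le> t" and fin: "finite {p \<in> D. s < fst p \<and> fst p \<le> t \<and> nonzero_at L S n (snd p)}"
  shows "\<psi> (incr (x t) (x s)) = (-1) ^ card (D \<inter> ({s<..t} \<times> odd_part L S \<psi>))"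
proof -
  define A where "A t = {p \<in> D. s < fst p \<and> fst p \<le> t \<and> nonzero_at L S n (snd p)}" for t
  define Od where "Od t = D \<inter> ({s<..t} \<times> odd_part L S \<psi>)" for t
  have up: "initial S n \<subseteq> S" by auto
  have lev': "\<psi> M = \<psi> N" if "M \<in> structs L S" "N \<in> structs L S"
      "restrict_struct M (initial S n) = restrict_struct N (initial S n)" for M N
    using that(3) restrict_eq_iff[OF that(1,2) up] by (intro lev that(1,2)) blast
  have odd_nz: "nonzero_at L S n M" if "M \<in> odd_part L S \<psi>" for M
    using that by (intro odd_part_nonzero_at[OF c lev])
  have OA: "Od t \<subseteq> A t" for t
  proof
    fix p assume "p \<in> Od t"
    then have "p \<in> D" "s < fst p" "fst p \<le> t" "snd p \<in> odd_part L S \<psi>" by (auto simp: Od_def)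
    then show "p \<in> A t" unfolding A_def using odd_nz[of "snd p"] by blast
  qed
  have const: "restrict_struct (x t) (initial S n) = restrict_struct (x u) (initial S n)"
    if "0 \<le> u" "u \<le> t" "\<And>v M. (v, M) \<in> D \<Longrightarrow> u < v \<Longrightarrow> v \<le> t \<Longrightarrow> \<not> nonzero_at L S n M" for u t
    using dr that unfolding driven_path_def by fast
  have jump: "\<exists>Y. (\<forall>\<^sub>F s in at_left u. restrict_struct (x s) (initial S n) = Y) \<and>
      restrict_struct (x u) (initial S n) = incr Y (restrict_struct M (initial S n))"
    if "(u, M) \<in> D" "nonzero_at L S n M" for u M
    using dr that unfolding driven_path_def by fast
  have "finite (A t) \<Longrightarrow> s \<le> t \<Longrightarrow> \<psi> (incr (x t) (x s)) = (-1) ^ card (Od t)"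
  proof (induction "card (A t)" arbitrary: t rule: less_induct)
    case less
    have xs: "x s \<in> structs L S" using x s by blast
    have xt: "x t \<in> structs L S" using x s less.prems by simp
    show ?case
    proof (cases "A t = {}")
      case True
      then have "restrict_struct (x t) (initial S n) = restrict_struct (x s) (initial S n)"
        by (intro const s less.prems) (auto simp: A_def)
      then have "\<psi> (x t) = \<psi> (x s)" by (intro lev' xt xs)
      then have "\<psi> (incr (x t) (x s)) = 1"
        using character_incr[OF c xt xs] characterD(2)[OF c xs] by simp
      moreover have "Od t = {}" using OA True by blast
      ultimately show ?thesis by simp
    next
      case False
      define u where "u = Max (fst ` A t)"
      have "u \<in> fst ` A t" unfolding u_def using False less.prems by (intro Max_in) auto
      then obtain M where uM: "(u, M) \<in> A t" by auto
      then have uD: "(u, M) \<in> D" "s < u" "u \<le> t" "nonzero_at L S n M" by (auto simp: A_def)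
      have M: "M \<in> structs L S" using D uD by auto
      have umax: "fst p \<le> u" if "p \<in> A t" for p
        unfolding u_def using less.prems that by (intro Max_ge) auto
      have only: "p = (u, M)" if "p \<in> A t" "fst p = u" for p
        using distinct[OF _ _ uD(1) _ uD(4), of "snd p"] that uD s by (cases p) (auto simp: A_def)
      have xu: "x u \<in> structs L S" using x s uD by simp
      have "restrict_struct (x t) (initial S n) = restrict_struct (x u) (initial S n)"
      proof (rule const)
        fix v N assume v: "(v, N) \<in> D" "u < v" "v \<le> t"
        show "\<not> nonzero_at L S n N"
        proof
          assume "nonzero_at L S n N"
          then have "(v, N) \<in> A t" using v uD by (simp add: A_def)
          from umax[OF this] v show False by simp
        qed
      qed (use uD s in auto)
      then have tu: "\<psi> (x t) = \<psi> (x u)" by (intro lev' xt xu)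
      obtain Y where Y: "\<forall>\<^sub>F r in at_left u. restrict_struct (x r) (initial S n) = Y"
         "restrict_struct (x u) (initial S n) = incr Y (restrict_struct M (initial S n))"
        using jump[OF uD(1,4)] by blast
      \<comment> \<open>The last time before \<open>u\<close> of a visible atom, or \<open>s\<close> if there is none.\<close>
      define m where "m = Max (insert s (fst ` (A t - {(u, M)})))"
      have finm: "finite (insert s (fst ` (A t - {(u, M)})))" using less.prems by simp
      have "m \<in> insert s (fst ` (A t - {(u, M)}))" unfolding m_def by (rule Max_in[OF finm]) simp
      moreover have "fst p < u" if "p \<in> A t - {(u, M)}" for p
        using umax[of p] only[of p] that by force
      ultimately have mu: "m < u" using uD(2) by auto
      have sm: "s \<le> m" unfolding m_def by (rule Max_ge[OF finm]) simp
      have pm: "fst p \<le> m" if "p \<in> A t - {(u, M)}" for p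
        unfolding m_def by (rule Max_ge[OF finm]) (use that in blast)
      have "\<forall>\<^sub>F r in at_left u. m < r \<and> r < u" using mu by (auto simp: eventually_at_left_field)
      with Y(1) have "\<forall>\<^sub>F r in at_left u. restrict_struct (x r) (initial S n) = Y \<and> m < r \<and> r < u"
        by eventually_elim simp
      then obtain r where r: "restrict_struct (x r) (initial S n) = Y" "m < r" "r < u"
        using eventually_happens'[of "at_left u"] by auto
      have xr: "x r \<in> structs L S" using x r sm s by simp
      have Ar: "A r = A t - {(u, M)}"
      proof (intro equalityI subsetI)
        fix p assume "p \<in> A r"
        then show "p \<in> A t - {(u, M)}" using r uD by (auto simp: A_def)
      next
        fix p assume p: "p \<in> A t - {(u, M)}"
        from pm[OF p] p r show "p \<in> A r" by (auto simp: A_def)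
      qed
      have "card (A r) < card (A t)"
        unfolding Ar using less.prems uM by (intro psubset_card_mono) auto
      moreover have "finite (A r)" using less.prems by (simp add: Ar)
      ultimately have IH: "\<psi> (incr (x r) (x s)) = (-1) ^ card (Od r)"
        using less.hyps[of r] sm r by simp
      have Or: "Od r = Od t - {(u, M)}"
      proof -
        have "Od v = {p \<in> A v. snd p \<in> odd_part L S \<psi>}" for v
          using OA[of v] by (auto simp: Od_def A_def)
        then show ?thesis using Ar by auto
      qed
      have "\<psi> (x u) = \<psi> (incr (x r) M)"
      proof (rule lev[OF xu incr_in_structs[OF xr M]])
        fix a assume a: "a \<in> coords L (initial S n)"
        have "has_tuple a (x u) = has_tuple a (restrict_struct (x u) (initial S n))" by (rule has_tuple_restrict[OF xu a, symmetric])
        also have "\<dots> = (has_tuple a (restrict_struct (x r) (initial S n)) \<noteq> has_tuple a (restrict_struct M (initial S n)))"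
          unfolding Y(2) r(1)[symmetric]
          by (rule has_tuple_incr[OF restrict_in_structs[OF xr up] restrict_in_structs[OF M up] a])
        also have "\<dots> = has_tuple a (incr (x r) M)"
          unfolding has_tuple_restrict[OF xr a] has_tuple_restrict[OF M a] has_tuple_incr[OF xr M initial_coords[OF a]] ..
        finally show "has_tuple a (x u) = has_tuple a (incr (x r) M)" .
      qed
      then have "\<psi> (incr (x t) (x s)) = \<psi> (incr (x r) (x s)) * \<psi> M"
        by (simp add: character_incr[OF c xt xs] character_incr[OF c xr xs] character_incr[OF c xr M] tu)
      also have "\<dots> = (-1) ^ card (Od t)"
      proof (cases "\<psi> M = -1")
        case True
        then have "(u, M) \<in> Od t" using uD M by (auto simp: Od_def odd_part_def)
        moreover have "finite (Od t)" using finite_subset[OF OA less.prems(1)] .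
        ultimately have "card (Od t) = Suc (card (Od r))" unfolding Or by (rule card.remove[rotated])
        then show ?thesis by (simp add: IH True)
      next
        case False
        then have "\<psi> M = 1" "(u, M) \<notin> Od t" using characterD(1)[OF c M] by (auto simp: Od_def odd_part_def)
        then show ?thesis by (simp add: IH Or)
      qed
      finally show ?thesis .
    qed
  qed
  then show ?thesis using fin st unfolding A_def Od_def by blast
qed

lemma nonzero_at_in_borel:
  "1 \<le> n \<Longrightarrow> {M \<in> structs L S. nonzero_at L S n M} \<in> sets (struct_borel L S)"
  by (rule open_in_struct_borel[OF zero_free_cylinders_clopen(1)[OF nonzero_level_zero_free]])

text \<open>
  A structure that is nonzero has a coordinate, which is visible at some level \<open>n\<close>; so the space is
  the union of \<open>{0}\<close> and the sets of structures that are nonzero at level \<open>n\<close>.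
\<close>

lemma levy_measure_sigma_finite:
  assumes S: "S \<subseteq> {1..}" and \<mu>: "levy_measure L S \<mu>"
  shows "sigma_finite_measure \<mu>"
proof
  have sets: "sets \<mu> = sets (struct_borel L S)" using \<mu> by (simp add: levy_measure_def)
  have sp: "space \<mu> = structs L S" using sets_eq_imp_space_eq[OF sets] by (simp add: space_struct_borel)
  let ?NZ = "\<lambda>n. {M \<in> structs L S. nonzero_at L S n M}"
  let ?A = "insert {zero_struct L S} (?NZ ` {1..})"
  have z: "{zero_struct L S} \<in> sets \<mu>"
  proof -
    have "space \<mu> - (structs L S - {zero_struct L S}) \<in> sets \<mu>"
      using open_in_struct_borel[OF openin_nonzero[OF S]] by (intro sets.compl_sets) (simp add: sets)
    moreover have "space \<mu> - (structs L S - {zero_struct L S}) = {zero_struct L S}"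
      using zero_struct_in_structs by (auto simp: sp)
    ultimately show ?thesis by simp
  qed
  have "\<Union>?A = space \<mu>"
  proof (intro equalityI subsetI)
    fix M assume "M \<in> \<Union>?A" then show "M \<in> space \<mu>" using zero_struct_in_structs by (auto simp: sp)
  next
    fix M assume "M \<in> space \<mu>"
    then have M: "M \<in> structs L S" by (simp add: sp)
    show "M \<in> \<Union>?A"
    proof (cases "M = zero_struct L S")
      case False
      then obtain a where a: "a \<in> coords L S" "has_tuple a M"
        using structs_eqI[OF M zero_struct_in_structs] has_tuple_zero_struct[of _ L S S] by blast
      obtain n where n: "n \<ge> 1" "a \<in> coords L (initial S n)" using coords_eventually[OF S a(1)] by blast
      then have "nonzero_at L S n M" using a restrict_zero_iff[OF M, of "initial S n"] by blast
      then have "M \<in> ?NZ n" using M by simp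
      then show ?thesis using n(1) by blast
    qed simp
  qed
  moreover have "countable ?A" by simp
  moreover have "?A \<subseteq> sets \<mu>" using z nonzero_at_in_borel by (auto simp: sets)
  moreover have "\<forall>a\<in>?A. emeasure \<mu> a \<noteq> \<infinity>" using \<mu> by (auto simp: levy_measure_def less_top)
  ultimately show "\<exists>A. countable A \<and> A \<subseteq> sets \<mu> \<and> \<Union>A = space \<mu> \<and> (\<forall>a\<in>A. emeasure \<mu> a \<noteq> \<infinity>)"
    by blast
qed

lemma jump_intensity_rectangle:
  assumes "sigma_finite_measure \<mu>" "B \<in> sets \<mu>" "0 \<le> s" "s \<le> t"
  shows "{s<..t} \<times> B \<in> sets (jump_intensity \<mu>)"
    and "emeasure (jump_intensity \<mu>) ({s<..t} \<times> B) = ennreal (t - s) * emeasure \<mu> B"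
proof -
  have I: "{s<..t} \<in> sets (restrict_space lborel {0..})"
    using assms by (auto simp: sets_restrict_space_iff)
  show "{s<..t} \<times> B \<in> sets (jump_intensity \<mu>)"
    unfolding jump_intensity_def using I assms by (intro pair_measureI)
  have "emeasure (jump_intensity \<mu>) ({s<..t} \<times> B) = emeasure (restrict_space lborel {0..}) {s<..t} * emeasure \<mu> B"
    unfolding jump_intensity_def
    by (rule sigma_finite_measure.emeasure_pair_measure_Times[OF assms(1) I assms(2)])
  also have "emeasure (restrict_space lborel {0..}) {s<..t} = ennreal (t - s)"
    using assms by (subst emeasure_restrict_space) auto
  finally show "emeasure (jump_intensity \<mu>) ({s<..t} \<times> B) = ennreal (t - s) * emeasure \<mu> B" .
qed

lemma space_jump_intensity: "space (jump_intensity \<mu>) = {0..} \<times> space \<mu>"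
  by (simp add: jump_intensity_def space_pair_measure space_restrict_space)

text \<open>
  The Poisson weights add up to 1, which leaves no mass for an infinite count.
\<close>

lemma (in prob_space) poisson_AE_finite:
  fixes K :: "'a \<Rightarrow> ennreal"
  assumes [measurable]: "K \<in> borel_measurable M"
    and p: "\<And>n. prob {\<omega> \<in> space M. K \<omega> = of_nat n} = l ^ n / fact n * exp (- l)"
  shows "AE \<omega> in M. K \<omega> \<in> range of_nat"
proof -
  let ?A = "\<lambda>n. {\<omega> \<in> space M. K \<omega> = of_nat n}"
  have "(\<lambda>n. prob (?A n)) sums prob (\<Union>n. ?A n)"
    by (rule finite_measure_UNION) (auto simp: disjoint_family_on_def)
  moreover have "(\<lambda>n. prob (?A n)) sums 1"
    using exp_series_weighted[of 1 l] by (simp add: p)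
  ultimately have "prob (\<Union>n. ?A n) = 1" using sums_unique2 by blast
  then have "AE \<omega> in M. \<omega> \<in> (\<Union>n. ?A n)" by (rule AE_prob_1)
  then show ?thesis by eventually_elim auto
qed

lemma (in prob_space) poisson_expectation_sign:
  assumes K: "K \<in> borel_measurable M"
    and p: "\<And>n. prob {\<omega> \<in> space M. K \<omega> = of_nat n} = l ^ n / fact n * exp (- l)"
  shows "expectation (\<lambda>\<omega>. on_nat (\<lambda>n. (-1) ^ n) (K \<omega>)) = exp (- 2 * l)"
proof -
  note [measurable] = K
  have "(\<lambda>n. (-1) ^ n * expectation (\<lambda>\<omega>. 1 * indicator {\<omega>. K \<omega> = of_nat n} \<omega>)) sums
     expectation (\<lambda>\<omega>. 1 * on_nat (\<lambda>n. (-1) ^ n) (K \<omega>))"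
    by (rule sums_expectation_on_nat[OF _ K, where B = 1]) simp_all
  moreover have "expectation (\<lambda>\<omega>. 1 * indicator {\<omega>. K \<omega> = of_nat n} \<omega>) = l ^ n / fact n * exp (- l)" for n
    unfolding p[of n, symmetric] by (simp add: Int_def conj_commute)
  ultimately have "(\<lambda>n. (-1) ^ n * (l ^ n / fact n * exp (- l))) sums expectation (\<lambda>\<omega>. on_nat (\<lambda>n. (-1) ^ n) (K \<omega>))"
    by simp
  from sums_unique2[OF this exp_series_weighted[of "-1" l]] show ?thesis by simp
qed

lemma count_space_on_nat:
  assumes "emeasure (count_space UNIV) A \<in> range of_nat"
  shows "finite A" "on_nat g (emeasure (count_space UNIV) A) = g (card A)"
proof -
  show f: "finite A" using assms by (cases "finite A") (auto simp: emeasure_count_space)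
  then show "on_nat g (emeasure (count_space UNIV) A) = g (card A)" by (simp add: emeasure_count_space)
qed

text \<open>
  The structures that are nonzero at level \<open>n\<close> have finite \<open>\<mu>\<close>-measure, so the number of such atoms up to time
  \<open>m\<close> is a Poisson variable. Countably many such events hold simultaneously.
\<close>

lemma locally_finite_atoms:
  assumes S: "S \<subseteq> {1..}" and levy: "levy_measure L S \<mu>"
    and ppp: "poisson_point_process (jump_intensity \<mu>) Q \<Delta>"
  shows "AE \<omega> in Q. \<forall>m. \<forall>n\<in>{1..}. finite (\<Delta> \<omega> \<inter> ({0<..real m} \<times> {M \<in> structs L S. nonzero_at L S n M}))"
proof -
  interpret prob_space Q using ppp by (simp add: poisson_point_process_def)
  have "AE \<omega> in Q. finite (\<Delta> \<omega> \<inter> ({0<..real m} \<times> {M \<in> structs L S. nonzero_at L S n M}))"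
    if n: "n \<ge> 1" for m n
  proof -
    let ?A = "{0<..real m} \<times> {M \<in> structs L S. nonzero_at L S n M}"
    have "emeasure \<mu> {M \<in> structs L S. nonzero_at L S n M} < \<infinity>"
      using levy n by (simp add: levy_measure_def)
    then have A: "?A \<in> sets (jump_intensity \<mu>)" "emeasure (jump_intensity \<mu>) ?A < \<infinity>"
      using jump_intensity_rectangle[OF levy_measure_sigma_finite[OF S levy], of "{M \<in> structs L S. nonzero_at L S n M}" 0 "real m"]
        nonzero_at_in_borel[OF n, of L S] levy by (simp_all add: levy_measure_def ennreal_mult_less_top)
    have "AE \<omega> in Q. emeasure (count_space UNIV) (\<Delta> \<omega> \<inter> ?A) \<in> range of_nat"
    proof (rule poisson_AE_finite)
      show "(\<lambda>\<omega>. emeasure (count_space UNIV) (\<Delta> \<omega> \<inter> ?A)) \<in> borel_measurable Q"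
        using ppp A(1) by (simp add: poisson_point_process_def)
      show "prob {\<omega> \<in> space Q. emeasure (count_space UNIV) (\<Delta> \<omega> \<inter> ?A) = of_nat k} =
          measure (jump_intensity \<mu>) ?A ^ k / fact k * exp (- measure (jump_intensity \<mu>) ?A)" for k
        using ppp A unfolding poisson_point_process_def by blast
    qed
    then show ?thesis by eventually_elim (rule count_space_on_nat(1))
  qed
  then show ?thesis unfolding AE_all_countable by (intro allI AE_ball_countable') simp_all
qed

text \<open>
  Almost surely, \<open>\<psi>\<close> of an increment is \<open>(-1)\<close> to the number of atoms in \<open>(s, t] \<times> {\<psi> = -1}\<close>. For consecutive
  intervals these sets are disjoint, whence the numbers are independent Poisson variables, and
  \<open>E (-1)^K = exp (- 2 l)\<close> for a Poisson variable \<open>K\<close> with mean \<open>l\<close>.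
\<close>

lemma canonical_has_exponents:
  assumes S: "S \<subseteq> {1..}" and can: "canonical_levy_process L S \<mu> Q \<Delta> Y"
  shows "has_exponents L S \<mu> Q Y"
proof -
  let ?\<nu> = "jump_intensity \<mu>"
  let ?K = "\<lambda>A \<omega>. emeasure (count_space UNIV) (\<Delta> \<omega> \<inter> A)"
  have levy: "levy_measure L S \<mu>" and ppp: "poisson_point_process ?\<nu> Q \<Delta>"
    and Y: "\<And>t. 0 \<le> t \<Longrightarrow> Y t \<in> Q \<rightarrow>\<^sub>M struct_borel L S"
    and driven: "AE \<omega> in Q. \<forall>n\<ge>1. driven_path L S n (\<Delta> \<omega>) (\<lambda>t. restrict_struct (Y t \<omega>) (initial S n))"
    using can by (simp_all add: canonical_levy_process_def)
  interpret prob_space Q using ppp by (simp add: poisson_point_process_def)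
  note sf = levy_measure_sigma_finite[OF S levy]
  have sets: "sets \<mu> = sets (struct_borel L S)" using levy by (simp add: levy_measure_def)
  have sp: "space \<mu> = structs L S" using sets_eq_imp_space_eq[OF sets] by (simp add: space_struct_borel)
  have \<Delta>: "\<Delta> \<omega> \<subseteq> {0..} \<times> structs L S" if "\<omega> \<in> space Q" for \<omega>
    using ppp that sp by (auto simp: poisson_point_process_def space_jump_intensity)
  have Ys: "Y t \<omega> \<in> structs L S" if "0 \<le> t" "\<omega> \<in> space Q" for t \<omega>
    using measurable_space[OF Y[OF that(1)] that(2)] by (simp add: space_struct_borel)
  have K: "?K A \<in> borel_measurable Q" if "A \<in> sets ?\<nu>" for A
    using ppp that by (simp add: poisson_point_process_def)
  have pois: "prob {\<omega> \<in> space Q. ?K A \<omega> = of_nat k} = measure ?\<nu> A ^ k / fact k * exp (- measure ?\<nu> A)"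
    if "A \<in> sets ?\<nu>" "emeasure ?\<nu> A < \<infinity>" for A k
    using ppp that unfolding poisson_point_process_def by blast
  have NZfin: "emeasure \<mu> {M \<in> structs L S. nonzero_at L S n M} < \<infinity>" if "n \<ge> 1" for n
    using levy that by (simp add: levy_measure_def)
  have odd_fin: "emeasure \<mu> (odd_part L S \<psi>) < \<infinity>" if c: "character L S \<psi>" for \<psi>
  proof -
    obtain n where n: "n \<ge> 1" "\<And>M N. M \<in> structs L S \<Longrightarrow> N \<in> structs L S \<Longrightarrow>
       (\<And>a. a \<in> coords L (initial S n) \<Longrightarrow> has_tuple a M = has_tuple a N) \<Longrightarrow> \<psi> M = \<psi> N"
      using character_level[OF c] by metis
    have "odd_part L S \<psi> \<subseteq> {M \<in> structs L S. nonzero_at L S n M}"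
    proof
      fix M assume M: "M \<in> odd_part L S \<psi>"
      then have "nonzero_at L S n M" by (intro odd_part_nonzero_at[OF c n(2)])
      then show "M \<in> {M \<in> structs L S. nonzero_at L S n M}" using M by (simp add: odd_part_def)
    qed
    from emeasure_mono[OF this, of \<mu>] show ?thesis
      using NZfin[OF n(1)] nonzero_at_in_borel[OF n(1), of L S] by (auto simp: sets dest: le_less_trans)
  qed
  from locally_finite_atoms[OF S levy ppp] driven have good: "AE \<omega> in Q. \<omega> \<in> space Q \<and>
     (\<forall>n\<ge>1. driven_path L S n (\<Delta> \<omega>) (\<lambda>t. restrict_struct (Y t \<omega>) (initial S n))) \<and>
     (\<forall>m. \<forall>n\<ge>1. finite (\<Delta> \<omega> \<inter> ({0<..real m} \<times> {M \<in> structs L S. nonzero_at L S n M})))"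
    using AE_space by eventually_elim auto
  have parity: "AE \<omega> in Q. \<psi> (incr (Y t \<omega>) (Y s \<omega>)) = on_nat (\<lambda>n. (-1) ^ n) (?K ({s<..t} \<times> odd_part L S \<psi>) \<omega>)"
    if c: "character L S \<psi>" and st: "0 \<le> s" "s \<le> t" for \<psi> s t
  proof -
    obtain n where n: "n \<ge> 1" "\<And>M N. M \<in> structs L S \<Longrightarrow> N \<in> structs L S \<Longrightarrow>
       (\<And>a. a \<in> coords L (initial S n) \<Longrightarrow> has_tuple a M = has_tuple a N) \<Longrightarrow> \<psi> M = \<psi> N"
      using character_level[OF c] by metis
    let ?A = "{s<..t} \<times> odd_part L S \<psi>"
    have A: "?A \<in> sets ?\<nu>" "emeasure ?\<nu> ?A < \<infinity>"
      using jump_intensity_rectangle[OF sf _ st, of "odd_part L S \<psi>"] odd_part_in_borel[OF c] odd_fin[OF c]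
      by (simp_all add: sets ennreal_mult_less_top)
    from good poisson_AE_finite[OF K[OF A(1)] pois[OF A]] show ?thesis
    proof eventually_elim
      case (elim \<omega>)
      then have w: "\<omega> \<in> space Q"
        and dr: "\<And>n. n \<ge> 1 \<Longrightarrow> driven_path L S n (\<Delta> \<omega>) (\<lambda>t. restrict_struct (Y t \<omega>) (initial S n))"
        and fin: "\<And>m n. n \<ge> 1 \<Longrightarrow> finite (\<Delta> \<omega> \<inter> ({0<..real m} \<times> {M \<in> structs L S. nonzero_at L S n M}))"
        by auto
      obtain m where m: "t \<le> real m" using real_arch_simple by blast
      have "\<psi> (incr (Y t \<omega>) (Y s \<omega>)) = (-1) ^ card (\<Delta> \<omega> \<inter> ?A)"
      proof (rule driven_path_parity[OF \<Delta>[OF w] _ dr[OF n(1)] _ c n(2) st])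
        show "Y t \<omega> \<in> structs L S" if "0 \<le> t" for t using Ys[OF that w] .
        show "M = M'" if "0 < u" "(u, M) \<in> \<Delta> \<omega>" "(u, M') \<in> \<Delta> \<omega>" "nonzero_at L S n M" "nonzero_at L S n M'" for u M M'
          using driven_path_distinct_times[OF S \<Delta>[OF w], of "\<lambda>t. Y t \<omega>"] Ys[OF _ w] dr that by blast
        show "finite {p \<in> \<Delta> \<omega>. s < fst p \<and> fst p \<le> t \<and> nonzero_at L S n (snd p)}"
          by (rule finite_subset[OF _ fin[OF n(1), of m]]) (use \<Delta>[OF w] m st in auto)
      qed
      then show ?case using count_space_on_nat(2)[OF elim(2)] by simp
    qed
  qed
  show ?thesis
    unfolding has_exponents_def
  proof (intro conjI allI impI)
    show "prob_space Q" by (rule prob_space_axioms)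
    show "Y t \<in> Q \<rightarrow>\<^sub>M struct_borel L S" if "0 \<le> t" for t using Y[OF that] .
    show "AE \<omega> in Q. Y 0 \<omega> = zero_struct L S"
      using good
    proof eventually_elim
      case (elim \<omega>)
      have Y0: "Y 0 \<omega> \<in> structs L S" using Ys elim by simp
      show ?case
      proof (rule structs_eqI[OF Y0 zero_struct_in_structs])
        fix a assume a: "a \<in> coords L S"
        then obtain n where n: "n \<ge> 1" "a \<in> coords L (initial S n)" using coords_eventually[OF S] by blast
        then have "restrict_struct (Y 0 \<omega>) (initial S n) = zero_struct L (initial S n)"
          using elim by (simp add: driven_path_def)
        then have "\<not> has_tuple a (Y 0 \<omega>)" using n restrict_zero_iff[OF Y0, of "initial S n"] by blast
        then show "has_tuple a (Y 0 \<omega>) = has_tuple a (zero_struct L S)" using has_tuple_zero_struct[OF a] by blast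
      qed
    qed
    fix r :: nat and \<tau> :: "nat \<Rightarrow> real" and \<psi>
    assume \<tau>: "\<tau> 0 = 0" "mono_on {..r} \<tau>" and c: "\<forall>i<r. character L S (\<psi> i)"
    have \<tau>i: "0 \<le> \<tau> i" "\<tau> i \<le> \<tau> (Suc i)" if "i < r" for i
      using mono_onD[OF \<tau>(2), of 0 i] mono_onD[OF \<tau>(2), of i "Suc i"] \<tau>(1) that by auto
    define A where "A i = {\<tau> i<..\<tau> (Suc i)} \<times> odd_part L S (\<psi> i)" for i
    have A: "A i \<in> sets ?\<nu>" "emeasure ?\<nu> (A i) = ennreal (\<tau> (Suc i) - \<tau> i) * emeasure \<mu> (odd_part L S (\<psi> i))"
      if "i < r" for i
      using jump_intensity_rectangle[OF sf _ \<tau>i[OF that], of "odd_part L S (\<psi> i)"] odd_part_in_borel c that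
      by (simp_all add: sets A_def)
    have Afin: "emeasure ?\<nu> (A i) < \<infinity>" if "i < r" for i
      using A(2)[OF that] odd_fin[of "\<psi> i"] c that by (simp add: ennreal_mult_less_top)
    have Am: "measure ?\<nu> (A i) = (\<tau> (Suc i) - \<tau> i) * measure \<mu> (odd_part L S (\<psi> i))" if "i < r" for i
      using A(2)[OF that] \<tau>i[OF that] by (simp add: measure_def enn2real_mult)
    have disj: "disjoint_family_on A {..<r}"
      unfolding disjoint_family_on_def
    proof (intro ballI impI)
      have lt: "A i \<inter> A j = {}" if "i < j" "j < r" for i j
        using mono_onD[OF \<tau>(2), of "Suc i" j] that by (auto simp: A_def)
      fix i j assume "i \<in> {..<r}" "j \<in> {..<r}" "i \<noteq> j"
      then show "A i \<inter> A j = {}" using lt[of i j] lt[of j i] by (cases "i < j") auto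
    qed
    have ind: "indep_vars (\<lambda>_. borel) (\<lambda>i. ?K (A i)) {..<r}"
      using ppp A(1) disj unfolding poisson_point_process_def by blast
    then have ind': "indep_vars (\<lambda>_. borel) (\<lambda>i \<omega>. on_nat (\<lambda>n. (-1) ^ n) (?K (A i) \<omega>)) {..<r}"
      by (rule indep_vars_compose2) simp
    have "expectation (\<lambda>\<omega>. \<Prod>i<r. \<psi> i (incr (Y (\<tau> (Suc i)) \<omega>) (Y (\<tau> i) \<omega>))) =
       expectation (\<lambda>\<omega>. \<Prod>i<r. on_nat (\<lambda>n. (-1) ^ n) (?K (A i) \<omega>))"
    proof (rule integral_cong_AE)
      show "(\<lambda>\<omega>. \<Prod>i<r. \<psi> i (incr (Y (\<tau> (Suc i)) \<omega>) (Y (\<tau> i) \<omega>))) \<in> borel_measurable Q"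
      proof (rule borel_measurable_prod)
        fix i assume "i \<in> {..<r}"
        then show "(\<lambda>\<omega>. \<psi> i (incr (Y (\<tau> (Suc i)) \<omega>) (Y (\<tau> i) \<omega>))) \<in> borel_measurable Q"
          using \<tau>i[of i] c by (intro measurable_compose[OF measurable_incr[OF S Y Y] measurable_character]) auto
      qed
      show "(\<lambda>\<omega>. \<Prod>i<r. on_nat (\<lambda>n. (-1) ^ n) (?K (A i) \<omega>)) \<in> borel_measurable Q"
        using A(1) by (intro borel_measurable_prod measurable_compose[OF K measurable_on_nat]) auto
      have "AE \<omega> in Q. \<forall>i\<in>{..<r}. \<psi> i (incr (Y (\<tau> (Suc i)) \<omega>) (Y (\<tau> i) \<omega>)) = on_nat (\<lambda>n. (-1) ^ n) (?K (A i) \<omega>)"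
        unfolding A_def using c \<tau>i by (intro AE_finite_allI parity) auto
      then show "AE \<omega> in Q. (\<Prod>i<r. \<psi> i (incr (Y (\<tau> (Suc i)) \<omega>) (Y (\<tau> i) \<omega>))) =
          (\<Prod>i<r. on_nat (\<lambda>n. (-1) ^ n) (?K (A i) \<omega>))"
        by eventually_elim (rule prod.cong, auto)
    qed
    also have "\<dots> = (\<Prod>i<r. expectation (\<lambda>\<omega>. on_nat (\<lambda>n. (-1) ^ n) (?K (A i) \<omega>)))"
    proof (rule indep_vars_lebesgue_integral[OF _ ind'])
      fix i assume i: "i \<in> {..<r}"
      show "integrable Q (\<lambda>\<omega>. on_nat (\<lambda>n. (-1) ^ n) (?K (A i) \<omega>))"
        using i A(1)[of i] abs_on_nat_le[of "\<lambda>n. (-1) ^ n" 1]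
        by (intro integrable_const_bound[where B = 1] measurable_compose[OF K measurable_on_nat]) auto
    qed simp
    also have "\<dots> = (\<Prod>i<r. exp (- 2 * (\<tau> (Suc i) - \<tau> i) * measure \<mu> (odd_part L S (\<psi> i))))"
    proof (rule prod.cong[OF refl])
      fix i assume "i \<in> {..<r}"
      then have i: "i < r" by simp
      show "expectation (\<lambda>\<omega>. on_nat (\<lambda>n. (-1) ^ n) (?K (A i) \<omega>)) =
          exp (- 2 * (\<tau> (Suc i) - \<tau> i) * measure \<mu> (odd_part L S (\<psi> i)))"
        using poisson_expectation_sign[OF K[OF A(1)[OF i]] pois[OF A(1)[OF i] Afin[OF i]]] Am[OF i]
        by (simp add: algebra_simps)
    qed
    finally show "expectation (\<lambda>\<omega>. \<Prod>i<r. \<psi> i (incr (Y (\<tau> (Suc i)) \<omega>) (Y (\<tau> i) \<omega>))) =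
        (\<Prod>i<r. exp (- 2 * (\<tau> (Suc i) - \<tau> i) * measure \<mu> (odd_part L S (\<psi> i))))" .
  qed
qed

section \<open>Construction of a Poisson point process\<close>

text \<open>
  An increasing sequence of natural numbers is eventually constant or tends to infinity.
\<close>

lemma ennreal_limit_of_nat:
  fixes f :: "nat \<Rightarrow> nat"
  assumes mono: "incseq f" and lim: "(\<lambda>n. of_nat (f n) :: ennreal) \<longlonglongrightarrow> k"
  shows "k \<in> insert \<top> (range of_nat)"
    and "0 < s \<Longrightarrow> s \<le> 1 \<Longrightarrow> (\<lambda>n. gpow s (of_nat (f n))) \<longlonglongrightarrow> gpow s k"
proof -
  have "(\<exists>m. k = of_nat m \<and> (\<forall>\<^sub>F n in sequentially. f n = m)) \<or> (k = \<top> \<and> filterlim f at_top sequentially)"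
  proof (cases "\<exists>m. \<forall>n. f n \<le> m")
    case True
    then have fin: "finite (range f)" by (metis finite_nat_set_iff_bounded_le rangeE)
    define m where "m = Max (range f)"
    obtain N where N: "f N = m" using Max_in[OF fin] unfolding m_def by (metis UNIV_not_empty empty_is_image imageE)
    have "f n = m" if "N \<le> n" for n
      using incseqD[OF mono that] Max_ge[OF fin, of "f n"] N by (simp add: m_def)
    then have ev: "\<forall>\<^sub>F n in sequentially. f n = m" by (auto simp: eventually_sequentially)
    then have "(\<lambda>n. of_nat (f n) :: ennreal) \<longlonglongrightarrow> of_nat m" by (intro tendsto_eventually) (auto elim: eventually_mono)
    then have "k = of_nat m" by (rule LIMSEQ_unique[OF lim])
    with ev show ?thesis by blast
  next
    case False
    have top: "filterlim f at_top sequentially"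
      unfolding filterlim_at_top
    proof
      fix Z
      obtain N where "Z < f N" using False by (meson not_le)
      then have "Z \<le> f n" if "N \<le> n" for n using incseqD[OF mono that] by simp
      then show "\<forall>\<^sub>F n in sequentially. Z \<le> f n" by (auto simp: eventually_sequentially)
    qed
    have "of_nat m \<le> k" for m
    proof (rule tendsto_lowerbound[OF lim])
      have "\<forall>\<^sub>F n in sequentially. m \<le> f n" using top by (simp add: filterlim_at_top)
      then show "\<forall>\<^sub>F n in sequentially. of_nat m \<le> (of_nat (f n) :: ennreal)" by eventually_elim simp
    qed simp
    then have "k = \<top>" using ennreal_Ex_less_of_nat[of k] by (meson leD less_top)
    with top show ?thesis by blast
  qed
  note cases = this
  then show "k \<in> insert \<top> (range of_nat)" by auto
  assume s: "0 < s" "s \<le> 1"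
  from cases show "(\<lambda>n. gpow s (of_nat (f n))) \<longlonglongrightarrow> gpow s k"
  proof (elim disjE exE conjE)
    fix m assume "k = of_nat m" "\<forall>\<^sub>F n in sequentially. f n = m"
    then show ?thesis by (intro tendsto_eventually) (auto elim: eventually_mono)
  next
    assume k: "k = \<top>" and top: "filterlim f at_top sequentially"
    show ?thesis
    proof (cases "s = 1")
      case False
      have "(\<lambda>n. s ^ n) \<longlonglongrightarrow> 0" using s False by (intro LIMSEQ_realpow_zero) auto
      from filterlim_compose[OF this top] show ?thesis using False by (simp add: gpow_def k)
    qed (simp add: gpow_def)
  qed
qed

text \<open>
  The Poisson distribution, with the degenerate one for mean 0.
\<close>

definition poisson_law :: "real \<Rightarrow> nat pmf" where
  "poisson_law l = (if l = 0 then return_pmf 0 else poisson_pmf l)"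

lemma pmf_poisson_law: "0 \<le> l \<Longrightarrow> pmf (poisson_law l) n = l ^ n / fact n * exp (- l)"
  by (auto simp: poisson_law_def indicator_def split: if_splits)

text \<open>
  A partition of the space of \<open>N\<close> into blocks \<open>B k\<close> of finite measure. In each block, the process will have a
  Poisson number of independent points with law proportional to \<open>N\<close>. All random variables live on one sequence
  of points of \<open>N\<close>, so the Poisson numbers are encoded as points by \<open>code\<close> and read off by \<open>decode\<close>. The function
  \<open>time\<close> has a diffuse image under \<open>N\<close>, which makes the atoms almost surely distinct.
\<close>

locale poisson_construction =
  fixes N :: "'b measure" and B :: "nat \<Rightarrow> 'b set" and code :: "nat \<Rightarrow> 'b" and decode :: "'b \<Rightarrow> nat"
    and time :: "'b \<Rightarrow> real"
  assumes B_sets: "\<And>k. B k \<in> sets N" and B_UN: "(\<Union>k. B k) = space N"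
    and B_fin: "\<And>k. emeasure N (B k) \<noteq> \<infinity>" and B_disj: "disjoint_family B"
    and code_space: "\<And>n. code n \<in> space N" and decode_code: "\<And>n. decode (code n) = n"
    and measurable_decode [measurable]: "decode \<in> N \<rightarrow>\<^sub>M count_space UNIV"
    and measurable_time [measurable]: "time \<in> borel_measurable N"
    and diffuse: "\<And>u. emeasure N {x \<in> space N. time x = u} = 0"
begin

definition rate :: "nat \<Rightarrow> real" where "rate k = measure N (B k)"

text \<open>
  The coordinates are arranged as pairs: \<open>(k, 0)\<close> encodes the number of points in block \<open>k\<close>, and \<open>(k, j + 1)\<close> is
  the \<open>j\<close>-th candidate point of that block. In a block of measure 0 the number is 0 almost surely, so the
  point law chosen there only has to be a probability measure.
\<close>

definition coord_law :: "nat \<Rightarrow> 'b measure" where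
  "coord_law i = (case prod_decode i of
     (k, 0) \<Rightarrow> distr (measure_pmf (poisson_law (rate k))) N code
   | (k, Suc j) \<Rightarrow> if rate k = 0 then return N (code 0) else uniform_measure N (B k))"

definition \<Omega> :: "(nat \<Rightarrow> 'b) measure" where "\<Omega> = PiM UNIV coord_law"

definition number :: "nat \<Rightarrow> (nat \<Rightarrow> 'b) \<Rightarrow> nat" where "number k \<omega> = decode (\<omega> (prod_encode (k, 0)))"

definition point :: "nat \<Rightarrow> nat \<Rightarrow> (nat \<Rightarrow> 'b) \<Rightarrow> 'b" where "point k j \<omega> = \<omega> (prod_encode (k, Suc j))"

lemma rate_nonneg: "0 \<le> rate k" by (simp add: rate_def)

lemma emeasure_B: "emeasure N (B k) = ennreal (rate k)"
  unfolding rate_def using B_fin[of k] by (simp add: emeasure_eq_ennreal_measure)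

lemma measurable_code: "code \<in> count_space UNIV \<rightarrow>\<^sub>M N"
  by (rule measurable_count_space_eq1[THEN iffD2]) (simp add: code_space)

lemma sets_coord_law [measurable_cong]: "sets (coord_law i) = sets N"
  by (auto simp: coord_law_def split: prod.split nat.split)

lemma prob_space_coord_law: "prob_space (coord_law i)"
proof -
  have "prob_space (distr (measure_pmf (poisson_law (rate k))) N code)" for k
    by (rule measure_pmf.prob_space_distr) (use measurable_code in simp)
  moreover have "prob_space (return N (code 0))" by (rule prob_space_return[OF code_space])
  moreover have "prob_space (uniform_measure N (B k))" if "rate k \<noteq> 0" for k
    using that rate_nonneg[of k] by (intro prob_space_uniform_measure) (auto simp: emeasure_B)
  moreover obtain k j where "prod_decode i = (k, j)" by (cases "prod_decode i")
  ultimately show ?thesis by (cases j) (simp_all add: coord_law_def)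
qed

sublocale product_prob_space coord_law UNIV
  by (rule product_prob_spaceI) (rule prob_space_coord_law)

sublocale \<Omega>: prob_space \<Omega>
  unfolding \<Omega>_def by (rule prob_space_PiM[OF prob_space_coord_law])

lemma measurable_coord [measurable]: "(\<lambda>\<omega>. \<omega> i) \<in> \<Omega> \<rightarrow>\<^sub>M N"
proof -
  have "(\<lambda>\<omega>. \<omega> i) \<in> \<Omega> \<rightarrow>\<^sub>M coord_law i" unfolding \<Omega>_def by simp
  then show ?thesis by (simp cong: measurable_cong_sets add: sets_coord_law)
qed

lemma measurable_number [measurable]: "number k \<in> \<Omega> \<rightarrow>\<^sub>M count_space UNIV"
  unfolding number_def[abs_def] by measurable

lemma measurable_point [measurable]: "point k j \<in> \<Omega> \<rightarrow>\<^sub>M N"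
  unfolding point_def[abs_def] by measurable

lemma indep_coords: "\<Omega>.indep_vars coord_law (\<lambda>i \<omega>. \<omega> i) UNIV"
proof (subst \<Omega>.indep_vars_iff_distr_eq_PiM)
  show "(UNIV :: nat set) \<noteq> {}" by simp
  show "(\<lambda>\<omega>. \<omega> i) \<in> \<Omega> \<rightarrow>\<^sub>M coord_law i" for i unfolding \<Omega>_def by simp
  have "distr \<Omega> (coord_law i) (\<lambda>\<omega>. \<omega> i) = coord_law i" for i
    unfolding \<Omega>_def by (rule PiM_component) simp
  moreover have "distr \<Omega> (PiM UNIV coord_law) (\<lambda>x. \<lambda>i\<in>UNIV. x i) = \<Omega>"
    by (simp add: \<Omega>_def restrict_UNIV distr_id2)
  ultimately show "distr \<Omega> (PiM UNIV coord_law) (\<lambda>x. \<lambda>i\<in>UNIV. x i) = PiM UNIV (\<lambda>i. distr \<Omega> (coord_law i) (\<lambda>\<omega>. \<omega> i))"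
    by (simp add: \<Omega>_def)
qed

lemma expectation_prod_coords:
  assumes "finite F" and f: "\<And>i. i \<in> F \<Longrightarrow> f i \<in> borel_measurable N" "\<And>i x. i \<in> F \<Longrightarrow> \<bar>f i x\<bar> \<le> (1::real)"
  shows "\<Omega>.expectation (\<lambda>\<omega>. \<Prod>i\<in>F. f i (\<omega> i)) = (\<Prod>i\<in>F. \<integral>x. f i x \<partial>coord_law i)"
proof -
  have f': "f i \<in> borel_measurable (coord_law i)" if "i \<in> F" for i
    using f(1)[OF that] by (simp cong: measurable_cong_sets add: sets_coord_law)
  have "\<Omega>.indep_vars (\<lambda>_. borel) (\<lambda>i \<omega>. f i (\<omega> i)) F"
    by (rule \<Omega>.indep_vars_compose2[OF \<Omega>.indep_vars_subset[OF indep_coords] f']) auto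
  then have "\<Omega>.expectation (\<lambda>\<omega>. \<Prod>i\<in>F. f i (\<omega> i)) = (\<Prod>i\<in>F. \<Omega>.expectation (\<lambda>\<omega>. f i (\<omega> i)))"
    by (rule \<Omega>.indep_vars_lebesgue_integral[OF assms(1)])
      (auto intro!: \<Omega>.integrable_const_bound[where B = 1] f(2) measurable_compose[OF measurable_coord f(1)])
  also have "\<dots> = (\<Prod>i\<in>F. \<integral>x. f i x \<partial>coord_law i)"
  proof (rule prod.cong[OF refl])
    fix i assume i: "i \<in> F"
    have "(\<integral>x. f i x \<partial>coord_law i) = (\<integral>x. f i x \<partial>distr \<Omega> (coord_law i) (\<lambda>\<omega>. \<omega> i))"
      unfolding \<Omega>_def by (subst PiM_component) auto
    also have "\<dots> = \<Omega>.expectation (\<lambda>\<omega>. f i (\<omega> i))"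
      by (rule integral_distr[OF _ f'[OF i]]) (simp add: \<Omega>_def)
    finally show "\<Omega>.expectation (\<lambda>\<omega>. f i (\<omega> i)) = (\<integral>x. f i x \<partial>coord_law i)" ..
  qed
  finally show ?thesis .
qed

lemma measurable_decode_eq: "(\<lambda>x. of_bool (decode x = m) :: real) \<in> borel_measurable N"
proof -
  have "Measurable.pred N (\<lambda>x. decode x = m)" by measurable
  then show ?thesis unfolding of_bool_def by measurable
qed

lemma coord_law_number: "(\<integral>x. (of_bool (decode x = m) :: real) \<partial>coord_law (prod_encode (k, 0))) = rate k ^ m / fact m * exp (- rate k)"
proof -
  have "(\<integral>x. (of_bool (decode x = m) :: real) \<partial>coord_law (prod_encode (k, 0))) =
     (\<integral>x. (of_bool (decode x = m) :: real) \<partial>distr (measure_pmf (poisson_law (rate k))) N code)"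
    by (simp add: coord_law_def)
  also have "\<dots> = (\<integral>n. (of_bool (decode (code n) = m) :: real) \<partial>measure_pmf (poisson_law (rate k)))"
  proof (rule integral_distr)
    show "code \<in> measure_pmf (poisson_law (rate k)) \<rightarrow>\<^sub>M N" using measurable_code by simp
    show "(\<lambda>x. of_bool (decode x = m) :: real) \<in> borel_measurable N" by (rule measurable_decode_eq)
  qed
  also have "\<dots> = (\<integral>n. indicator {m} n \<partial>measure_pmf (poisson_law (rate k)))"
    by (simp add: decode_code indicator_def of_bool_def)
  also have "\<dots> = pmf (poisson_law (rate k)) m" by (simp add: measure_pmf_single)
  finally show ?thesis by (simp add: pmf_poisson_law rate_nonneg)
qed

text \<open>
  The contribution of block \<open>k\<close> to the Laplace functional: the product of \<open>h\<close> over the points that are used.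
\<close>

definition block_product :: "('b \<Rightarrow> real) \<Rightarrow> nat \<Rightarrow> (nat \<Rightarrow> 'b) \<Rightarrow> real" where
  "block_product h k \<omega> = (\<Prod>j<number k \<omega>. h (point k j \<omega>))"

lemma coord_law_point:
  assumes h: "h \<in> borel_measurable N" "\<And>x. 0 \<le> h x \<and> h x \<le> 1"
  shows "(1 - (\<integral>x. h x \<partial>coord_law (prod_encode (k, Suc j)))) * rate k = (\<integral>x. indicator (B k) x * (1 - h x) \<partial>N)"
proof (cases "rate k = 0")
  case True
  then have "AE x in N. x \<notin> B k" using B_sets[of k] by (intro AE_not_in) (auto simp: null_sets_def emeasure_B)
  then have "AE x in N. indicator (B k) x * (1 - h x) = 0" by eventually_elim simp
  then have "(\<integral>x. indicator (B k) x * (1 - h x) \<partial>N) = 0" by (rule integral_eq_zero_AE)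
  then show ?thesis using True by simp
next
  case False
  then have r: "rate k > 0" using rate_nonneg[of k] by simp
  note [measurable] = h(1) B_sets
  have iB: "integrable N (indicator (B k) :: _ \<Rightarrow> real)" using B_sets B_fin by (simp add: less_top)
  have ih: "integrable N (\<lambda>x. indicator (B k) x * h x)"
    by (rule Bochner_Integration.integrable_bound[OF iB]) (use h(2) in \<open>auto split: split_indicator\<close>)
  have "uniform_measure N (B k) = density N (\<lambda>x. ennreal (indicator (B k) x / rate k))"
    unfolding uniform_measure_def emeasure_B
    using r by (intro density_cong) (auto simp: divide_ennreal[symmetric] ennreal_indicator split: split_indicator)
  then have "(\<integral>x. h x \<partial>coord_law (prod_encode (k, Suc j))) = (\<integral>x. h x \<partial>density N (\<lambda>x. ennreal (indicator (B k) x / rate k)))"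
    using False by (simp add: coord_law_def)
  also have "\<dots> = (\<integral>x. (indicator (B k) x / rate k) *\<^sub>R h x \<partial>N)"
    using r by (intro integral_density) auto
  also have "\<dots> = (\<integral>x. indicator (B k) x * h x \<partial>N) / rate k"
    by simp
  finally have 1: "(\<integral>x. h x \<partial>coord_law (prod_encode (k, Suc j))) = (\<integral>x. indicator (B k) x * h x \<partial>N) / rate k" .
  have "(\<integral>x. indicator (B k) x * (1 - h x) \<partial>N) = (\<integral>x. indicator (B k) x \<partial>N) - (\<integral>x. indicator (B k) x * h x \<partial>N)"
    using iB ih by (simp add: right_diff_distrib)
  also have "(\<integral>x. indicator (B k) x \<partial>N) = rate k"
    using sets.sets_into_space[OF B_sets[of k]] by (simp add: rate_def Int_absorb2)
  finally show ?thesis using r 1 by (simp add: field_simps)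
qed

lemma block_product_bounds:
  assumes "\<And>x. 0 \<le> h x \<and> h x \<le> 1"
  shows "0 \<le> block_product h k \<omega>" "block_product h k \<omega> \<le> 1"
  unfolding block_product_def using assms by (auto intro!: prod_nonneg prod_le_1)

lemma measurable_block_product:
  assumes [measurable]: "h \<in> borel_measurable N"
  shows "block_product h k \<in> borel_measurable \<Omega>"
  unfolding block_product_def[abs_def]
  by (rule measurable_compose_countable[where f = "\<lambda>n \<omega>. \<Prod>j<n. h (point k j \<omega>)" and g = "number k"]) measurable

text \<open>
  Conditionally on \<open>m\<close> points the expectation is \<open>a ^ m\<close>, where \<open>a\<close> is the mean of \<open>h\<close> at one point. Summing over the
  Poisson number gives \<open>exp (- (1 - a) * rate k)\<close>.
\<close>

lemma expectation_block_product:
  assumes h [measurable]: "h \<in> borel_measurable N" and h01: "\<And>x. 0 \<le> h x \<and> h x \<le> 1"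
  shows "\<Omega>.expectation (block_product h k) = exp (- (\<integral>x. indicator (B k) x * (1 - h x) \<partial>N))"
proof -
  let ?g = "\<lambda>m \<omega>. of_bool (number k \<omega> = m) * (\<Prod>j<m. h (point k j \<omega>)) :: real"
  define a where "a = (\<integral>x. h x \<partial>coord_law (prod_encode (k, Suc 0)))"
  have claw: "coord_law (prod_encode (k, Suc j)) = coord_law (prod_encode (k, Suc 0))" for j
    by (simp add: coord_law_def)
  have g: "\<Omega>.expectation (?g m) = rate k ^ m / fact m * exp (- rate k) * a ^ m" for m
  proof -
    let ?e = "\<lambda>j. prod_encode (k, j)"
    define f where "f i = (case prod_decode i of (_, 0) \<Rightarrow> (\<lambda>x. of_bool (decode x = m)) | (_, Suc j) \<Rightarrow> h)" for i
    have inj: "inj_on ?e A" for A by (auto simp: inj_on_def prod_encode_eq)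
    have "?g m = (\<lambda>\<omega>. \<Prod>i\<in>?e ` {..m}. f i (\<omega> i))"
    proof
      fix \<omega>
      have "(\<Prod>i\<in>?e ` {..m}. f i (\<omega> i)) = (\<Prod>j\<le>m. f (?e j) (\<omega> (?e j)))" by (simp add: prod.reindex[OF inj])
      also have "\<dots> = f (?e 0) (\<omega> (?e 0)) * (\<Prod>j<m. f (?e (Suc j)) (\<omega> (?e (Suc j))))"
        unfolding lessThan_Suc_atMost[symmetric] prod.lessThan_Suc_shift ..
      also have "\<dots> = ?g m \<omega>" by (simp add: f_def number_def point_def)
      finally show "?g m \<omega> = (\<Prod>i\<in>?e ` {..m}. f i (\<omega> i))" ..
    qed
    then have "\<Omega>.expectation (?g m) = (\<Prod>i\<in>?e ` {..m}. \<integral>x. f i x \<partial>coord_law i)"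
      using measurable_decode_eq h01
      by (simp only:) (rule expectation_prod_coords, auto simp: f_def split: prod.split nat.split)
    also have "\<dots> = (\<Prod>j\<le>m. \<integral>x. f (?e j) x \<partial>coord_law (?e j))" by (simp add: prod.reindex[OF inj])
    also have "\<dots> = (\<integral>x. f (?e 0) x \<partial>coord_law (?e 0)) * (\<Prod>j<m. \<integral>x. f (?e (Suc j)) x \<partial>coord_law (?e (Suc j)))"
      unfolding lessThan_Suc_atMost[symmetric] prod.lessThan_Suc_shift ..
    also have "(\<integral>x. f (?e 0) x \<partial>coord_law (?e 0)) = rate k ^ m / fact m * exp (- rate k)"
      by (simp add: f_def coord_law_number)
    also have "(\<Prod>j<m. \<integral>x. f (?e (Suc j)) x \<partial>coord_law (?e (Suc j))) = (\<Prod>j<m. a)"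
    proof (rule prod.cong[OF refl])
      show "(\<integral>x. f (?e (Suc j)) x \<partial>coord_law (?e (Suc j))) = a" for j
        unfolding claw[of j] a_def by (simp add: f_def)
    qed
    also have "(\<Prod>j<m. a) = a ^ m" by simp
    finally show ?thesis .
  qed
  have gm: "?g m \<in> borel_measurable \<Omega>" for m
    using measurable_compose[OF measurable_coord measurable_decode_eq[of m], of "prod_encode (k, 0)"]
    by (auto simp: number_def intro!: borel_measurable_times borel_measurable_prod)
  have gi: "integrable \<Omega> (?g m)" for m
  proof (rule \<Omega>.integrable_const_bound[where B = 1, OF _ gm], rule AE_I2)
    fix \<omega>
    have "0 \<le> (\<Prod>j<m. h (point k j \<omega>))" "(\<Prod>j<m. h (point k j \<omega>)) \<le> 1"
      using h01 by (auto intro: prod_nonneg prod_le_1)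
    then show "norm (?g m \<omega>) \<le> 1" by (cases "number k \<omega> = m") simp_all
  qed
  have "(\<lambda>n. \<Sum>m<n. \<Omega>.expectation (?g m)) \<longlonglongrightarrow> \<Omega>.expectation (block_product h k)"
  proof -
    have sum: "(\<Sum>m<n. ?g m \<omega>) = of_bool (number k \<omega> < n) * block_product h k \<omega>" for n \<omega>
    proof -
      have "(\<Sum>m<n. ?g m \<omega>) = (\<Sum>m<n. if m = number k \<omega> then block_product h k \<omega> else 0)"
        by (rule sum.cong) (auto simp: block_product_def)
      then show ?thesis by simp
    qed
    have "(\<lambda>n. \<Omega>.expectation (\<lambda>\<omega>. \<Sum>m<n. ?g m \<omega>)) \<longlonglongrightarrow> \<Omega>.expectation (block_product h k)"
    proof (rule integral_dominated_convergence[where w = "\<lambda>_. 1"])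
      show "AE \<omega> in \<Omega>. (\<lambda>n. \<Sum>m<n. ?g m \<omega>) \<longlonglongrightarrow> block_product h k \<omega>"
      proof (rule AE_I2)
        fix \<omega>
        have "\<forall>\<^sub>F n in sequentially. (\<Sum>m<n. ?g m \<omega>) = block_product h k \<omega>"
          unfolding sum using eventually_gt_at_top[of "number k \<omega>"] by eventually_elim simp
        then show "(\<lambda>n. \<Sum>m<n. ?g m \<omega>) \<longlonglongrightarrow> block_product h k \<omega>" by (rule tendsto_eventually)
      qed
      show "AE \<omega> in \<Omega>. norm (\<Sum>m<n. ?g m \<omega>) \<le> 1" for n
        unfolding sum using block_product_bounds[OF h01] by (intro AE_I2) auto
    qed (use gm measurable_block_product[OF h] in auto)
    then show ?thesis using gi by (subst (asm) Bochner_Integration.integral_sum) auto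
  qed
  then have "(\<lambda>m. rate k ^ m / fact m * exp (- rate k) * a ^ m) sums \<Omega>.expectation (block_product h k)"
    unfolding g sums_def .
  moreover have "(\<lambda>m. rate k ^ m / fact m * exp (- rate k) * a ^ m) = (\<lambda>m. a ^ m * (rate k ^ m / fact m * exp (- rate k)))"
    by (rule ext) (rule mult.commute)
  ultimately have "\<Omega>.expectation (block_product h k) = exp (- (1 - a) * rate k)"
    using sums_unique2[OF _ exp_series_weighted] by simp
  also have "\<dots> = exp (- ((1 - a) * rate k))" by (simp only: mult_minus_left)
  also have "(1 - a) * rate k = (\<integral>x. indicator (B k) x * (1 - h x) \<partial>N)"
    unfolding a_def by (rule coord_law_point[OF h h01])
  finally show ?thesis .
qed

text \<open>
  Different blocks use disjoint sets of coordinates.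
\<close>

lemma expectation_prod_block_product:
  assumes h [measurable]: "h \<in> borel_measurable N" and h01: "\<And>x. 0 \<le> h x \<and> h x \<le> 1"
  shows "\<Omega>.expectation (\<lambda>\<omega>. \<Prod>k<n. block_product h k \<omega>) = (\<Prod>k<n. exp (- (\<integral>x. indicator (B k) x * (1 - h x) \<partial>N)))"
proof -
  let ?K = "\<lambda>k. range (\<lambda>j. prod_encode (k, j))"
  have disj: "disjoint_family_on ?K {..<n}" by (auto simp: disjoint_family_on_def prod_encode_eq)
  have ind: "\<Omega>.indep_vars (\<lambda>k. PiM (?K k) coord_law) (\<lambda>k \<omega>. restrict (\<lambda>i. \<omega> i) (?K k)) {..<n}"
    by (rule \<Omega>.indep_vars_restrict[OF indep_coords _ disj]) simp
  have meas: "block_product h k \<in> borel_measurable (PiM (?K k) coord_law)" for k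
  proof -
    have c: "(\<lambda>\<omega>. \<omega> (prod_encode (k, j))) \<in> PiM (?K k) coord_law \<rightarrow>\<^sub>M N" for j
    proof -
      have "(\<lambda>\<omega>. \<omega> (prod_encode (k, j))) \<in> PiM (?K k) coord_law \<rightarrow>\<^sub>M coord_law (prod_encode (k, j))"
        by (rule measurable_component_singleton) simp
      then show ?thesis by (simp cong: measurable_cong_sets add: sets_coord_law)
    qed
    have num: "number k \<in> PiM (?K k) coord_law \<rightarrow>\<^sub>M count_space UNIV"
      unfolding number_def[abs_def] by (rule measurable_compose[OF c measurable_decode])
    show ?thesis
      unfolding block_product_def[abs_def]
      by (rule measurable_compose_countable[where f = "\<lambda>n \<omega>. \<Prod>j<n. h (point k j \<omega>)" and g = "number k", OF _ num])
        (auto simp: point_def intro!: borel_measurable_prod measurable_compose[OF c h])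
  qed
  have eq: "block_product h k (restrict (\<lambda>i. \<omega> i) (?K k)) = block_product h k \<omega>" for k \<omega>
    by (simp add: block_product_def number_def point_def)
  have "\<Omega>.indep_vars (\<lambda>_. borel) (\<lambda>k \<omega>. block_product h k (restrict (\<lambda>i. \<omega> i) (?K k))) {..<n}"
    by (rule \<Omega>.indep_vars_compose2[OF ind meas])
  then have "\<Omega>.indep_vars (\<lambda>_. borel) (\<lambda>k \<omega>. block_product h k \<omega>) {..<n}" unfolding eq .
  then have "\<Omega>.expectation (\<lambda>\<omega>. \<Prod>k<n. block_product h k \<omega>) = (\<Prod>k<n. \<Omega>.expectation (block_product h k))"
    using block_product_bounds[OF h01] measurable_block_product[OF h]
    by (intro \<Omega>.indep_vars_lebesgue_integral \<Omega>.integrable_const_bound[where B = 1]) auto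
  then show ?thesis by (simp add: expectation_block_product[OF h h01])
qed

definition block_count :: "'b set \<Rightarrow> nat \<Rightarrow> (nat \<Rightarrow> 'b) \<Rightarrow> nat" where
  "block_count A k \<omega> = (\<Sum>j<number k \<omega>. of_bool (point k j \<omega> \<in> A))"

definition total_count :: "'b set \<Rightarrow> (nat \<Rightarrow> 'b) \<Rightarrow> ennreal" where
  "total_count A \<omega> = (\<Sum>k. of_nat (block_count A k \<omega>))"

text \<open>
  The generating function \<open>exp (- (1 - s) l)\<close> of a Poisson variable with mean \<open>l\<close>, extended to \<open>l = \<infinity>\<close> in
  accordance with \<open>gpow\<close>.
\<close>

definition poisson_gf :: "real \<Rightarrow> ennreal \<Rightarrow> real" where
  "poisson_gf s l = (if s = 1 then 1 else if l = \<top> then 0 else exp (- (1 - s) * enn2real l))"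

lemma measurable_total_count [measurable]:
  assumes [measurable]: "A \<in> sets N"
  shows "total_count A \<in> borel_measurable \<Omega>"
proof -
  have 1: "(\<lambda>\<omega>. \<Sum>j<number k \<omega>. indicator A (point k j \<omega>) :: ennreal) \<in> borel_measurable \<Omega>" for k
    by (rule measurable_compose_countable[where f = "\<lambda>n \<omega>. \<Sum>j<n. indicator A (point k j \<omega>)" and g = "number k"]) measurable
  have "of_nat (block_count A k \<omega>) = (\<Sum>j<number k \<omega>. indicator A (point k j \<omega>) :: ennreal)" for k \<omega>
    by (simp add: block_count_def indicator_def of_bool_def if_distrib cong: if_cong)
  then show ?thesis unfolding total_count_def[abs_def] using 1 by simp
qed

lemma partial_count_mono: "incseq (\<lambda>n. \<Sum>k<n. block_count A k \<omega>)"
  by (rule incseq_SucI) simp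

lemma partial_count_limit: "(\<lambda>n. of_nat (\<Sum>k<n. block_count A k \<omega>) :: ennreal) \<longlonglongrightarrow> total_count A \<omega>"
  unfolding total_count_def of_nat_sum by (rule summable_LIMSEQ[OF summableI])

lemma total_count_values: "total_count A \<omega> \<in> insert \<top> (range of_nat)"
  by (rule ennreal_limit_of_nat(1)[OF partial_count_mono partial_count_limit])

lemma poisson_gf_limit:
  assumes A: "A \<in> sets N" and s: "0 < s" "s \<le> 1"
  shows "(\<lambda>n. exp (- (1 - s) * (\<Sum>k<n. measure N (A \<inter> B k)))) \<longlonglongrightarrow> poisson_gf s (emeasure N A)"
proof (cases "s = 1")
  case False
  let ?S = "\<lambda>n. \<Sum>k<n. measure N (A \<inter> B k)"
  have AB: "A \<inter> B k \<in> sets N" for k using A B_sets by auto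
  have disj: "disjoint_family (\<lambda>k. A \<inter> B k)"
    using B_disj unfolding disjoint_family_on_def by blast
  have "(\<Union>k. A \<inter> B k) = A" using B_UN sets.sets_into_space[OF A] by auto
  then have "(\<lambda>k. emeasure N (A \<inter> B k)) sums emeasure N A"
    using sums_emeasure[OF disj AB] by simp
  moreover have "emeasure N (A \<inter> B k) = ennreal (measure N (A \<inter> B k))" for k
  proof (rule emeasure_eq_ennreal_measure)
    have "emeasure N (A \<inter> B k) \<le> emeasure N (B k)" by (rule emeasure_mono[OF _ B_sets]) auto
    then show "emeasure N (A \<inter> B k) \<noteq> \<top>" using B_fin[of k] by (auto simp: top_unique)
  qed
  ultimately have lim: "(\<lambda>n. ennreal (?S n)) \<longlonglongrightarrow> emeasure N A" by (simp add: sums_def)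
  show ?thesis
  proof (cases "emeasure N A = \<top>")
    case True
    then have "filterlim ?S at_top sequentially" using lim by (simp add: ennreal_tendsto_top_eq_at_top)
    then have "filterlim (\<lambda>n. - (1 - s) * ?S n) at_bot sequentially"
      using s False by (intro filterlim_tendsto_neg_mult_at_bot[OF tendsto_const]) auto
    from filterlim_compose[OF exp_at_bot this] show ?thesis using True False by (simp add: poisson_gf_def)
  next
    case fin: False
    then have "(\<lambda>n. enn2real (ennreal (?S n))) \<longlonglongrightarrow> enn2real (emeasure N A)"
      using lim by (intro tendsto_enn2real) (auto simp: less_top)
    then have "?S \<longlonglongrightarrow> enn2real (emeasure N A)" by (simp add: sum_nonneg)
    then have "(\<lambda>n. exp (- (1 - s) * ?S n)) \<longlonglongrightarrow> exp (- (1 - s) * enn2real (emeasure N A))"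
      by (intro tendsto_intros)
    then show ?thesis using fin False by (simp add: poisson_gf_def)
  qed
qed (simp add: poisson_gf_def)

text \<open>
  For disjoint sets \<open>A i\<close>, the product of the powers \<open>s i ^ count (A i)\<close> over the first \<open>n\<close> blocks is a product over
  points of the function \<open>h\<close> that is \<open>s i\<close> on \<open>A i\<close> and 1 elsewhere. Let \<open>n\<close> tend to infinity in its expectation.
\<close>

lemma joint_generating_function:
  assumes I: "finite I" and A: "\<And>i. i \<in> I \<Longrightarrow> A i \<in> sets N" "disjoint_family_on A I"
    and s: "\<And>i. i \<in> I \<Longrightarrow> 0 < s i \<and> s i \<le> 1"
  shows "\<Omega>.expectation (\<lambda>\<omega>. \<Prod>i\<in>I. gpow (s i) (total_count (A i) \<omega>)) = (\<Prod>i\<in>I. poisson_gf (s i) (emeasure N (A i)))"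
proof -
  define h where "h x = (\<Prod>i\<in>I. if x \<in> A i then s i else 1)" for x
  have h01: "0 \<le> h x \<and> h x \<le> 1" for x
    unfolding h_def using s by (auto intro!: prod_nonneg prod_le_1 simp: less_imp_le)
  have hm: "h \<in> borel_measurable N"
    unfolding h_def[abs_def] using A(1) by (intro borel_measurable_prod measurable_If_set) auto
  have gp: "gpow u (of_nat m) = u ^ m" for u m by (simp add: gpow_def)
  have pw: "u ^ block_count C k \<omega> = (\<Prod>j<number k \<omega>. if point k j \<omega> \<in> C then u else 1)" for u :: real and C k \<omega>
    unfolding block_count_def power_sum by (rule prod.cong) auto
  have prod: "(\<Prod>i\<in>I. gpow (s i) (of_nat (\<Sum>k<n. block_count (A i) k \<omega>))) = (\<Prod>k<n. block_product h k \<omega>)" for n \<omega>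
  proof -
    have "(\<Prod>i\<in>I. gpow (s i) (of_nat (\<Sum>k<n. block_count (A i) k \<omega>))) =
        (\<Prod>i\<in>I. \<Prod>k<n. \<Prod>j<number k \<omega>. if point k j \<omega> \<in> A i then s i else 1)"
      unfolding gp power_sum pw ..
    also have "\<dots> = (\<Prod>k<n. \<Prod>i\<in>I. \<Prod>j<number k \<omega>. if point k j \<omega> \<in> A i then s i else 1)"
      by (rule prod.swap)
    also have "\<dots> = (\<Prod>k<n. block_product h k \<omega>)"
      unfolding block_product_def h_def by (intro prod.cong refl prod.swap)
    finally show ?thesis .
  qed
  have hsum: "1 - h x = (\<Sum>i\<in>I. (1 - s i) * indicator (A i) x)" for x
  proof (cases "\<exists>i\<in>I. x \<in> A i")
    case True
    then obtain i where i: "i \<in> I" "x \<in> A i" by blast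
    have other: "x \<notin> A j" if "j \<in> I - {i}" for j
      using A(2) i that by (auto simp: disjoint_family_on_def)
    have "h x = s i"
      unfolding h_def using prod.remove[OF I i(1), of "\<lambda>i. if x \<in> A i then s i else 1"] i other by simp
    moreover have "(\<Sum>i\<in>I. (1 - s i) * indicator (A i) x) = 1 - s i"
      using sum.remove[OF I i(1), of "\<lambda>i. (1 - s i) * indicator (A i) x"] i other by simp
    ultimately show ?thesis by simp
  next
    case False
    then show ?thesis by (simp add: h_def)
  qed
  have int: "(\<integral>x. indicator (B k) x * (1 - h x) \<partial>N) = (\<Sum>i\<in>I. (1 - s i) * measure N (A i \<inter> B k))" for k
  proof -
    have i: "integrable N (\<lambda>x. (1 - s i) * indicator (A i \<inter> B k) x)" if "i \<in> I" for i
    proof -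
      have "emeasure N (A i \<inter> B k) \<le> emeasure N (B k)" by (rule emeasure_mono[OF _ B_sets]) auto
      then have "emeasure N (A i \<inter> B k) < \<infinity>" using B_fin[of k] by (auto simp: less_top top_unique)
      then show ?thesis using A(1)[OF that] B_sets[of k] by simp
    qed
    have "(\<integral>x. indicator (B k) x * (1 - h x) \<partial>N) = (\<integral>x. (\<Sum>i\<in>I. (1 - s i) * indicator (A i \<inter> B k) x) \<partial>N)"
      unfolding hsum sum_distrib_left by (intro Bochner_Integration.integral_cong sum.cong refl) (auto split: split_indicator)
    also have "\<dots> = (\<Sum>i\<in>I. \<integral>x. (1 - s i) * indicator (A i \<inter> B k) x \<partial>N)"
      by (rule Bochner_Integration.integral_sum[OF i])
    also have "\<dots> = (\<Sum>i\<in>I. (1 - s i) * measure N (A i \<inter> B k))"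
      using sets.sets_into_space[OF B_sets[of k]] by (intro sum.cong refl) (simp add: Int_absorb2 le_infI2)
    finally show ?thesis .
  qed
  have "(\<lambda>n. \<Omega>.expectation (\<lambda>\<omega>. \<Prod>k<n. block_product h k \<omega>)) \<longlonglongrightarrow> \<Omega>.expectation (\<lambda>\<omega>. \<Prod>i\<in>I. gpow (s i) (total_count (A i) \<omega>))"
  proof (rule integral_dominated_convergence[where w = "\<lambda>_. 1"])
    show "(\<lambda>\<omega>. \<Prod>i\<in>I. gpow (s i) (total_count (A i) \<omega>)) \<in> borel_measurable \<Omega>"
      using A(1) by (intro borel_measurable_prod measurable_compose[OF measurable_total_count measurable_gpow]) auto
    show "(\<lambda>\<omega>. \<Prod>k<n. block_product h k \<omega>) \<in> borel_measurable \<Omega>" for n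
      using measurable_block_product[OF hm] by (intro borel_measurable_prod) auto
    show "AE \<omega> in \<Omega>. (\<lambda>n. \<Prod>k<n. block_product h k \<omega>) \<longlonglongrightarrow> (\<Prod>i\<in>I. gpow (s i) (total_count (A i) \<omega>))"
      unfolding prod[symmetric] using s
      by (intro AE_I2 tendsto_prod ennreal_limit_of_nat(2)[OF partial_count_mono partial_count_limit]) auto
    show "AE \<omega> in \<Omega>. norm (\<Prod>k<n. block_product h k \<omega>) \<le> 1" for n
      using block_product_bounds[OF h01] by (intro AE_I2) (auto simp: abs_prod intro!: prod_le_1)
  qed simp
  moreover have "\<Omega>.expectation (\<lambda>\<omega>. \<Prod>k<n. block_product h k \<omega>) =
     (\<Prod>i\<in>I. exp (- (1 - s i) * (\<Sum>k<n. measure N (A i \<inter> B k))))" for n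
  proof -
    have "\<Omega>.expectation (\<lambda>\<omega>. \<Prod>k<n. block_product h k \<omega>) = exp (- (\<Sum>k<n. \<Sum>i\<in>I. (1 - s i) * measure N (A i \<inter> B k)))"
      unfolding expectation_prod_block_product[OF hm h01] int by (simp add: exp_sum flip: sum_negf)
    also have "(\<Sum>k<n. \<Sum>i\<in>I. (1 - s i) * measure N (A i \<inter> B k)) = (\<Sum>i\<in>I. \<Sum>k<n. (1 - s i) * measure N (A i \<inter> B k))"
      by (rule sum.swap)
    also have "exp (- \<dots>) = (\<Prod>i\<in>I. exp (- (1 - s i) * (\<Sum>k<n. measure N (A i \<inter> B k))))"
      unfolding sum_distrib_left[symmetric] sum_negf[symmetric] exp_sum[OF I] by (simp only: mult_minus_left)
    finally show ?thesis .
  qed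
  ultimately have 1: "(\<lambda>n. \<Prod>i\<in>I. exp (- (1 - s i) * (\<Sum>k<n. measure N (A i \<inter> B k)))) \<longlonglongrightarrow>
      \<Omega>.expectation (\<lambda>\<omega>. \<Prod>i\<in>I. gpow (s i) (total_count (A i) \<omega>))" by simp
  have 2: "(\<lambda>n. \<Prod>i\<in>I. exp (- (1 - s i) * (\<Sum>k<n. measure N (A i \<inter> B k)))) \<longlonglongrightarrow>
      (\<Prod>i\<in>I. poisson_gf (s i) (emeasure N (A i)))"
    using s A(1) by (intro tendsto_prod poisson_gf_limit) auto
  from LIMSEQ_unique[OF 1 2] show ?thesis .
qed

lemma generating_function:
  assumes "A \<in> sets N" "0 < s" "s \<le> 1"
  shows "\<Omega>.expectation (\<lambda>\<omega>. gpow s (total_count A \<omega>)) = poisson_gf s (emeasure N A)"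
  using joint_generating_function[of "{()}" "\<lambda>_. A" "\<lambda>_. s"] assms by (simp add: disjoint_family_on_def)

lemma total_count_poisson:
  assumes A: "A \<in> sets N" "emeasure N A < \<infinity>"
  shows "measure \<Omega> {\<omega> \<in> space \<Omega>. total_count A \<omega> = of_nat n} = measure N A ^ n / fact n * exp (- measure N A)"
proof (rule \<Omega>.poisson_of_generating_function[OF measurable_total_count[OF A(1)]])
  fix s :: real assume s: "0 < s" "s < 1"
  then show "\<Omega>.expectation (\<lambda>\<omega>. gpow s (total_count A \<omega>)) = exp (- (1 - s) * measure N A)"
    using generating_function[OF A(1)] A(2) by (simp add: poisson_gf_def measure_def)
qed simp

text \<open>
  The generating function of the count vanishes at \<open>s = 1/2\<close>, while \<open>(1/2) ^ k\<close> is positive for every finite \<open>k\<close>.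
\<close>

lemma total_count_infinite:
  assumes A: "A \<in> sets N" "emeasure N A = \<infinity>"
  shows "AE \<omega> in \<Omega>. total_count A \<omega> = \<infinity>"
proof -
  have m: "(\<lambda>\<omega>. gpow (1/2) (total_count A \<omega>)) \<in> borel_measurable \<Omega>"
    by (rule measurable_compose[OF measurable_total_count[OF A(1)] measurable_gpow])
  have i: "integrable \<Omega> (\<lambda>\<omega>. gpow (1/2) (total_count A \<omega>))"
    by (rule \<Omega>.integrable_const_bound[where B = 1, OF _ m]) (use gpow_bounds[of "1/2"] in auto)
  have "\<Omega>.expectation (\<lambda>\<omega>. gpow (1/2) (total_count A \<omega>)) = 0"
    using generating_function[OF A(1), of "1/2"] A(2) by (simp add: poisson_gf_def)
  then have "AE \<omega> in \<Omega>. gpow (1/2) (total_count A \<omega>) = 0"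
    using integral_nonneg_eq_0_iff_AE[OF i] gpow_bounds[of "1/2"] by simp
  then show ?thesis
  proof eventually_elim
    case (elim \<omega>)
    then show ?case using total_count_values[of A \<omega>] by (auto simp: gpow_def)
  qed
qed

text \<open>
  The samples for which all points used have different times. Only then does the set of points determine
  their number with multiplicities.
\<close>

definition simple_samples :: "(nat \<Rightarrow> 'b) set" where
  "simple_samples = {\<omega> \<in> space \<Omega>. \<forall>k j k' j'. (k, j) \<noteq> (k', j') \<longrightarrow> j < number k \<omega> \<longrightarrow> j' < number k' \<omega> \<longrightarrow>
     time (point k j \<omega>) \<noteq> time (point k' j' \<omega>)}"

definition atoms :: "(nat \<Rightarrow> 'b) \<Rightarrow> 'b set" where
  "atoms \<omega> = (if \<omega> \<in> simple_samples then {point k j \<omega> | k j. j < number k \<omega>} else {})"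

lemma simple_samples_sets [measurable]: "simple_samples \<in> sets \<Omega>"
  unfolding simple_samples_def
proof (intro sets.sets_Collect_countable_All)
  fix k j k' j'
  have t: "(\<lambda>\<omega>. time (point k j \<omega>)) \<in> borel_measurable \<Omega>" for k j
    by (rule measurable_compose[OF measurable_point measurable_time])
  have n: "{\<omega> \<in> space \<Omega>. j < number k \<omega>} \<in> sets \<Omega>" for k j
    using measurable_sets[OF measurable_number, of "{j<..}" k] by (simp add: vimage_def Int_def conj_commute)
  show "{\<omega> \<in> space \<Omega>. (k, j) \<noteq> (k', j') \<longrightarrow> j < number k \<omega> \<longrightarrow> j' < number k' \<omega> \<longrightarrow>
     time (point k j \<omega>) \<noteq> time (point k' j' \<omega>)} \<in> sets \<Omega>"
    by (intro sets.sets_Collect_imp sets.sets_Collect_const n borel_measurable_neq t)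
qed

lemma AE_number_zero:
  assumes "rate k = 0"
  shows "AE \<omega> in \<Omega>. number k \<omega> = 0"
proof -
  have "\<Omega>.expectation (\<lambda>\<omega>. \<Prod>i\<in>{prod_encode (k, 0)}. of_bool (decode (\<omega> i) = 0) :: real) =
     (\<Prod>i\<in>{prod_encode (k, 0)}. \<integral>x. of_bool (decode x = 0) \<partial>coord_law i)"
  proof (rule expectation_prod_coords)
    show "(\<lambda>x. of_bool (decode x = 0) :: real) \<in> borel_measurable N" by (rule measurable_decode_eq)
  qed auto
  then have "\<Omega>.expectation (\<lambda>\<omega>. of_bool (number k \<omega> = 0) :: real) = 1"
    using coord_law_number[where m = 0 and k = k] assms by (simp add: number_def)
  moreover have "\<Omega>.expectation (\<lambda>\<omega>. of_bool (number k \<omega> = 0) :: real) =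
     \<Omega>.expectation (\<lambda>\<omega>. indicator {\<omega> \<in> space \<Omega>. number k \<omega> = 0} \<omega>)"
    by (rule Bochner_Integration.integral_cong) (auto simp: indicator_def)
  moreover have "{\<omega> \<in> space \<Omega>. number k \<omega> = 0} \<in> sets \<Omega>" by measurable
  ultimately have "\<Omega>.prob {\<omega> \<in> space \<Omega>. number k \<omega> = 0} = 1" by simp
  from \<Omega>.AE_prob_1[OF this] show ?thesis by eventually_elim simp
qed

text \<open>
  The two times are independent and the second one is diffuse, so the diagonal is null by Fubini's theorem.
\<close>

lemma AE_times_distinct:
  assumes ne: "(k, j) \<noteq> (k', j')" and r: "rate k' \<noteq> 0"
  shows "AE \<omega> in \<Omega>. time (point k j \<omega>) \<noteq> time (point k' j' \<omega>)"
proof -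
  let ?a = "prod_encode (k, Suc j)" and ?b = "prod_encode (k', Suc j')"
  let ?U = "\<lambda>\<omega>. time (\<omega> ?a)" and ?V = "\<lambda>\<omega>. time (\<omega> ?b)"
  have ab: "?a \<noteq> ?b" using ne by (auto simp: prod_encode_eq)
  have comp: "(\<lambda>v. time (v i)) \<in> PiM {i} coord_law \<rightarrow>\<^sub>M borel" for i
  proof -
    have "(\<lambda>v. v i) \<in> PiM {i} coord_law \<rightarrow>\<^sub>M coord_law i" by (rule measurable_component_singleton) simp
    then have "(\<lambda>v. v i) \<in> PiM {i} coord_law \<rightarrow>\<^sub>M N" by (simp cong: measurable_cong_sets add: sets_coord_law)
    then show ?thesis by (rule measurable_compose[OF _ measurable_time])
  qed
  have "\<Omega>.indep_var (PiM {?a} coord_law) (\<lambda>\<omega>. restrict (\<lambda>i. \<omega> i) {?a}) (PiM {?b} coord_law) (\<lambda>\<omega>. restrict (\<lambda>i. \<omega> i) {?b})"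
    by (rule \<Omega>.indep_var_restrict[OF indep_coords]) (use ab in auto)
  from \<Omega>.indep_var_compose[OF this comp comp]
  have "\<Omega>.indep_var borel ?U borel ?V" by (simp add: comp_def)
  then have joint: "distr \<Omega> borel ?U \<Otimes>\<^sub>M distr \<Omega> borel ?V = distr \<Omega> (borel \<Otimes>\<^sub>M borel) (\<lambda>\<omega>. (?U \<omega>, ?V \<omega>))"
    by (simp add: \<Omega>.indep_var_distribution_eq)
  have U: "?U \<in> borel_measurable \<Omega>" and V: "?V \<in> borel_measurable \<Omega>" by measurable
  interpret U: prob_space "distr \<Omega> borel ?U" by (rule \<Omega>.prob_space_distr[OF U])
  interpret V: prob_space "distr \<Omega> borel ?V" by (rule \<Omega>.prob_space_distr[OF V])
  interpret UV: pair_sigma_finite "distr \<Omega> borel ?U" "distr \<Omega> borel ?V" ..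
  \<comment> \<open>The point law of block \<open>k'\<close> is normalised \<open>N\<close>, so it inherits diffuse times.\<close>
  have atomless: "AE y in distr \<Omega> borel ?V. u \<noteq> y" for u
  proof -
    have "AE x in N. time x \<noteq> u"
      using diffuse[of u] by (intro AE_I[of _ _ "{x \<in> space N. time x = u}"]) auto
    then have "AE x in uniform_measure N (B k'). time x \<noteq> u"
      using B_sets[of k'] by (intro AE_uniform_measureI) (auto elim: eventually_mono)
    moreover have "coord_law ?b = uniform_measure N (B k')" using r by (simp add: coord_law_def)
    ultimately have "AE x in coord_law ?b. time x \<noteq> u" by (simp only:)
    then have "AE \<omega> in \<Omega>. ?V \<omega> \<noteq> u" unfolding \<Omega>_def by (rule AE_component[OF UNIV_I])
    then show ?thesis by (subst AE_distr_iff[OF V]) (auto elim: eventually_mono)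
  qed
  have "AE p in distr \<Omega> borel ?U \<Otimes>\<^sub>M distr \<Omega> borel ?V. fst p \<noteq> snd p"
  proof (rule UV.AE_pair_measure)
    have "{p :: real \<times> real. fst p \<noteq> snd p} \<in> sets (borel \<Otimes>\<^sub>M borel)"
      unfolding borel_prod by (intro borel_open open_Collect_neq continuous_intros)
    then show "{p \<in> space (distr \<Omega> borel ?U \<Otimes>\<^sub>M distr \<Omega> borel ?V). fst p \<noteq> snd p} \<in>
        sets (distr \<Omega> borel ?U \<Otimes>\<^sub>M distr \<Omega> borel ?V)"
      by (simp add: space_pair_measure cong: sets_pair_measure_cong)
  qed (use atomless in simp)
  then have "AE p in distr \<Omega> (borel \<Otimes>\<^sub>M borel) (\<lambda>\<omega>. (?U \<omega>, ?V \<omega>)). fst p \<noteq> snd p" by (simp only: joint)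
  then have "AE \<omega> in \<Omega>. fst (?U \<omega>, ?V \<omega>) \<noteq> snd (?U \<omega>, ?V \<omega>)"
    by (rule AE_distrD[rotated]) measurable
  then show ?thesis by (simp add: point_def)
qed

lemma AE_simple_samples: "AE \<omega> in \<Omega>. \<omega> \<in> simple_samples"
proof -
  have "AE \<omega> in \<Omega>. (k, j) \<noteq> (k', j') \<longrightarrow> j < number k \<omega> \<longrightarrow> j' < number k' \<omega> \<longrightarrow>
     time (point k j \<omega>) \<noteq> time (point k' j' \<omega>)" for k j k' j'
  proof (cases "(k, j) \<noteq> (k', j') \<and> rate k' \<noteq> 0")
    case True
    with AE_times_distinct[of k j k' j'] show ?thesis by (auto elim: eventually_mono)
  next
    case False
    then show ?thesis using AE_number_zero[of k'] by (cases "rate k' = 0") (auto elim: eventually_mono)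
  qed
  then have "AE \<omega> in \<Omega>. \<forall>k j k' j'. (k, j) \<noteq> (k', j') \<longrightarrow> j < number k \<omega> \<longrightarrow> j' < number k' \<omega> \<longrightarrow>
     time (point k j \<omega>) \<noteq> time (point k' j' \<omega>)"
    by (simp only: AE_all_countable) blast
  then show ?thesis using AE_space by eventually_elim (simp add: simple_samples_def)
qed

lemma atoms_distinct_times: "x \<in> atoms \<omega> \<Longrightarrow> y \<in> atoms \<omega> \<Longrightarrow> time x = time y \<Longrightarrow> x = y"
proof -
  assume "x \<in> atoms \<omega>" "y \<in> atoms \<omega>" and t: "time x = time y"
  then obtain k j k' j' where "\<omega> \<in> simple_samples" "x = point k j \<omega>" "j < number k \<omega>" "y = point k' j' \<omega>" "j' < number k' \<omega>"
    by (auto simp: atoms_def split: if_splits)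
  then have "(k, j) \<noteq> (k', j') \<longrightarrow> time x \<noteq> time y" unfolding simple_samples_def by simp
  then show "x = y" using t \<open>x = _\<close> \<open>y = _\<close> by auto
qed

lemma atoms_in_space: "\<omega> \<in> space \<Omega> \<Longrightarrow> atoms \<omega> \<subseteq> space N"
  using measurable_space[OF measurable_point] by (auto simp: atoms_def)

lemma count_atoms: "emeasure (count_space UNIV) (atoms \<omega> \<inter> A) = indicator simple_samples \<omega> * total_count A \<omega>"
proof (cases "\<omega> \<in> simple_samples")
  case True
  let ?D = "\<lambda>k. (\<lambda>j. point k j \<omega>) ` {j \<in> {..<number k \<omega>}. point k j \<omega> \<in> A}"
  have inj: "(k, j) = (k', j')" if "j < number k \<omega>" "j' < number k' \<omega>" "point k j \<omega> = point k' j' \<omega>" for k j k' j'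
    using True that unfolding simple_samples_def by fastforce
  have "atoms \<omega> \<inter> A = (\<Union>k. ?D k)" using True by (auto simp: atoms_def)
  also have "emeasure (count_space UNIV) (\<Union>k. ?D k) = (\<Sum>k. emeasure (count_space UNIV) (?D k))"
    by (rule suminf_emeasure[symmetric]) (use inj in \<open>fastforce simp: disjoint_family_on_def\<close>)+
  also have "(\<lambda>k. emeasure (count_space UNIV) (?D k)) = (\<lambda>k. of_nat (block_count A k \<omega>))"
  proof
    fix k
    have "inj_on (\<lambda>j. point k j \<omega>) {j \<in> {..<number k \<omega>}. point k j \<omega> \<in> A}"
      using inj by (auto simp: inj_on_def)
    then have "card (?D k) = card {j \<in> {..<number k \<omega>}. point k j \<omega> \<in> A}" by (rule card_image)
    also have "\<dots> = block_count A k \<omega>"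
      by (simp add: block_count_def Int_def)
    finally show "emeasure (count_space UNIV) (?D k) = of_nat (block_count A k \<omega>)"
      by (simp add: emeasure_count_space)
  qed
  finally show ?thesis using True by (simp add: total_count_def)
qed (simp add: atoms_def)

lemma AE_count_atoms: "AE \<omega> in \<Omega>. \<forall>A. emeasure (count_space UNIV) (atoms \<omega> \<inter> A) = total_count A \<omega>"
  using AE_simple_samples by eventually_elim (simp add: count_atoms)

text \<open>
  Almost surely the set of atoms has \<open>total_count A\<close> elements in \<open>A\<close>, for all \<open>A\<close> at once. So all claims reduce to
  the joint generating function of the total counts.
\<close>

theorem poisson_point_process_atoms: "poisson_point_process N \<Omega> atoms"
  unfolding poisson_point_process_def
proof (intro conjI ballI allI impI)
  let ?K = "\<lambda>A \<omega>. emeasure (count_space UNIV) (atoms \<omega> \<inter> A)"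
  show "prob_space \<Omega>" by (rule \<Omega>.prob_space_axioms)
  show "atoms \<omega> \<subseteq> space N" if "\<omega> \<in> space \<Omega>" for \<omega> by (rule atoms_in_space[OF that])
  have K [measurable]: "?K A \<in> borel_measurable \<Omega>" if [measurable]: "A \<in> sets N" for A
    unfolding count_atoms by measurable
  then show "A \<in> sets N \<Longrightarrow> ?K A \<in> borel_measurable \<Omega>" for A .
  show "\<Omega>.prob {\<omega> \<in> space \<Omega>. ?K A \<omega> = of_nat k} = measure N A ^ k / fact k * exp (- measure N A)"
    if A [measurable]: "A \<in> sets N" and fin: "emeasure N A < \<infinity>" for A k
  proof -
    have "\<Omega>.prob {\<omega> \<in> space \<Omega>. ?K A \<omega> = of_nat k} = \<Omega>.prob {\<omega> \<in> space \<Omega>. total_count A \<omega> = of_nat k}"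
    proof (rule measure_eq_AE)
      show "AE \<omega> in \<Omega>. (\<omega> \<in> {\<omega> \<in> space \<Omega>. ?K A \<omega> = of_nat k}) = (\<omega> \<in> {\<omega> \<in> space \<Omega>. total_count A \<omega> = of_nat k})"
        using AE_count_atoms by eventually_elim simp
    qed measurable
    then show ?thesis using total_count_poisson[OF A fin] by simp
  qed
  show "AE \<omega> in \<Omega>. ?K A \<omega> = \<infinity>" if "A \<in> sets N" "emeasure N A = \<infinity>" for A
    using AE_count_atoms total_count_infinite[OF that] by eventually_elim simp
  fix m :: nat and A assume A: "(\<forall>i<m. A i \<in> sets N) \<and> disjoint_family_on A {..<m}"
  show "\<Omega>.indep_vars (\<lambda>_. borel) (\<lambda>i. ?K (A i)) {..<m}"
  proof (rule \<Omega>.indep_vars_of_generating_functions)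
    show "?K (A i) \<in> borel_measurable \<Omega>" if "i \<in> {..<m}" for i using A that by (intro K) auto
    show "?K (A i) \<omega> \<in> insert \<top> (range of_nat)" for i \<omega>
      unfolding count_atoms using total_count_values[of "A i" \<omega>] by (auto simp: indicator_def image_iff intro: exI[of _ 0])
    fix s :: "nat \<Rightarrow> real" assume s: "\<And>i. i \<in> {..<m} \<Longrightarrow> 0 < s i \<and> s i \<le> 1"
    have eq: "\<Omega>.expectation (\<lambda>\<omega>. \<Prod>i\<in>J. gpow (s i) (?K (A i) \<omega>)) = (\<Prod>i\<in>J. poisson_gf (s i) (emeasure N (A i)))"
      if J: "J \<subseteq> {..<m}" for J
    proof -
      have AJ: "A i \<in> sets N" if "i \<in> J" for i using A J that by auto
      have "\<Omega>.expectation (\<lambda>\<omega>. \<Prod>i\<in>J. gpow (s i) (?K (A i) \<omega>)) = \<Omega>.expectation (\<lambda>\<omega>. \<Prod>i\<in>J. gpow (s i) (total_count (A i) \<omega>))"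
      proof (rule integral_cong_AE)
        show "(\<lambda>\<omega>. \<Prod>i\<in>J. gpow (s i) (?K (A i) \<omega>)) \<in> borel_measurable \<Omega>"
          by (intro borel_measurable_prod measurable_compose[OF K[OF AJ] measurable_gpow])
        show "(\<lambda>\<omega>. \<Prod>i\<in>J. gpow (s i) (total_count (A i) \<omega>)) \<in> borel_measurable \<Omega>"
          by (intro borel_measurable_prod measurable_compose[OF measurable_total_count[OF AJ] measurable_gpow])
        show "AE \<omega> in \<Omega>. (\<Prod>i\<in>J. gpow (s i) (?K (A i) \<omega>)) = (\<Prod>i\<in>J. gpow (s i) (total_count (A i) \<omega>))"
          using AE_count_atoms by eventually_elim simp
      qed
      also have "\<dots> = (\<Prod>i\<in>J. poisson_gf (s i) (emeasure N (A i)))"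
        using J s disjoint_family_on_mono[OF J conjunct2[OF A]]
        by (intro joint_generating_function AJ) (auto intro: finite_subset)
      finally show ?thesis .
    qed
    show "\<Omega>.expectation (\<lambda>\<omega>. \<Prod>i<m. gpow (s i) (?K (A i) \<omega>)) = (\<Prod>i<m. \<Omega>.expectation (\<lambda>\<omega>. gpow (s i) (?K (A i) \<omega>)))"
      unfolding eq[OF order_refl]
    proof (rule prod.cong[OF refl])
      fix i assume "i \<in> {..<m}"
      then show "poisson_gf (s i) (emeasure N (A i)) = \<Omega>.expectation (\<lambda>\<omega>. gpow (s i) (?K (A i) \<omega>))"
        using eq[of "{i}"] by simp
    qed
  qed simp
qed

end

section \<open>Existence of a canonical process\<close>

text \<open>
  The path that records, for each coordinate, the parity of the number of atoms that contain it. At level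
  \<open>n\<close> only locally finitely many atoms matter, so the path is constant on a left neighbourhood of each
  atom, and the atom flips exactly the coordinates of its mark.
\<close>

lemma driven_path_of_parity:
  assumes D: "D \<subseteq> {0..} \<times> structs L S" and pos: "\<And>p. p \<in> D \<Longrightarrow> fst p \<noteq> 0"
    and distinct: "\<And>p q. p \<in> D \<Longrightarrow> q \<in> D \<Longrightarrow> fst p = fst q \<Longrightarrow> p = q"
    and fin: "\<And>m. finite (D \<inter> ({0<..real m} \<times> {M \<in> structs L S. nonzero_at L S n M}))"
    and x: "\<And>t. 0 \<le> t \<Longrightarrow> x t \<in> structs L S"
    and par: "\<And>t a. 0 \<le> t \<Longrightarrow> a \<in> coords L (initial S n) \<Longrightarrow>
       has_tuple a (x t) \<longleftrightarrow> odd (card (D \<inter> ({0<..t} \<times> {M \<in> structs L S. has_tuple a M})))"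
  shows "driven_path L S n D (\<lambda>t. restrict_struct (x t) (initial S n))"
proof -
  define C where "C a t = D \<inter> ({0<..t} \<times> {M \<in> structs L S. has_tuple a M})" for a t
  have up: "initial S n \<subseteq> S" by auto
  have nz: "nonzero_at L S n M" if "a \<in> coords L (initial S n)" "has_tuple a M" "M \<in> structs L S" for a M
    using restrict_zero_iff[OF that(3) up] that(1,2) by blast
  have finC: "finite (C a t)" if a: "a \<in> coords L (initial S n)" for a t
  proof -
    obtain m where "t \<le> real m" using real_arch_simple by blast
    then have "C a t \<subseteq> D \<inter> ({0<..real m} \<times> {M \<in> structs L S. nonzero_at L S n M})"
      unfolding C_def using nz[OF a] by auto
    then show ?thesis using fin finite_subset by blast
  qed
  have req: "restrict_struct (x t) (initial S n) = restrict_struct (x s) (initial S n)"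
    if "0 \<le> s" "s \<le> t" and no: "\<And>p. p \<in> D \<Longrightarrow> s < fst p \<Longrightarrow> fst p \<le> t \<Longrightarrow> \<not> nonzero_at L S n (snd p)" for s t
  proof -
    have "C a t = C a s" if a: "a \<in> coords L (initial S n)" for a
    proof (intro equalityI subsetI)
      fix p assume p: "p \<in> C a t"
      then have "nonzero_at L S n (snd p)" using nz[OF a, of "snd p"] by (auto simp: C_def)
      then have "\<not> s < fst p" using no[of p] p by (auto simp: C_def)
      then show "p \<in> C a s" using p by (auto simp: C_def)
    qed (use that \<open>s \<le> t\<close> in \<open>auto simp: C_def\<close>)
    then have "\<forall>a\<in>coords L (initial S n). has_tuple a (x t) = has_tuple a (x s)"
      using par that unfolding C_def by simp
    then show ?thesis using restrict_eq_iff[OF x x up, of t s] that by simp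
  qed
  show ?thesis
    unfolding driven_path_def
  proof (intro conjI ballI allI impI)
    have "\<forall>a\<in>coords L (initial S n). \<not> has_tuple a (x 0)" using par[of 0] by simp
    then show "restrict_struct (x 0) (initial S n) = zero_struct L (initial S n)"
      using restrict_zero_iff[OF x up, of 0] by blast
  next
    fix p assume p: "p \<in> D"
    obtain u M where uM: "p = (u, M)" by (cases p)
    have u: "0 < u" and M: "M \<in> structs L S" using D pos[OF p] p by (auto simp: uM less_le)
    let ?F = "insert 0 (fst ` {q \<in> D. 0 < fst q \<and> fst q < u \<and> nonzero_at L S n (snd q)})"
    obtain m where m: "u \<le> real m" using real_arch_simple by blast
    have "{q \<in> D. 0 < fst q \<and> fst q < u \<and> nonzero_at L S n (snd q)} \<subseteq>
        D \<inter> ({0<..real m} \<times> {M \<in> structs L S. nonzero_at L S n M})"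
      using D m by auto
    then have finF: "finite ?F" using fin finite_subset by blast
    define s0 where "s0 = Max ?F"
    have s0u: "s0 < u" unfolding s0_def using finF u by (subst Max_less_iff) auto
    have s00: "0 \<le> s0" unfolding s0_def by (rule Max_ge[OF finF]) simp
    have no: "\<not> nonzero_at L S n (snd q)" if "q \<in> D" "s0 < fst q" "fst q < u" for q
    proof
      assume "nonzero_at L S n (snd q)"
      then have "fst q \<in> ?F" using that s00 by simp
      from Max_ge[OF finF this] that show False by (simp add: s0_def)
    qed
    define r where "r = (s0 + u) / 2"
    have r: "s0 < r" "r < u" "0 \<le> r" using s0u s00 by (auto simp: r_def)
    have near: "restrict_struct (x s) (initial S n) = restrict_struct (x r) (initial S n)" if s: "s0 < s" "s < u" for s
    proof (cases "s \<le> r")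
      case True
      then have "restrict_struct (x r) (initial S n) = restrict_struct (x s) (initial S n)"
        using s r s00 by (intro req no) auto
      then show ?thesis ..
    next
      case False
      then show ?thesis using s r s00 by (intro req no) auto
    qed
    have "restrict_struct (x u) (initial S n) = incr (restrict_struct (x r) (initial S n)) (restrict_struct M (initial S n))"
    proof (rule structs_eqI)
      have xr: "x r \<in> structs L S" and xu: "x u \<in> structs L S" using x r u by auto
      note rs = restrict_in_structs[OF xr up] restrict_in_structs[OF M up]
      show "restrict_struct (x u) (initial S n) \<in> structs L (initial S n)" by (rule restrict_in_structs[OF xu up])
      show "incr (restrict_struct (x r) (initial S n)) (restrict_struct M (initial S n)) \<in> structs L (initial S n)"
        by (rule incr_in_structs[OF rs])
      fix a assume a: "a \<in> coords L (initial S n)"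
      have C: "C a u = C a r \<union> (if has_tuple a M then {(u, M)} else {})"
      proof (intro equalityI subsetI)
        fix q assume q: "q \<in> C a u"
        show "q \<in> C a r \<union> (if has_tuple a M then {(u, M)} else {})"
        proof (cases "fst q = u")
          case True
          then have "q = (u, M)" using distinct[of q p] q p by (simp add: C_def uM)
          then show ?thesis using q by (auto simp: C_def)
        next
          case False
          then have "fst q < u" using q by (auto simp: C_def)
          moreover have "nonzero_at L S n (snd q)" using q nz[OF a, of "snd q"] by (auto simp: C_def)
          ultimately have "\<not> s0 < fst q" using no[of q] q by (auto simp: C_def)
          then show ?thesis using q r by (auto simp: C_def)
        qed
      next
        fix q assume "q \<in> C a r \<union> (if has_tuple a M then {(u, M)} else {})"
        then show "q \<in> C a u" using r p u M by (auto simp: C_def uM split: if_splits)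
      qed
      have "(u, M) \<notin> C a r" using r by (auto simp: C_def)
      then have "odd (card (C a u)) \<longleftrightarrow> odd (card (C a r)) \<noteq> has_tuple a M"
        unfolding C using finC[OF a, of r] by simp
      then have "has_tuple a (x u) \<longleftrightarrow> has_tuple a (x r) \<noteq> has_tuple a M"
        using par[OF _ a, of u] par[OF _ a, of r] u r unfolding C_def by simp
      then show "has_tuple a (restrict_struct (x u) (initial S n)) =
          has_tuple a (incr (restrict_struct (x r) (initial S n)) (restrict_struct M (initial S n)))"
        unfolding has_tuple_incr[OF rs a] has_tuple_restrict[OF xu a] has_tuple_restrict[OF xr a] has_tuple_restrict[OF M a] .
    qed
    moreover have "\<forall>\<^sub>F s in at_left u. restrict_struct (x s) (initial S n) = restrict_struct (x r) (initial S n)"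
      unfolding eventually_at_left_field using s0u near by blast
    ultimately show "case p of (t, M) \<Rightarrow> nonzero_at L S n M \<longrightarrow>
       (\<exists>Y. (\<forall>\<^sub>F s in at_left t. restrict_struct (x s) (initial S n) = Y) \<and>
          restrict_struct (x t) (initial S n) = incr Y (restrict_struct M (initial S n)))"
      unfolding uM by blast
  next
    fix s t assume st: "0 \<le> s \<and> s \<le> t \<and> (\<forall>(u, M)\<in>D. s < u \<and> u \<le> t \<longrightarrow> restrict_struct M (initial S n) = zero_struct L (initial S n))"
    show "restrict_struct (x t) (initial S n) = restrict_struct (x s) (initial S n)"
    proof (rule req)
      have all: "\<forall>p\<in>D. s < fst p \<and> fst p \<le> t \<longrightarrow> restrict_struct (snd p) (initial S n) = zero_struct L (initial S n)"
        using st by (simp add: case_prod_beta')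
      fix p assume "p \<in> D" "s < fst p" "fst p \<le> t"
      then show "\<not> nonzero_at L S n (snd p)" using bspec[OF all] by simp
    qed (use st in auto)
  qed
qed

text \<open>
  Apply the Poisson construction to \<open>dt \<otimes> \<mu>\<close> with the time coordinate as diffuse function; the number \<open>n\<close> is
  encoded by the point with time \<open>n\<close> and the zero structure as mark. The process records parities of
  counts. An infinite count is given parity 0, which happens with probability 0.
\<close>

lemma ex_canonical_levy_process:
  assumes S: "S \<subseteq> {1..}" and \<mu>: "levy_measure L S \<mu>"
  shows "\<exists>(Q :: atom_sequence measure) \<Delta> Y. canonical_levy_process L S \<mu> Q \<Delta> Y"
proof -
  let ?\<nu> = "jump_intensity \<mu>"
  have sets: "sets \<mu> = sets (struct_borel L S)" using \<mu> by (simp add: levy_measure_def)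
  have sp: "space \<mu> = structs L S" using sets_eq_imp_space_eq[OF sets] by (simp add: space_struct_borel)
  have sp\<nu>: "space ?\<nu> = {0..} \<times> structs L S" by (simp add: space_jump_intensity sp)
  note sf = levy_measure_sigma_finite[OF S \<mu>]
  interpret \<mu>: sigma_finite_measure \<mu> by (rule sf)
  interpret T: sigma_finite_measure "restrict_space lborel {0::real..}"
    by (rule sigma_finite_measure_restrict_space) (simp_all add: lborel.sigma_finite_measure_axioms)
  interpret pair: pair_sigma_finite "restrict_space lborel {0::real..}" \<mu> ..
  interpret \<nu>: sigma_finite_measure ?\<nu>
    unfolding jump_intensity_def by (rule pair.sigma_finite_measure_axioms)
  have "\<exists>B :: nat \<Rightarrow> _. range B \<subseteq> sets ?\<nu> \<and> (\<Union>i. B i) = space ?\<nu> \<and> (\<forall>i. emeasure ?\<nu> (B i) \<noteq> \<infinity>) \<and> disjoint_family B"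
  proof (rule \<nu>.sigma_finite_disjoint)
    fix A :: "nat \<Rightarrow> (real \<times> lstruct) set"
    assume "range A \<subseteq> sets ?\<nu>" "(\<Union>i. A i) = space ?\<nu>" "\<And>i. emeasure ?\<nu> (A i) \<noteq> \<infinity>" "disjoint_family A"
    then show ?thesis by (intro exI[of _ A]) simp
  qed
  then obtain B :: "nat \<Rightarrow> (real \<times> lstruct) set" where
    B: "range B \<subseteq> sets ?\<nu>" "(\<Union>i. B i) = space ?\<nu>" "\<And>i. emeasure ?\<nu> (B i) \<noteq> \<infinity>" "disjoint_family B"
    by auto
  have fst_meas: "fst \<in> borel_measurable ?\<nu>"
  proof -
    have "(\<lambda>x. x) \<in> restrict_space lborel {0::real..} \<rightarrow>\<^sub>M borel"
      by (rule measurable_restrict_space1) simp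
    from measurable_compose[OF measurable_fst this]
    show ?thesis by (simp add: jump_intensity_def)
  qed
  have fst_null: "emeasure ?\<nu> {x \<in> space ?\<nu>. fst x = u} = 0" for u
  proof -
    have I: "{u} \<inter> {0..} \<in> sets (restrict_space lborel {0..})" by (auto simp: sets_restrict_space_iff)
    have "{x \<in> space ?\<nu>. fst x = u} = ({u} \<inter> {0..}) \<times> space \<mu>" by (auto simp: sp\<nu> sp)
    then have "emeasure ?\<nu> {x \<in> space ?\<nu>. fst x = u} = emeasure (restrict_space lborel {0..}) ({u} \<inter> {0..}) * emeasure \<mu> (space \<mu>)"
      unfolding jump_intensity_def using \<mu>.emeasure_pair_measure_Times[OF I sets.top] by simp
    also have "emeasure (restrict_space lborel {0..}) ({u} \<inter> {0..}) = 0"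
    proof (subst emeasure_restrict_space)
      show "emeasure lborel ({u} \<inter> {0..}) = 0"
        by (rule emeasure_lborel_countable) simp
    qed auto
    finally show ?thesis by simp
  qed
  interpret poisson_construction ?\<nu> B "\<lambda>n. (real n, zero_struct L S)" "\<lambda>p. nat \<lfloor>fst p\<rfloor>" fst
  proof
    show "B k \<in> sets ?\<nu>" for k using B(1) by auto
    show "(\<lambda>p. nat \<lfloor>fst p\<rfloor>) \<in> ?\<nu> \<rightarrow>\<^sub>M count_space UNIV"
      by (rule measurable_compose[OF fst_meas]) measurable
  qed (use B fst_meas fst_null zero_struct_in_structs in \<open>auto simp: sp\<nu>\<close>)
  let ?K = "\<lambda>A \<omega>. emeasure (count_space UNIV) (atoms \<omega> \<inter> A)"
  define H where "H a = {M \<in> structs L S. has_tuple a M}" for a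
  define Y where "Y t \<omega> = struct_of L S {a. on_nat (\<lambda>n. of_bool (odd n)) (?K ({0<..t} \<times> H a) \<omega>) = 1}" for t \<omega>
  note ppp = poisson_point_process_atoms
  have K: "?K A \<in> borel_measurable \<Omega>" if "A \<in> sets ?\<nu>" for A
    using ppp that by (simp add: poisson_point_process_def)
  have pois: "measure \<Omega> {\<omega> \<in> space \<Omega>. ?K A \<omega> = of_nat k} = measure ?\<nu> A ^ k / fact k * exp (- measure ?\<nu> A)"
    if "A \<in> sets ?\<nu>" "emeasure ?\<nu> A < \<infinity>" for A k
    using ppp that unfolding poisson_point_process_def by blast
  have Y: "Y t \<in> \<Omega> \<rightarrow>\<^sub>M struct_borel L S" if t: "0 \<le> t" for t
  proof (rule measurable_struct_borelI[OF S])
    show "Y t \<omega> \<in> structs L S" for \<omega> unfolding Y_def by (rule struct_of_in_structs)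
    fix a assume a: "a \<in> coords L S"
    have A: "{0<..t} \<times> H a \<in> sets ?\<nu>"
      using jump_intensity_rectangle(1)[OF sf _ order_refl t, of "H a"] has_tuple_in_borel[OF S a] by (simp add: sets H_def)
    have "(\<lambda>\<omega>. on_nat (\<lambda>n. of_bool (odd n)) (?K ({0<..t} \<times> H a) \<omega>)) \<in> borel_measurable \<Omega>"
      by (rule measurable_compose[OF K[OF A] measurable_on_nat])
    then have "{\<omega> \<in> space \<Omega>. on_nat (\<lambda>n. of_bool (odd n)) (?K ({0<..t} \<times> H a) \<omega>) = 1} \<in> sets \<Omega>"
      by measurable
    then show "{\<omega> \<in> space \<Omega>. has_tuple a (Y t \<omega>)} \<in> sets \<Omega>"
      unfolding Y_def has_tuple_struct_of[OF a] by simp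
  qed
  have start: "AE \<omega> in \<Omega>. \<forall>p\<in>atoms \<omega>. fst p \<noteq> 0"
  proof -
    let ?Z = "{x \<in> space ?\<nu>. fst x = 0}"
    have Z: "?Z \<in> sets ?\<nu>"
      using measurable_sets[OF fst_meas, of "{0}"] by (simp add: vimage_def Int_def conj_commute)
    have "measure \<Omega> {\<omega> \<in> space \<Omega>. ?K ?Z \<omega> = of_nat 0} = 1"
      using pois[OF Z, of 0] fst_null[of 0] by (simp add: measure_def)
    from \<Omega>.AE_prob_1[OF this] AE_space show ?thesis
    proof eventually_elim
      case (elim \<omega>)
      then have "atoms \<omega> \<inter> ?Z = {}" by (simp add: emeasure_count_space_eq_0)
      then show ?case using atoms_in_space[OF elim(2)] by blast
    qed
  qed
  have "AE \<omega> in \<Omega>. \<forall>n\<ge>1. driven_path L S n (atoms \<omega>) (\<lambda>t. restrict_struct (Y t \<omega>) (initial S n))"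
    using locally_finite_atoms[OF S \<mu> ppp] start AE_space
  proof eventually_elim
    case (elim \<omega>)
    show ?case
    proof (intro allI impI driven_path_of_parity)
      fix n :: nat assume n: "1 \<le> n"
      show "atoms \<omega> \<subseteq> {0..} \<times> structs L S" using atoms_in_space[OF elim(3)] sp\<nu> by simp
      show fin\<omega>: "finite (atoms \<omega> \<inter> ({0<..real m} \<times> {M \<in> structs L S. nonzero_at L S n M}))" for m
        using elim(1) n by simp
      show "Y t \<omega> \<in> structs L S" for t unfolding Y_def by (rule struct_of_in_structs)
      show "p = q" if "p \<in> atoms \<omega>" "q \<in> atoms \<omega>" "fst p = fst q" for p q
        using atoms_distinct_times[OF that] .
      show "fst p \<noteq> 0" if "p \<in> atoms \<omega>" for p using elim(2) that by blast
      fix t :: real and a assume t: "0 \<le> t" and a: "a \<in> coords L (initial S n)"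
      have up: "initial S n \<subseteq> S" by auto
      obtain m where m: "t \<le> real m" using real_arch_simple by blast
      have "nonzero_at L S n M" if "M \<in> structs L S" "has_tuple a M" for M
        using restrict_zero_iff[OF that(1) up] a that(2) by blast
      then have "atoms \<omega> \<inter> ({0<..t} \<times> H a) \<subseteq> atoms \<omega> \<inter> ({0<..real m} \<times> {M \<in> structs L S. nonzero_at L S n M})"
        using m by (auto simp: H_def)
      then have "finite (atoms \<omega> \<inter> ({0<..t} \<times> H a))" using fin\<omega> finite_subset by blast
      then have "?K ({0<..t} \<times> H a) \<omega> = of_nat (card (atoms \<omega> \<inter> ({0<..t} \<times> H a)))"
        by (simp add: emeasure_count_space)
      then have "has_tuple a (Y t \<omega>) \<longleftrightarrow> odd (card (atoms \<omega> \<inter> ({0<..t} \<times> H a)))"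
        unfolding Y_def has_tuple_struct_of[OF initial_coords[OF a]] by simp
      then show "has_tuple a (Y t \<omega>) \<longleftrightarrow> odd (card (atoms \<omega> \<inter> ({0<..t} \<times> {M \<in> structs L S. has_tuple a M})))"
        unfolding H_def .
    qed
  qed
  then have "canonical_levy_process L S \<mu> \<Omega> atoms Y"
    unfolding canonical_levy_process_def using \<mu> ppp Y by blast
  then show ?thesis by blast
qed

section \<open>The representation theorem\<close>

theorem theorem4p13:
  fixes L :: "nat list" and S :: "nat set"
    and P :: "'a measure" and X :: "real \<Rightarrow> 'a \<Rightarrow> lstruct"
  assumes "sorted L" and "L \<noteq> []" and "last L \<ge> 1"
    and "S \<subseteq> {1..}"
    and "comb_levy_process P L S X"
  shows
    "(\<forall>\<mu>. is_rate_measure L S P X \<mu> \<longrightarrow>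
        (\<exists>(Q :: atom_sequence measure) \<Delta> Y. canonical_levy_process L S \<mu> Q \<Delta> Y) \<and>
        (\<forall>(Q :: 'b measure) \<Delta> Y. canonical_levy_process L S \<mu> Q \<Delta> Y \<longrightarrow>
           same_fdds (struct_borel L S) P X Q Y)) \<and>
     (\<exists>\<mu>. levy_measure L S \<mu> \<and>
        (\<exists>(Q :: atom_sequence measure) \<Delta> Y. canonical_levy_process L S \<mu> Q \<Delta> Y \<and>
           same_fdds (struct_borel L S) P X Q Y))"
proof -
  note S = \<open>S \<subseteq> {1..}\<close>
  interpret comb_levy_process P L S X by fact
  show ?thesis
  proof (intro conjI allI impI)
    fix \<mu> assume \<mu>: "is_rate_measure L S P X \<mu>"
    then show "\<exists>(Q :: atom_sequence measure) \<Delta> Y. canonical_levy_process L S \<mu> Q \<Delta> Y"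
      by (intro ex_canonical_levy_process[OF S]) (simp add: is_rate_measure_def)
    show "same_fdds (struct_borel L S) P X Q Y" if "canonical_levy_process L S \<mu> Q \<Delta> Y"
      for Q :: "'b measure" and \<Delta> Y
      by (rule has_exponents_imp_same_fdds[OF S rate_measure_has_exponents[OF S \<mu>] canonical_has_exponents[OF S that]])
  next
    obtain \<mu> where \<mu>: "levy_measure L S \<mu>" "has_exponents L S \<mu> P X" using ex_levy_measure[OF S] by blast
    obtain Q :: "atom_sequence measure" and \<Delta> Y where "canonical_levy_process L S \<mu> Q \<Delta> Y"
      using ex_canonical_levy_process[OF S \<mu>(1)] by blast
    with \<mu> has_exponents_imp_same_fdds[OF S \<mu>(2) canonical_has_exponents[OF S]]
    show "\<exists>\<mu>. levy_measure L S \<mu> \<and>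
        (\<exists>(Q :: atom_sequence measure) \<Delta> Y. canonical_levy_process L S \<mu> Q \<Delta> Y \<and>
           same_fdds (struct_borel L S) P X Q Y)" by blast
  qed
qed

end
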